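(* Let $|q|<1$ and $(a,b)$ a pair of coprime integers with $1\leq b<a$. If $a\le 2b$ then \[ \sum_{m\in\mathbb Z_{\ge0}^{d}}\frac{q^{m^TCm}}{(q)_{\tau_1m_1}}\prod_{j=2}^{d}\begin{bmatrix}\tau_jm_j+n_j\\ \tau_jm_j\end{bmatrix} =\frac{(q^{ab},q^{ab+1},q^{2ab+1};q^{2ab+1})_\infty}{(q;q)_\infty}, \] and if $a>2b$ then \[ \sum_{\substack{n_1,\dots,n_{a_0}\ge0\\ m_{a_0+1},\dots,m_d\ge0}}\frac{q^{\sum_{i=1}^{a_0}(N_i+m_{a_0+1})^2+\sum_{j,k=a_0+1}^{d}m_jC_{j,k}m_k}}{(q)_{n_1}\cdots(q)_{n_{a_0}}(q)_{\tau_{a_0+1}m_{a_0+1}}}\prod_{j=a_0+2}^d\begin{bmatrix}\tau_jm_j+n_j\\ \tau_jm_j\end{bmatrix} =\frac{(q^{ab},q^{ab+1},q^{2ab+1};q^{2ab+1})_\infty}{(q;q)_\infty}. \]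
   Context: Notation: $(x;q)_n=\prod_{i=0}^{n-1}(1-xq^i)$ (also for $n=\infty$), $(q)_n=(q;q)_n$, $(x_1,\dots,x_r;q)_\infty=\prod_i(x_i;q)_\infty$; $\begin{bmatrix}n\\ m\end{bmatrix}=\frac{(q)_n}{(q)_m(q)_{n-m}}$ if $m,n-m$ are nonnegative integers, $0$ otherwise. Continued-fraction data: for coprime $1\le b<a$ let $\mathrm{cf}(a,b)=(a/b-1)^{s}$ with $s=1$ if $a>2b$, $s=-1$ if $a<2b$, $s=0$ if $a=2b$. Write $\mathrm{cf}(a,b)=[a_0,\dots,a_n]$ (regular continued fraction with positive integer partial quotients), choosing $a_n\ge 2$ when $(a,b)\ne(2,1)$ (and $\mathrm{cf}(2,1)=[1]$). Put $t_0=0$, $t_j=a_0+\dots+a_{j-1}$ ($1\le j\le n+1$), $d=t_{n+1}$. $\mathcal I$ is the $d\times d$ matrix with $\mathcal I_{j,k}=\delta_{j,k+1}+\delta_{j,k-1}$ if $j\notin\{t_1,\dots,t_{n+1}\}$ and $\delta_{j,k+1}+\delta_{j,k}-\delta_{j,k-1}$ otherwise; $C=2I-\mathcal I$. $\tau_j=2$ for $j<d$, $\tau_d=1$. $m^TCm=\sum_{j,k}m_jC_{j,k}m_k$. In the case $a\le 2b$, $n_j=-\sum_{k=1}^dC_{j,k}m_k$ for $j\ge 2$. In the case $a>2b$: $N_i=n_i+\dots+n_{a_0}$; $n_j=-\sum_{k=a_0+1}^dC_{j,k}m_k$ for $j\ge a_0+2$; if $d=a_0$ (exactly when $b=1$)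 there are no variables $m_{a_0+1},\dots,m_d$, one sets $m_{a_0+1}=0$, and the sum over $j,k\ge a_0+1$ and the final product are empty. *)

theory Defs
  imports "HOL-Analysis.Analysis"
begin

definition qpoch :: "complex \<Rightarrow> complex \<Rightarrow> nat \<Rightarrow> complex" where
  "qpoch x q n = (\<Prod>i<n. 1 - x * q ^ i)"

definition qpoch_inf :: "complex \<Rightarrow> complex \<Rightarrow> complex" where
  "qpoch_inf x q = (\<Prod>i. 1 - x * q ^ i)"

definition qbinom :: "complex \<Rightarrow> int \<Rightarrow> int \<Rightarrow> complex" where
  "qbinom q N M =
     (if 0 \<le> M \<and> M \<le> N
      then qpoch q q (nat N) / (qpoch q q (nat M) * qpoch q q (nat (N - M)))
      else 0)"

fun cfval :: "nat list \<Rightarrow> rat" where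
  "cfval [] = 0"
| "cfval [x] = of_nat x"
| "cfval (x # y # r) = of_nat x + 1 / cfval (y # r)"

definition cf_target :: "nat \<Rightarrow> nat \<Rightarrow> rat" where
  "cf_target a b =
     (if a > 2 * b then of_nat a / of_nat b - 1
      else if a < 2 * b then inverse (of_nat a / of_nat b - 1)
      else 1)"

definition cf :: "nat \<Rightarrow> nat \<Rightarrow> nat list" where
  "cf a b = (THE l. l \<noteq> [] \<and> (\<forall>x\<in>set l. 0 < x) \<and>
                    (if (a, b) = (2, 1) then l = [1] else 2 \<le> last l) \<and>
                    cfval l = cf_target a b)"

definition cf_a0 :: "nat \<Rightarrow> nat \<Rightarrow> nat" where
  "cf_a0 a b = hd (cf a b)"

definition cfd :: "nat \<Rightarrow> nat \<Rightarrow> nat" where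
  "cfd a b = sum_list (cf a b)"

definition tset :: "nat \<Rightarrow> nat \<Rightarrow> nat set" where
  "tset a b = {sum_list (take j (cf a b)) | j. 1 \<le> j \<and> j \<le> length (cf a b)}"

text \<open>The matrix script-I (indices 1..d).\<close>
definition Imat :: "nat \<Rightarrow> nat \<Rightarrow> nat \<Rightarrow> nat \<Rightarrow> int" where
  "Imat a b j k =
     (if j \<notin> tset a b
      then (if j = k + 1 then 1 else 0) + (if j + 1 = k then 1 else 0)
      else (if j = k + 1 then 1 else 0) + (if j = k then 1 else 0) - (if j + 1 = k then 1 else 0))"

definition Cmat :: "nat \<Rightarrow> nat \<Rightarrow> nat \<Rightarrow> nat \<Rightarrow> int" where
  "Cmat a b j k = (if j = k then 2 else 0) - Imat a b j k"

definition tau :: "nat \<Rightarrow> nat \<Rightarrow> nat \<Rightarrow> nat" where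
  "tau a b j = (if j < cfd a b then 2 else 1)"

end

theory Submission
  imports Defs
begin

text \<open>
  Everything rests on the Burge transform (a form of the \<open>q\<close>-Saalschutz sum), which turns
  \<open>\<Sum>\<^sub>j (-1)^j q^(c e j^2 + j (j + 1) / 2)\<close> times a product of two \<open>q\<close>-binomials with shifts \<open>c j\<close>
  and \<open>e j\<close> into the same sum for \<open>(c + e, e)\<close>; the symmetry of the sum exchanges \<open>c\<close> and \<open>e\<close>.
  Starting from \<open>(1, 1)\<close>, where the sum is a single \<open>q\<close>-binomial, these two moves reach every
  coprime pair by running the Euclidean algorithm backwards, and the continued fraction of \<open>c / e\<close>
  records when the two entries are exchanged. Each Burge step contributes one summation variable and
  one \<open>q\<close>-binomial, which produces the fermionic side. Letting one and then both parameters tend to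
  infinity leaves a theta series, which the triple product evaluates.
  The case \<open>q = 0\<close> is separate, since the recurrences divide by powers of \<open>q\<close>.
\<close>

section \<open>q-Pochhammer symbols and the q-Saalschutz sum\<close>

text \<open>After the first limit a Burge sum becomes a \<open>bailey_sum\<close>, in which only one
  of the two entries still shifts the denominators. From there \<open>a\<close> grows by
  \<open>b\<close> at a time through Bailey's lemma, whose new variable carries no
  \<open>q\<close>-binomial. Hence for \<open>a > 2 * b\<close> the first partial quotient
  contributes variables \<open>n\<close> with plain factors 1/(q)_n, while for
  \<open>a \<le> 2 * b\<close> only the final limit adds a \<open>b\<close>. If \<open>b = 1\<close>
  and \<open>a > 2\<close>, the chain has to start from (0, 1), which is outside the Burge tree; its
  sum is a Kronecker delta, found by inverting one Bailey step from (1, 1). The matrix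
  \<open>C\<close> fits because row j of C m is m_j - m_(j-1) + i_j, where i_j is the variable of
  the j-th Burge step. This makes the \<open>q\<close>-binomials agree, and the quadratic form
  becomes the first m squared plus the squares of the i_j. The analytic obstacle is unconditional
  convergence: the recursions only give finite sums for a fixed value of the outermost variable. A
  bound on the sum of absolute values, polynomial in that value, is therefore carried along; the
  factor q^(k^2) of the final limit beats it.\<close>

lemma has_sum_tannery:
  fixes f :: "nat \<Rightarrow> 'a \<Rightarrow> complex" and e :: "nat \<Rightarrow> 'a"
  assumes e: "bij e"
    and lim: "\<And>x. (\<lambda>n. f n x) \<longlonglongrightarrow> g x"
    and bound: "\<And>n x. norm (f n x) \<le> h x"
    and h: "h summable_on UNIV"
    and s: "\<And>n. (f n has_sum s n) UNIV"
    and t: "s \<longlonglongrightarrow> t"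
  shows "(g has_sum t) UNIV"
proof -
  \<comment> \<open>\<open>tannerys_theorem\<close> concerns series over the naturals, so all
    families are pulled back along the enumeration \<open>e\<close>.\<close>
  have he: "summable (\<lambda>k. h (e k))"
    using h summable_on_reindex_bij_betw[OF e, of h] summable_on_imp_summable by blast
  have *: "(\<forall>\<^sub>F n in sequentially. summable (\<lambda>k. norm (f n (e k)))) \<and>
     summable (\<lambda>n. norm (g (e n))) \<and>
     (\<lambda>n. suminf (\<lambda>k. f n (e k))) \<longlonglongrightarrow> (\<Sum>k. g (e k))"
    by (rule tannerys_theorem[where M = "\<lambda>k. h (e k)"]) (use lim bound he in \<open>auto intro!: always_eventually\<close>)
  have "(\<lambda>k. f n (e k)) sums s n" for n
    using s[of n] has_sum_reindex_bij_betw[OF e, of "f n"] has_sum_imp_sums by blast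
  hence "suminf (\<lambda>k. f n (e k)) = s n" for n by (simp add: sums_iff)
  hence "s \<longlonglongrightarrow> (\<Sum>k. g (e k))" using * by simp
  hence "t = (\<Sum>k. g (e k))" using t LIMSEQ_unique by blast
  moreover have "((\<lambda>k. g (e k)) has_sum (\<Sum>k. g (e k))) UNIV"
    using * by (intro norm_summable_imp_has_sum) (auto simp: summable_norm_cancel)
  ultimately show ?thesis using has_sum_reindex_bij_betw[OF e, of g] by simp
qed

lemma qpoch_inf_LIMSEQ:
  assumes "norm q < 1"
  shows "(\<lambda>n. qpoch x q n) \<longlonglongrightarrow> qpoch_inf x q"
proof -
  have "summable (\<lambda>i. norm x * norm q ^ i)"
    using assms by (intro summable_mult summable_geometric) auto
  hence "summable (\<lambda>i. norm ((1 - x * q ^ i) - 1))"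
    by (simp add: norm_mult norm_power)
  hence "convergent_prod (\<lambda>i. 1 - x * q ^ i)"
    using abs_convergent_prod_conv_summable abs_convergent_prod_imp_convergent_prod by blast
  hence "(\<lambda>i. 1 - x * q ^ i) has_prod qpoch_inf x q"
    unfolding qpoch_inf_def by (simp add: convergent_prod_has_prod_iff)
  thus ?thesis
    unfolding qpoch_def by (rule has_prod_imp_tendsto')
qed

lemma qpoch_nonzero:
  assumes "norm q < 1"
  shows "qpoch q q n \<noteq> 0"
proof -
  have "q * q ^ i \<noteq> 1" for i
  proof
    assume "q * q ^ i = 1"
    hence "norm q ^ Suc i = 1" by (metis norm_one norm_power power_Suc)
    moreover have "norm q ^ Suc i < 1" using assms power_le_one[of "norm q" i] mult_left_le[of "norm q ^ i" "norm q"] by auto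
    ultimately show False by simp
  qed
  thus ?thesis unfolding qpoch_def by (auto simp: prod_zero_iff)
qed

lemma qpoch_inf_nonzero:
  assumes "norm q < 1"
  shows "qpoch_inf q q \<noteq> 0"
proof -
  have "summable (\<lambda>i. norm q * norm q ^ i)"
    using assms by (intro summable_mult summable_geometric) auto
  hence "summable (\<lambda>i. norm ((1 - q * q ^ i) - 1))"
    by (simp add: norm_mult norm_power)
  hence *: "convergent_prod (\<lambda>i. 1 - q * q ^ i)"
    using abs_convergent_prod_conv_summable abs_convergent_prod_imp_convergent_prod by blast
  have "1 - q * q ^ i \<noteq> 0" for i
    using qpoch_nonzero[OF assms, of "Suc i"] by (auto simp: qpoch_def)
  thus ?thesis unfolding qpoch_inf_def using prodinf_nonzero[OF *] by blast
qed

text \<open>With \<open>qrf q n = 0\<close> for negative \<open>n\<close>, the recurrences below hold for all integers,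
  and the vanishing of binomial coefficients outside their range is automatic.\<close>

definition qpf :: "complex \<Rightarrow> int \<Rightarrow> complex" where
  "qpf q n = qpoch q q (nat n)"

definition qrf :: "complex \<Rightarrow> int \<Rightarrow> complex" where
  "qrf q n = (if n < 0 then 0 else 1 / qpoch q q (nat n))"

locale nome =
  fixes q :: complex
  assumes q_nonzero [simp]: "q \<noteq> 0" and q_less: "norm q < 1"
begin

abbreviation pf :: "int \<Rightarrow> complex" where "pf \<equiv> qpf q"
abbreviation rf :: "int \<Rightarrow> complex" where "rf \<equiv> qrf q"

lemma pf_nonzero: "pf n \<noteq> 0"
  by (simp add: qpf_def qpoch_nonzero q_less)

lemma rf_neg [simp]: "n < 0 \<Longrightarrow> rf n = 0"
  by (simp add: qrf_def)

lemma pf_rf: "n \<ge> 0 \<Longrightarrow> pf n * rf n = 1"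
  using pf_nonzero[of n] by (simp add: qrf_def qpf_def)

lemma rf_eq: "n \<ge> 0 \<Longrightarrow> rf n = 1 / pf n"
  by (simp add: qrf_def qpf_def)

lemma pf_0 [simp]: "pf 0 = 1" and rf_0 [simp]: "rf 0 = 1"
  by (simp_all add: qpf_def qrf_def qpoch_def)

lemma pf_rec: "n \<ge> 0 \<Longrightarrow> pf (n + 1) = (1 - q powi (n + 1)) * pf n"
proof -
  assume n: "n \<ge> 0"
  have "nat (n + 1) = Suc (nat n)" using n by simp
  moreover have "q powi (n + 1) = q ^ Suc (nat n)"
    using n by (simp add: power_int_nonneg_exp nat_add_distrib)
  ultimately show ?thesis by (simp add: qpf_def qpoch_def)
qed

text \<open>At \<open>n = 0\<close> the factor \<open>1 - q powi n\<close> vanishes, in agreement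
  with \<open>rf (- 1) = 0\<close>; so no boundary case arises when the recurrence is used.\<close>

lemma rf_rec: "rf (n - 1) = (1 - q powi n) * rf n"
proof (cases "n \<ge> 1")
  case True
  have "pf n = (1 - q powi n) * pf (n - 1)" using pf_rec[of "n - 1"] True by simp
  thus ?thesis using True pf_nonzero[of n] pf_nonzero[of "n - 1"] by (auto simp: rf_eq)
next
  case False
  hence "n = 0 \<or> n < 0" by auto
  thus ?thesis by auto
qed

lemma qbinom_eq: "N \<ge> 0 \<Longrightarrow> qbinom q N M = pf N * rf M * rf (N - M)"
  by (auto simp: qbinom_def qpf_def qrf_def)

lemma qbinom_zero: "M > N \<or> M < 0 \<Longrightarrow> qbinom q N M = 0"
  by (auto simp: qbinom_def)

lemma powi_add: "q powi (m + n) = q powi m * q powi n"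
  using q_nonzero by (simp add: power_int_add)

lemma powi_diff: "q powi (m - n) = q powi m / q powi n"
  using q_nonzero by (simp add: power_int_diff)

lemma pf_LIMSEQ: "(\<lambda>n. pf (int n)) \<longlonglongrightarrow> qpoch_inf q q"
  unfolding qpf_def using qpoch_inf_LIMSEQ[OF q_less] by simp

lemma filterlim_shift: "filterlim (\<lambda>n. nat (int n * c + k)) sequentially sequentially" if "c > 0"
proof -
  have "eventually (\<lambda>n. nat (int n * c + k) \<ge> Z) sequentially" for Z
  proof (rule eventually_sequentiallyI)
    fix n assume n: "nat (int Z - k) \<le> n"
    have "int n * c \<ge> int n * 1" using that by (intro mult_left_mono) auto
    thus "Z \<le> nat (int n * c + k)" using n by linarith
  qed
  thus ?thesis by (simp add: filterlim_at_top)
qed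

lemma pf_tendsto: "c > 0 \<Longrightarrow> (\<lambda>n. pf (int n * c + k)) \<longlonglongrightarrow> qpoch_inf q q"
  unfolding qpf_def
  by (rule filterlim_compose[OF qpoch_inf_LIMSEQ[OF q_less] filterlim_shift])

lemma rf_tendsto: assumes "c > 0" shows "(\<lambda>n. rf (int n * c + k)) \<longlonglongrightarrow> 1 / qpoch_inf q q"
proof -
  have "(\<lambda>n. 1 / pf (int n * c + k)) \<longlonglongrightarrow> 1 / qpoch_inf q q"
    by (intro tendsto_intros pf_tendsto assms qpoch_inf_nonzero q_less)
  moreover have "eventually (\<lambda>n. 1 / pf (int n * c + k) = rf (int n * c + k)) sequentially"
  proof (rule eventually_sequentiallyI)
    fix n assume n: "nat (- k) \<le> n"
    have "int n * c \<ge> int n * 1" using assms by (intro mult_left_mono) auto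
    hence "int n * c + k \<ge> 0" using n by linarith
    thus "1 / pf (int n * c + k) = rf (int n * c + k)" by (simp add: rf_eq)
  qed
  ultimately show ?thesis by (rule Lim_transform_eventually)
qed

lemma norm_pf_rf_bounded:
  obtains K where "K \<ge> 1" "\<And>n. norm (pf n) \<le> K" "\<And>n. norm (rf n) \<le> K"
proof -
  have "Bseq (\<lambda>n. pf (int n))" using pf_LIMSEQ convergentI convergent_imp_Bseq by blast
  then obtain K1 where K1: "\<And>n. norm (pf (int n)) \<le> K1" by (auto simp: Bseq_def)
  have "Bseq (\<lambda>n. rf (int n))"
    using rf_tendsto[of 1 0] convergentI convergent_imp_Bseq by fastforce
  then obtain K2 where K2: "\<And>n. norm (rf (int n)) \<le> K2" by (auto simp: Bseq_def)
  define K where "K = max 1 (max K1 K2)"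
  have "norm (pf n) \<le> K" for n
    using K1[of "nat n"] by (cases "n < 0") (simp_all add: qpf_def K_def)
  moreover have "norm (rf n) \<le> K" for n
    using K2[of "nat n"] by (cases "n < 0") (simp_all add: K_def)
  ultimately show ?thesis using that[of K] by (simp add: K_def)
qed

text \<open>The \<open>q\<close>-Saalschutz sum is proved by a WZ pair in \<open>N1\<close>. This is the WZ equation divided by the
  common factorials, with \<open>u = q^s\<close>, \<open>C = q^c\<close>, \<open>x = q^(N1 + 1)\<close>, \<open>y = q^N2\<close> and \<open>p = q^P\<close>.\<close>

lemma saalschutz_certificate:
  fixes u C x y p :: complex
  assumes "u \<noteq> 0" "C \<noteq> 0"
  shows "(1 - x * C) * ((1 - x * y * p / u) * (1 - x)) - (1 - x * p * C) * ((1 - x / u) * (1 - x * y))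
     = - x * u * C * (1 - p / u) * (1 - x / u) * (1 - y / (u * C))
       + x * (1 - u) * (1 - u * C) * (1 - x * y * p / u) / u"
  using assms by (simp add: divide_simps) algebra

text \<open>Both sides satisfy the same first-order recurrence in \<open>N1\<close>, and at
  \<open>N1 = 0\<close> only \<open>s = 0\<close> survives. The factors \<open>pf (int N1)\<close>
  and \<open>rf (int (N1 + N2))\<close> are kept under the sum so that this recurrence has the short
  coefficients \<open>1 - x * C\<close> and \<open>1 - x * p * C\<close>.\<close>

lemma saalschutz_aux:
  fixes N1 N2 P c :: nat
  shows "(\<Sum>s\<le>P. q powi (int s * int (s + c)) * pf (int (N1 + N2 + P) - int s) * rf (int P - int s)
            * rf (int (N1 + N2)) * pf (int N1) * rf (int s) * rf (int N1 - int s)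
            * rf (int (s + c)) * rf (int N2 - int (s + c)))
       = pf (int (N1 + P + c)) * rf (int P) * rf (int (N1 + c)) * pf (int (N2 + P)) * rf (int (P + c)) * rf (int N2 - int c)
         * rf (int N2)"
proof (induction N1)
  case 0
  have "(\<Sum>s\<le>P. q powi (int s * int (s + c)) * pf (int (0 + N2 + P) - int s) * rf (int P - int s)
            * rf (int (0 + N2)) * pf (int 0) * rf (int s) * rf (int 0 - int s)
            * rf (int (s + c)) * rf (int N2 - int (s + c)))
     = (\<Sum>s\<in>{0}. q powi (int s * int (s + c)) * pf (int (0 + N2 + P) - int s) * rf (int P - int s)
            * rf (int (0 + N2)) * pf (int 0) * rf (int s) * rf (int 0 - int s)
            * rf (int (s + c)) * rf (int N2 - int (s + c)))"
    by (rule sum.mono_neutral_right) auto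
  also have "\<dots> = pf (int (N2 + P)) * rf (int P) * rf (int N2) * (pf (int (P + c)) * rf (int (P + c))) * rf (int c) * rf (int N2 - int c)"
    by (simp add: pf_rf)
  finally show ?case by (simp add: mult_ac)
next
  case (Suc N1)
  define t where "t N s = q powi (int s * int (s + c)) * pf (int (N + N2 + P) - int s) * rf (int P - int s)
            * rf (int (N + N2)) * pf (int N) * rf (int s) * rf (int N - int s)
            * rf (int (s + c)) * rf (int N2 - int (s + c))" for N s
  define x y p C where "x = q powi (int N1 + 1)" and "y = q powi (int N2)" and "p = q powi (int P)"
    and "C = q powi (int c)"
  \<comment> \<open>The WZ companion of \<open>t\<close>. It vanishes at \<open>s = 0\<close>
    through \<open>rf (int s - 1)\<close> and at \<open>s = P + 1\<close> through
    \<open>rf (int P - int s)\<close>, so the telescoped sum is 0.\<close>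
  define G where "G s = - x / q powi (int s) * q powi (int s * int (s + c)) * pf (int (N1 + N2 + P) + 1 - int s)
     * rf (int s - 1) * rf (int (s + c) - 1) * rf (int P - int s) * rf (int N1 + 1 - int s) * rf (int N2 - int (s + c))
     * pf (int N1) * rf (int (N1 + N2) + 1)" for s
  have nz: "y \<noteq> 0" "p \<noteq> 0" "C \<noteq> 0" by (simp_all add: y_def p_def C_def)
  have tel: "(1 - x * C) * t (Suc N1) s - (1 - x * p * C) * t N1 s = G (Suc s) - G s" if "s \<le> P" for s
  proof -
    define u where "u = q powi (int s)"
    have u: "u \<noteq> 0" by (simp add: u_def)
    \<comment> \<open>The factor common to both values of \<open>t\<close> and both values of
      \<open>G\<close>; dividing by it leaves exactly \<open>saalschutz_certificate\<close>.\<close>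
    define h where "h = q powi (int s * int (s + c)) * pf (int (N1 + N2 + P) - int s) * rf (int P - int s)
            * rf (int (N1 + N2) + 1) * pf (int N1) * rf (int s) * rf (int N1 + 1 - int s)
            * rf (int (s + c)) * rf (int N2 - int (s + c))"
    have 1: "pf (int (N1 + N2 + P) + 1 - int s) = (1 - x * y * p / u) * pf (int (N1 + N2 + P) - int s)"
    proof -
      have "q powi (int (N1 + N2 + P) - int s + 1) = x * y * p / u"
        by (simp add: x_def y_def p_def u_def powi_add powi_diff)
      thus ?thesis using pf_rec[of "int (N1 + N2 + P) - int s"] that by (simp add: algebra_simps)
    qed
    have 2: "rf (int N1 - int s) = (1 - x / u) * rf (int N1 + 1 - int s)"
      using rf_rec[of "int N1 + 1 - int s"] by (simp add: x_def u_def powi_diff)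
    have 3: "rf (int (N1 + N2)) = (1 - x * y) * rf (int (N1 + N2) + 1)"
      using rf_rec[of "int (N1 + N2) + 1"] by (simp add: x_def y_def powi_add mult_ac)
    have 4: "pf (int (Suc N1)) = (1 - x) * pf (int N1)"
      using pf_rec[of "int N1"] by (simp add: x_def add.commute)
    have 5: "rf (int s - 1) = (1 - u) * rf (int s)"
      using rf_rec[of "int s"] by (simp add: u_def)
    have 6: "rf (int (s + c) - 1) = (1 - u * C) * rf (int (s + c))"
      using rf_rec[of "int (s + c)"] by (simp add: u_def C_def powi_add)
    have 7: "rf (int P - int (Suc s)) = (1 - p / u) * rf (int P - int s)"
      using rf_rec[of "int P - int s"] by (simp add: u_def p_def powi_diff algebra_simps)
    have 8: "rf (int N2 - int (Suc s + c)) = (1 - y / (u * C)) * rf (int N2 - int (s + c))"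
      using rf_rec[of "int N2 - int (s + c)"]
      by (simp add: u_def y_def C_def powi_diff powi_add algebra_simps)
    have 9: "q powi (int (Suc s) * int (Suc s + c)) = q powi (int s * int (s + c)) * u * u * C * q"
    proof -
      have "int (Suc s) * int (Suc s + c) = int s * int (s + c) + int s + int s + int c + 1"
        by (simp add: algebra_simps)
      thus ?thesis by (simp only: powi_add u_def C_def power_int_1_right)
    qed
    have A: "t (Suc N1) s = (1 - x * y * p / u) * (1 - x) * h"
    proof -
      have e: "int (Suc N1 + N2 + P) - int s = int (N1 + N2 + P) + 1 - int s"
        "int (Suc N1 + N2) = int (N1 + N2) + 1" "int (Suc N1) - int s = int N1 + 1 - int s" by simp_all
      show ?thesis unfolding t_def e 1 4 h_def by (simp only: mult_ac)
    qed
    have B: "t N1 s = (1 - x / u) * (1 - x * y) * h"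
      unfolding t_def 2 3 h_def by (simp only: mult_ac)
    have D: "G s = - (x * (1 - u) * (1 - u * C) * (1 - x * y * p / u) / u) * h"
      unfolding G_def h_def 1 5 6 u_def[symmetric] by (simp add: mult_ac)
    have E: "G (Suc s) = - x * u * C * (1 - p / u) * (1 - x / u) * (1 - y / (u * C)) * h"
    proof -
      have e: "int (N1 + N2 + P) + 1 - int (Suc s) = int (N1 + N2 + P) - int s"
        "int (Suc s) - 1 = int s" "int (Suc s + c) - 1 = int (s + c)"
        "int N1 + 1 - int (Suc s) = int N1 - int s" by simp_all
      have f: "q powi int (Suc s) = u * q"
        using powi_add[of "int s" 1] by (simp add: u_def add.commute)
      have "- x / (u * q) * (Q * u * u * C * q) = - x * u * C * Q" for Q
        using u q_nonzero by (simp add: field_simps)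
      note g = this[of "q powi (int s * int (s + c))"]
      show ?thesis unfolding G_def e f 9 g 7 8 2 h_def by (simp only: mult_ac)
    qed
    have "(1 - x * C) * t (Suc N1) s - (1 - x * p * C) * t N1 s
       = ((1 - x * C) * ((1 - x * y * p / u) * (1 - x)) - (1 - x * p * C) * ((1 - x / u) * (1 - x * y))) * h"
      unfolding A B by (simp only: left_diff_distrib[where c = h] mult.assoc)
    also have "\<dots> = G (Suc s) - G s"
      unfolding saalschutz_certificate[OF u nz(3)] D E by (simp only: distrib_right mult_minus_left diff_minus_eq_add)
    finally show ?thesis .
  qed
  have "(1 - x * C) * (\<Sum>s\<le>P. t (Suc N1) s) - (1 - x * p * C) * (\<Sum>s\<le>P. t N1 s) = (\<Sum>s\<le>P. G (Suc s) - G s)"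
    unfolding sum_distrib_left sum_subtractf[symmetric] using tel by (intro sum.cong) auto
  also have "\<dots> = G (Suc P) - G 0"
    by (induction P) simp_all
  also have "\<dots> = 0" by (simp add: G_def)
  finally have rec: "(1 - x * C) * (\<Sum>s\<le>P. t (Suc N1) s) = (1 - x * p * C) * (\<Sum>s\<le>P. t N1 s)" by simp
  have xC: "rf (int (N1 + c)) = (1 - x * C) * rf (int (Suc N1 + c))"
  proof -
    have "q powi int (Suc N1 + c) = x * C"
      unfolding x_def C_def powi_add[symmetric] by (simp add: add_ac)
    moreover have "int (Suc N1 + c) - 1 = int (N1 + c)" by simp
    ultimately show ?thesis using rf_rec[of "int (Suc N1 + c)"] by (simp only:)
  qed
  \<comment> \<open>\<open>rf (int (N1 + c))\<close> is nonzero and contains this factor.\<close>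
  have nz': "1 - x * C \<noteq> 0"
    using xC pf_rf[of "int (N1 + c)"] by auto
  have xp: "pf (int (Suc N1 + P + c)) = (1 - x * p * C) * pf (int (N1 + P + c))"
  proof -
    have "q powi (int (N1 + P + c) + 1) = x * p * C"
      unfolding x_def p_def C_def powi_add[symmetric] by (simp add: add_ac)
    moreover have "int (N1 + P + c) + 1 = int (Suc N1 + P + c)" by simp
    ultimately show ?thesis using pf_rec[of "int (N1 + P + c)"] by (metis of_nat_0_le_iff)
  qed
  have "(1 - x * C) * (\<Sum>s\<le>P. t (Suc N1) s) = (1 - x * C) *
     (pf (int (Suc N1 + P + c)) * rf (int P) * rf (int (Suc N1 + c)) * pf (int (N2 + P)) * rf (int (P + c)) * rf (int N2 - int c) * rf (int N2))"
    unfolding rec unfolding t_def Suc xC xp by (simp only: mult_ac)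
  thus ?case using nz' unfolding t_def by simp
qed

end

section \<open>The Burge transform\<close>

lemma sum_int_telescope:
  fixes g :: "int \<Rightarrow> 'a :: ab_group_add"
  shows "(\<Sum>j\<in>{- int N..int N}. g (j + 1) - g j) = g (int N + 1) - g (- int N)"
proof (induction N)
  case (Suc N)
  have "{- int (Suc N)..int (Suc N)} = insert (- int N - 1) (insert (int N + 1) {- int N..int N})"
    by auto
  hence "(\<Sum>j\<in>{- int (Suc N)..int (Suc N)}. g (j + 1) - g j)
      = (g (- int N - 1 + 1) - g (- int N - 1)) + ((g (int N + 1 + 1) - g (int N + 1)) + (g (int N + 1) - g (- int N)))"
    using Suc by simp
  also have "\<dots> = g (int N + 1 + 1) - g (- int N - 1)" by simp
  also have "\<dots> = g (int (Suc N) + 1) - g (- int (Suc N))"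
    by (rule arg_cong2[where f = "\<lambda>x y. g x - g y"]) simp_all
  finally show ?case .
qed simp

lemma sum_int_reflect:
  "(\<Sum>j\<in>{- int N..int N}. g (- j)) = (\<Sum>j\<in>{- int N..int N}. g j)"
  by (rule sum.reindex_bij_witness[of _ uminus uminus]) auto

context nome
begin

text \<open>The Burge transform for one index j, with \<open>a = c j\<close> and
  \<open>b = e j\<close>. Substituting \<open>i = s + b\<close> gives the Saalschutz sum with shift
  \<open>2 * b\<close>, with the two upper entries \<open>N1\<close> and \<open>N2\<close> adding up
  to \<open>2 * v\<close>.\<close>

lemma burge_nonneg:
  fixes u v :: nat and a b :: int
  assumes ab: "a \<ge> 0" "b \<ge> 0" and vu: "v \<le> u"
  shows "(\<Sum>i\<le>v. q powi ((int i)\<^sup>2) * qbinom q (int (v + u) - int i) (int (2 * v))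
           * (qbinom q (int v + (a - b)) (int v - int i + a) * qbinom q (int v - (a - b)) (int v - int i - a)))
       = q powi (b\<^sup>2) * (qbinom q (int u + a) (int v + (a + b)) * qbinom q (int u - a) (int v - (a + b)))"
    (is "(\<Sum>i\<le>v. ?f i) = ?r")
\<comment> \<open>Exactly when this fails one of \<open>N1\<close>, \<open>N2\<close>,
  \<open>P\<close> would be negative; then every summand and the right-hand side contain a vanishing
  \<open>q\<close>-binomial.\<close>
proof (cases "b \<le> int v + a \<and> a \<le> int v + b \<and> b \<le> int u - int v")
  case False
  have "?f i = 0" if "i \<le> v" for i
    using False that ab by (auto simp: qbinom_def)
  moreover have "?r = 0"
    using False ab by (auto simp: qbinom_def)
  moreover have "(\<Sum>i\<le>v. ?f i) = 0"
    using calculation(1) by (intro sum.neutral ballI) (simp only: atMost_iff)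
  ultimately show ?thesis by (simp only:)
next
  case True
  define N1 N2 P b' where "N1 = nat (int v + a - b)" and "N2 = nat (int v - a + b)"
    and "P = nat (int u - int v - b)" and "b' = nat b"
  have N: "int N1 = int v + a - b" "int N2 = int v - a + b" "int P = int u - int v - b" "b = int b'"
    using True ab by (auto simp: N1_def N2_def P_def b'_def)
  \<comment> \<open>The upper end \<open>P + b'\<close> is \<open>u - v\<close>, which may exceed
    \<open>v\<close>; terms of either range outside the other vanish.\<close>
  have "(\<Sum>i\<le>v. ?f i) = (\<Sum>i\<in>{0 + b'..P + b'}. ?f i)"
  proof (rule sum.mono_neutral_cong)
    show "?f i = 0" if "i \<in> {0 + b'..P + b'} - {..v}" for i
    proof -
      have "int v - int i - a < 0" using that ab by auto
      thus ?thesis by (simp add: qbinom_zero)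
    qed
    show "?f i = 0" if "i \<in> {..v} - {0 + b'..P + b'}" for i
    proof -
      have "i < b' \<or> i > P + b'" using that by auto
      thus ?thesis
      proof
        assume "i < b'"
        hence "int v + (a - b) < int v - int i + a" using N by simp
        thus ?thesis by (simp add: qbinom_zero)
      next
        assume "i > P + b'"
        hence "int (v + u) - int i < int (2 * v)" using N by simp
        thus ?thesis by (simp add: qbinom_zero)
      qed
    qed
  qed auto
  also have "\<dots> = (\<Sum>s\<le>P. ?f (s + b'))"
    by (subst sum.shift_bounds_cl_nat_ivl) (simp add: atLeast0AtMost)
  also have "\<dots> = (\<Sum>s\<le>P. (pf (int N2) * q powi (b\<^sup>2)) * (q powi (int s * int (s + 2 * b')) * pf (int (N1 + N2 + P) - int s) * rf (int P - int s)
            * rf (int (N1 + N2)) * pf (int N1) * rf (int s) * rf (int N1 - int s)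
            * rf (int (s + 2 * b')) * rf (int N2 - int (s + 2 * b'))))"
  proof (rule sum.cong[OF refl])
    fix s assume s: "s \<in> {..P}"
    have 1: "qbinom q (int (v + u) - int (s + b')) (int (2 * v))
        = pf (int (N1 + N2 + P) - int s) * rf (int (N1 + N2)) * rf (int P - int s)"
    proof -
      have e: "int (v + u) - int (s + b') = int (N1 + N2 + P) - int s" "int (2 * v) = int (N1 + N2)"
        using N by simp_all
      have e': "int (N1 + N2 + P) - int s - int (N1 + N2) = int P - int s" by simp
      have "int (N1 + N2 + P) - int s \<ge> 0" using s by simp
      from qbinom_eq[OF this, of "int (N1 + N2)"] show ?thesis unfolding e e' .
    qed
    have 2: "qbinom q (int v + (a - b)) (int v - int (s + b') + a) = pf (int N1) * rf (int N1 - int s) * rf (int s)"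
    proof -
      have e: "int v + (a - b) = int N1" "int v - int (s + b') + a = int N1 - int s" using N by simp_all
      have e': "int N1 - (int N1 - int s) = int s" by simp
      from qbinom_eq[OF of_nat_0_le_iff, of N1 "int N1 - int s"] show ?thesis unfolding e e' .
    qed
    have 3: "qbinom q (int v - (a - b)) (int v - int (s + b') - a)
       = pf (int N2) * rf (int N2 - int (s + 2 * b')) * rf (int (s + 2 * b'))"
    proof -
      have e: "int v - (a - b) = int N2" "int v - int (s + b') - a = int N2 - int (s + 2 * b')"
        using N by simp_all
      have e': "int N2 - (int N2 - int (s + 2 * b')) = int (s + 2 * b')" by simp
      from qbinom_eq[OF of_nat_0_le_iff, of N2 "int N2 - int (s + 2 * b')"] show ?thesis unfolding e e' .
    qed
    have "(int (s + b'))\<^sup>2 = b\<^sup>2 + int s * int (s + 2 * b')"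
      by (simp add: N power2_eq_square algebra_simps)
    hence 4: "q powi ((int (s + b'))\<^sup>2) = q powi (b\<^sup>2) * q powi (int s * int (s + 2 * b'))"
      by (simp only: powi_add)
    show "?f (s + b') = (pf (int N2) * q powi (b\<^sup>2)) * (q powi (int s * int (s + 2 * b')) * pf (int (N1 + N2 + P) - int s) * rf (int P - int s)
            * rf (int (N1 + N2)) * pf (int N1) * rf (int s) * rf (int N1 - int s)
            * rf (int (s + 2 * b')) * rf (int N2 - int (s + 2 * b')))"
      unfolding 1 2 3 4 by (simp only: mult_ac)
  qed
  also have "\<dots> = (pf (int N2) * q powi (b\<^sup>2)) * (pf (int (N1 + P + 2 * b')) * rf (int P) * rf (int (N1 + 2 * b')) * pf (int (N2 + P)) * rf (int (P + 2 * b')) * rf (int N2 - int (2 * b'))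
         * rf (int N2))"
    unfolding sum_distrib_left[symmetric] saalschutz_aux ..
  \<comment> \<open>\<open>saalschutz_aux\<close> leaves \<open>rf (int N2)\<close>, which cancels
    against the \<open>pf (int N2)\<close> taken out of the sum.\<close>
  also have "\<dots> = (pf (int N2) * rf (int N2)) * (q powi (b\<^sup>2) * (pf (int (N1 + P + 2 * b')) * rf (int (N1 + 2 * b')) * rf (int P) * (pf (int (N2 + P)) * rf (int N2 - int (2 * b')) * rf (int (P + 2 * b')))))"
    by (simp only: mult_ac)
  also have "\<dots> = ?r"
  proof -
    have "qbinom q (int (N1 + P + 2 * b')) (int (N1 + 2 * b')) = pf (int (N1 + P + 2 * b')) * rf (int (N1 + 2 * b')) * rf (int P)"
      using qbinom_eq[of "int (N1 + P + 2 * b')" "int (N1 + 2 * b')"] by simp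
    moreover have "int (N1 + P + 2 * b') = int u + a" "int (N1 + 2 * b') = int v + (a + b)"
      using N by simp_all
    moreover have "qbinom q (int (N2 + P)) (int N2 - int (2 * b')) = pf (int (N2 + P)) * rf (int N2 - int (2 * b')) * rf (int (P + 2 * b'))"
      using qbinom_eq[of "int (N2 + P)" "int N2 - int (2 * b')"] by (simp add: algebra_simps)
    moreover have "int (N2 + P) = int u - a" "int N2 - int (2 * b') = int v - (a + b)"
      using N by simp_all
    ultimately show ?thesis by (simp add: pf_rf)
  qed
  finally show ?thesis .
qed

definition burge_term :: "nat \<Rightarrow> nat \<Rightarrow> nat \<Rightarrow> nat \<Rightarrow> int \<Rightarrow> complex" where
  "burge_term c e u v j = (- 1) powi j * q powi (int (c * e) * j\<^sup>2 + j * (j + 1) div 2) *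
     (qbinom q (int u + (int c * j - int e * j)) (int v + int c * j) *
      qbinom q (int u - (int c * j - int e * j)) (int v - int c * j))"

text \<open>The usual parameters of the Burge transform are \<open>L = v\<close> and \<open>M = u - v\<close>.\<close>

definition burge_sum :: "nat \<Rightarrow> nat \<Rightarrow> nat \<Rightarrow> nat \<Rightarrow> complex" where
  "burge_sum c e u v = (\<Sum>j\<in>{- int u..int u}. burge_term c e u v j)"

lemma burge_term_zero:
  assumes "c \<ge> 1" "\<bar>j\<bar> > int v"
  shows "burge_term c e u v j = 0"
proof -
  have "int c * \<bar>j\<bar> \<ge> 1 * \<bar>j\<bar>" using assms by (intro mult_right_mono) auto
  hence "\<bar>int c * j\<bar> > int v" using assms by (simp add: abs_mult)
  hence "int v + int c * j < 0 \<or> int v - int c * j < 0" by linarith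
  thus ?thesis by (auto simp: burge_term_def qbinom_zero)
qed

text \<open>Nonzero terms have absolute index at most \<open>v\<close>, since
  \<open>c \<ge> 1\<close>. This puts sums with different parameters over one common range before
  the order of summation is exchanged.\<close>

lemma burge_sum_eq:
  assumes "c \<ge> 1" "v \<le> N" "v \<le> u"
  shows "burge_sum c e u v = (\<Sum>j\<in>{- int N..int N}. burge_term c e u v j)"
  unfolding burge_sum_def
proof (rule sum.mono_neutral_cong)
  show "burge_term c e u v j = 0" if "j \<in> {- int N..int N} - {- int u..int u}" for j
    using that assms by (intro burge_term_zero) auto
  show "burge_term c e u v j = 0" if "j \<in> {- int u..int u} - {- int N..int N}" for j
    using that assms by (intro burge_term_zero) auto
qed auto

text \<open>It holds for every index \<open>j\<close> separately: the single-index identity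
  contributes \<open>(e j)\<^sup>2\<close> to the exponent, which turns \<open>c e\<close> into
  \<open>(c + e) e\<close>.\<close>

lemma burge_transform:
  assumes c: "c \<ge> 1" and vu: "v \<le> u"
  shows "burge_sum (c + e) e u v
     = (\<Sum>i\<le>v. q powi ((int i)\<^sup>2) * qbinom q (int (v + u) - int i) (int (2 * v)) * burge_sum c e v (v - i))"
proof -
  have "(\<Sum>i\<le>v. q powi ((int i)\<^sup>2) * qbinom q (int (v + u) - int i) (int (2 * v)) * burge_sum c e v (v - i))
     = (\<Sum>i\<le>v. \<Sum>j\<in>{- int u..int u}. q powi ((int i)\<^sup>2) * qbinom q (int (v + u) - int i) (int (2 * v)) * burge_term c e v (v - i) j)"
    using c vu by (simp add: burge_sum_eq[where N = u] sum_distrib_left)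
  also have "\<dots> = (\<Sum>j\<in>{- int u..int u}. \<Sum>i\<le>v. q powi ((int i)\<^sup>2) * qbinom q (int (v + u) - int i) (int (2 * v)) * burge_term c e v (v - i) j)"
    by (rule sum.swap)
  also have "\<dots> = (\<Sum>j\<in>{- int u..int u}. burge_term (c + e) e u v j)"
  proof (rule sum.cong[OF refl])
    fix j
    define w where "w = (- 1 :: complex) powi j * q powi (int (c * e) * j\<^sup>2 + j * (j + 1) div 2)"
    have "(\<Sum>i\<le>v. q powi ((int i)\<^sup>2) * qbinom q (int (v + u) - int i) (int (2 * v)) * burge_term c e v (v - i) j)
       = w * (\<Sum>i\<le>v. q powi ((int i)\<^sup>2) * qbinom q (int (v + u) - int i) (int (2 * v))
           * (qbinom q (int v + (int c * j - int e * j)) (int v - int i + int c * j)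
              * qbinom q (int v - (int c * j - int e * j)) (int v - int i - int c * j)))"
      unfolding sum_distrib_left burge_term_def w_def by (rule sum.cong) (auto simp: of_nat_diff)
    also have "(\<Sum>i\<le>v. q powi ((int i)\<^sup>2) * qbinom q (int (v + u) - int i) (int (2 * v))
           * (qbinom q (int v + (int c * j - int e * j)) (int v - int i + int c * j)
              * qbinom q (int v - (int c * j - int e * j)) (int v - int i - int c * j)))
        = q powi ((int e * j)\<^sup>2) * (qbinom q (int u + int c * j) (int v + (int c * j + int e * j))
            * qbinom q (int u - int c * j) (int v - (int c * j + int e * j)))"
    proof (cases "j \<ge> 0")
      case True
      thus ?thesis by (intro burge_nonneg vu) auto
    next
      case False
      \<comment> \<open>A simultaneous change of sign of \<open>c j\<close> and \<open>e j\<close>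
        merely exchanges the two \<open>q\<close>-binomials, so negative \<open>j\<close> reduces to
        the nonnegative case.\<close>
      have "- (int c * j) \<ge> 0" "- (int e * j) \<ge> 0"
        using False by (auto simp: mult_nonneg_nonpos)
      from burge_nonneg[OF this vu] show ?thesis by (simp add: algebra_simps)
    qed
    also have "w * \<dots> = burge_term (c + e) e u v j"
    proof -
      have "int ((c + e) * e) * j\<^sup>2 + j * (j + 1) div 2
         = (int (c * e) * j\<^sup>2 + j * (j + 1) div 2) + (int e * j)\<^sup>2"
        by (simp add: power2_eq_square algebra_simps)
      moreover have "int (c + e) * j - int e * j = int c * j" "int (c + e) * j = int c * j + int e * j"
        by (simp_all add: algebra_simps)
      ultimately show ?thesis unfolding burge_term_def w_def by (simp only: powi_add mult.assoc)
    qed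
    finally show "(\<Sum>i\<le>v. q powi ((int i)\<^sup>2) * qbinom q (int (v + u) - int i) (int (2 * v)) * burge_term c e v (v - i) j)
      = burge_term (c + e) e u v j" .
  qed
  finally show ?thesis by (simp add: burge_sum_def)
qed

lemma qbinom_symmetric: "qbinom q N (N - M) = qbinom q N M"
  by (auto simp: qbinom_def mult_ac)

text \<open>Reflecting both \<open>q\<close>-binomials interchanges their roles, and the exponent is
  symmetric in \<open>c\<close> and \<open>e\<close>.\<close>

lemma burge_sum_swap:
  assumes "v \<le> u"
  shows "burge_sum c e u v = burge_sum e c u (u - v)"
  unfolding burge_sum_def
proof (rule sum.cong[OF refl])
  fix j
  have "qbinom q (int u + (int c * j - int e * j)) (int v + int c * j)
      = qbinom q (int u - (int e * j - int c * j)) (int (u - v) - int e * j)"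
    using qbinom_symmetric[of "int u + (int c * j - int e * j)" "int v + int c * j"] assms
    by (simp add: of_nat_diff algebra_simps)
  moreover have "qbinom q (int u - (int c * j - int e * j)) (int v - int c * j)
      = qbinom q (int u + (int e * j - int c * j)) (int (u - v) + int e * j)"
    using qbinom_symmetric[of "int u - (int c * j - int e * j)" "int v - int c * j"] assms
    by (simp add: of_nat_diff algebra_simps)
  ultimately show "burge_term c e u v j = burge_term e c u (u - v) j"
    unfolding burge_term_def by (simp add: mult_ac)
qed

text \<open>The root of the Burge tree. The summand is symmetrised under \<open>j \<mapsto> - j\<close>, since only
  then is there a first-order WZ pair in \<open>M\<close>.\<close>

lemma burge_root_certificate:
  fixes l x z :: complex
  assumes "x \<noteq> 0"
  shows "(1 - z) * (1 - l * z) * (1 + x) - (1 - z / x) * (1 - z * x) * (1 + x)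
     = z * x\<^sup>2 * (1 - l / x) * (1 - z / x) + z / x * (1 - l * x) * (1 - z * x)"
  using assms by (simp add: divide_simps) algebra

text \<open>A finite form of Euler's pentagonal number theorem, which reappears as \<open>L\<close>
  and \<open>M\<close> tend to infinity. The factor 2 comes from the symmetrisation. The range
  \<open>N\<close> stays fixed during the induction on \<open>M\<close>, so that only the summand
  changes.\<close>

lemma burge_root_aux:
  fixes L M N :: nat
  assumes "M \<le> N"
  shows "(\<Sum>j\<in>{- int N..int N}. (- 1) powi j * q powi (j * (3 * j - 1) div 2) * (1 + q powi j)
           * (rf (int L + j) * rf (int L - j) * (rf (int M + j) * rf (int M - j))))
        = 2 * (rf (int L) * rf (int M) * rf (int (L + M)))"
  using assms
proof (induction M)
  case 0
  have "(\<Sum>j\<in>{- int N..int N}. (- 1) powi j * q powi (j * (3 * j - 1) div 2) * (1 + q powi j)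
           * (rf (int L + j) * rf (int L - j) * (rf (int 0 + j) * rf (int 0 - j))))
      = (\<Sum>j\<in>{0}. (- 1) powi j * q powi (j * (3 * j - 1) div 2) * (1 + q powi j)
           * (rf (int L + j) * rf (int L - j) * (rf (int 0 + j) * rf (int 0 - j))))"
  proof (rule sum.mono_neutral_right)
    show "\<forall>j\<in>{- int N..int N} - {0}. (- 1) powi j * q powi (j * (3 * j - 1) div 2) * (1 + q powi j)
           * (rf (int L + j) * rf (int L - j) * (rf (int 0 + j) * rf (int 0 - j))) = 0"
    proof
      fix j assume "j \<in> {- int N..int N} - {0}"
      hence "int 0 + j < 0 \<or> int 0 - j < 0" by auto
      thus "(- 1) powi j * q powi (j * (3 * j - 1) div 2) * (1 + q powi j)
           * (rf (int L + j) * rf (int L - j) * (rf (int 0 + j) * rf (int 0 - j))) = 0"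
        by auto
    qed
  qed auto
  thus ?case by simp
next
  case (Suc M)
  define t where "t m j = (- 1) powi j * q powi (j * (3 * j - 1) div 2) * (1 + q powi j)
           * (rf (int L + j) * rf (int L - j) * (rf (m + j) * rf (m - j)))" for m j
  define z l where "z = q powi (int M + 1)" and "l = q powi (int L)"
  define G where "G j = - z / q powi j * ((- 1) powi j * q powi (j * (3 * j - 1) div 2)
       * (rf (int L + j - 1) * rf (int L - j) * (rf (int M + j) * rf (int M + 1 - j))))" for j
  have tel: "(1 - z) * (1 - l * z) * t (int M + 1) j - t (int M) j = G (j + 1) - G j" for j
  proof -
    define x where "x = q powi j"
    have x: "x \<noteq> 0" by (simp add: x_def)
    define h where "h = (- 1) powi j * q powi (j * (3 * j - 1) div 2)
           * (rf (int L + j) * rf (int L - j) * (rf (int M + 1 + j) * rf (int M + 1 - j)))"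
    have 1: "rf (int M + j) = (1 - z * x) * rf (int M + 1 + j)"
      using rf_rec[of "int M + 1 + j"] by (simp add: z_def x_def powi_add add_ac)
    have 2: "rf (int M - j) = (1 - z / x) * rf (int M + 1 - j)"
      using rf_rec[of "int M + 1 - j"] by (simp add: z_def x_def powi_diff)
    have 3: "rf (int L + j - 1) = (1 - l * x) * rf (int L + j)"
      using rf_rec[of "int L + j"] by (simp add: l_def x_def powi_add)
    have 4: "rf (int L - (j + 1)) = (1 - l / x) * rf (int L - j)"
      using rf_rec[of "int L - j"] by (simp add: l_def x_def powi_diff algebra_simps)
    have 5: "q powi ((j + 1) * (3 * (j + 1) - 1) div 2) = q powi (j * (3 * j - 1) div 2) * x * x * x * q"
    proof -
      have "(j + 1) * (3 * (j + 1) - 1) = j * (3 * j - 1) + (j + j + j + 1) * 2"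
        by (simp add: algebra_simps)
      hence "(j + 1) * (3 * (j + 1) - 1) div 2 = j * (3 * j - 1) div 2 + j + j + j + 1"
        using div_mult_self1[of 2 "j * (3 * j - 1)" "j + j + j + 1"] by linarith
      thus ?thesis by (simp only: powi_add x_def power_int_1_right)
    qed
    have A: "t (int M + 1) j = (1 + x) * h" "t (int M) j = (1 - z / x) * (1 - z * x) * (1 + x) * h"
      unfolding t_def h_def 1 2 x_def[symmetric] by (simp_all only: mult_ac)
    have D: "G j = - (z / x * (1 - l * x) * (1 - z * x)) * h"
      unfolding G_def h_def 1 3 x_def[symmetric] by (simp add: mult_ac)
    have E: "G (j + 1) = z * x\<^sup>2 * (1 - l / x) * (1 - z / x) * h"
    proof -
      have e: "int L + (j + 1) - 1 = int L + j" "int M + (j + 1) = int M + 1 + j"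
        "int M + 1 - (j + 1) = int M - j" by simp_all
      have f: "q powi (j + 1) = x * q" by (simp add: x_def powi_add)
      have f': "(- 1 :: complex) powi (j + 1) = - ((- 1) powi j)" by (simp add: power_int_add)
      have "- z / (x * q) * (- s * (Q * x * x * x * q)) = z * x\<^sup>2 * (s * Q)" for Q s
        using x by (simp add: field_simps power2_eq_square)
      note g = this[of "(- 1) powi j" "q powi (j * (3 * j - 1) div 2)"]
      have "G (j + 1) = - z / (x * q) * (- ((- 1) powi j) * (q powi (j * (3 * j - 1) div 2) * x * x * x * q))
        * (rf (int L + j) * ((1 - l / x) * rf (int L - j)) * (rf (int M + 1 + j) * ((1 - z / x) * rf (int M + 1 - j))))"
        unfolding G_def e f f' 5 4 2 by (simp only: mult.assoc)
      thus ?thesis unfolding g h_def by (simp only: mult_ac)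
    qed
    have "(1 - z) * (1 - l * z) * t (int M + 1) j - t (int M) j
       = ((1 - z) * (1 - l * z) * (1 + x) - (1 - z / x) * (1 - z * x) * (1 + x)) * h"
      unfolding A by (simp only: left_diff_distrib[where c = h] mult.assoc)
    also have "\<dots> = G (j + 1) - G j"
      unfolding burge_root_certificate[OF x] D E by (simp only: distrib_right mult_minus_left diff_minus_eq_add)
    finally show ?thesis .
  qed
  have "(1 - z) * (1 - l * z) * (\<Sum>j\<in>{- int N..int N}. t (int M + 1) j) - (\<Sum>j\<in>{- int N..int N}. t (int M) j)
      = (\<Sum>j\<in>{- int N..int N}. G (j + 1) - G j)"
    unfolding sum_distrib_left sum_subtractf[symmetric] using tel by (intro sum.cong) auto
  also have "\<dots> = G (int N + 1) - G (- int N)" by (rule sum_int_telescope)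
  \<comment> \<open>Here \<open>N > M\<close> is essential: both boundary values contain
    \<open>rf (int M - int N)\<close>.\<close>
  also have "\<dots> = 0" using Suc.prems by (simp add: G_def)
  finally have "(1 - z) * (1 - l * z) * (\<Sum>j\<in>{- int N..int N}. t (int M + 1) j) = (\<Sum>j\<in>{- int N..int N}. t (int M) j)"
    by simp
  also have "\<dots> = 2 * (rf (int L) * rf (int M) * rf (int (L + M)))"
    using Suc by (simp add: t_def)
  also have "rf (int M) = (1 - z) * rf (int (Suc M))"
    using rf_rec[of "int M + 1"] by (simp add: z_def add.commute)
  also have "rf (int (L + M)) = (1 - l * z) * rf (int (L + Suc M))"
  proof -
    have "q powi int (L + Suc M) = l * z"
      unfolding z_def l_def powi_add[symmetric] by (simp add: add_ac)
    moreover have "int (L + Suc M) - 1 = int (L + M)" by simp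
    ultimately show ?thesis using rf_rec[of "int (L + Suc M)"] by (simp only:)
  qed
  finally have "((1 - z) * (1 - l * z)) * (\<Sum>j\<in>{- int N..int N}. t (int M + 1) j)
    = ((1 - z) * (1 - l * z)) * (2 * (rf (int L) * rf (int (Suc M)) * rf (int (L + Suc M))))"
    by (simp only: mult_ac)
  moreover have "(1 - z) * (1 - l * z) \<noteq> 0"
    using \<open>rf (int M) = (1 - z) * rf (int (Suc M))\<close> \<open>rf (int (L + M)) = (1 - l * z) * rf (int (L + Suc M))\<close>
      pf_rf[of "int M"] pf_rf[of "int (L + M)"] by auto
  ultimately have "(\<Sum>j\<in>{- int N..int N}. t (int M + 1) j) = 2 * (rf (int L) * rf (int (Suc M)) * rf (int (L + Suc M)))"
    using mult_left_cancel by blast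
  moreover have "int M + 1 = int (Suc M)" by simp
  ultimately show ?case unfolding t_def by (simp only:)
qed

lemma burge_sum_1_1:
  assumes "v \<le> u"
  shows "burge_sum 1 1 u v = qbinom q (int u) (int v)"
proof -
  define M where "M = u - v"
  have M: "int M = int u - int v" using assms by (simp add: M_def)
  define W where "W j = rf (int v + j) * rf (int v - j) * (rf (int M + j) * rf (int M - j))" for j
  define T where "T j = (- 1) powi j * q powi (j * (3 * j - 1) div 2) * W j" for j
  have W: "W (- j) = W j" for j by (simp add: W_def)
  \<comment> \<open>The Burge exponent at \<open>(1, 1)\<close> is the generalised pentagonal number
    with index \<open>- j\<close>.\<close>
  have e: "(- j) * (3 * (- j) - 1) div 2 = j\<^sup>2 + j * (j + 1) div 2" for j :: int
  proof -
    have "(- j) * (3 * (- j) - 1) = j * (j + 1) + j\<^sup>2 * 2"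
      by (simp add: algebra_simps power2_eq_square)
    thus ?thesis using div_mult_self1[of 2 "j * (j + 1)" "j\<^sup>2"] by linarith
  qed
  have e': "(- j) * (3 * (- j) - 1) div 2 = j * (3 * j - 1) div 2 + j" for j :: int
  proof -
    have "(- j) * (3 * (- j) - 1) = j * (3 * j - 1) + j * 2"
      by (simp add: algebra_simps power2_eq_square)
    thus ?thesis using div_mult_self1[of 2 "j * (3 * j - 1)" j] by linarith
  qed
  have sgn: "(- 1 :: complex) powi (- j) = (- 1) powi j" for j
    by (rule power_int_minus_one_minus)
  have bt: "burge_term 1 1 u v j = (pf (int u))\<^sup>2 * T (- j)" for j
  proof -
    have "qbinom q (int u) (int v + j) = pf (int u) * rf (int v + j) * rf (int M - j)"
      using qbinom_eq[of "int u" "int v + j"] M by (simp add: diff_diff_eq)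
    moreover have "qbinom q (int u) (int v - j) = pf (int u) * rf (int v - j) * rf (int M + j)"
      using qbinom_eq[of "int u" "int v - j"] M by (simp add: diff_diff_eq2 diff_add_eq)
    ultimately show ?thesis unfolding T_def burge_term_def W e sgn W_def
      by (simp add: power2_eq_square mult_ac)
  qed
  \<comment> \<open>Since \<open>T (- j) = q powi j * T j\<close>, averaging over \<open>j\<close>
    and \<open>- j\<close> produces the factor \<open>1 + q powi j\<close> of the symmetrised
    sum.\<close>
  have "2 * (\<Sum>j\<in>{- int u..int u}. T (- j)) = (\<Sum>j\<in>{- int u..int u}. T j) + (\<Sum>j\<in>{- int u..int u}. T (- j))"
    by (simp add: sum_int_reflect)
  also have "\<dots> = (\<Sum>j\<in>{- int u..int u}. (- 1) powi j * q powi (j * (3 * j - 1) div 2) * (1 + q powi j) * W j)"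
    unfolding sum.distrib[symmetric] T_def W sgn e' powi_add by (intro sum.cong) (auto simp: algebra_simps)
  also have "\<dots> = 2 * (rf (int v) * rf (int M) * rf (int (v + M)))"
    unfolding W_def by (rule burge_root_aux) (simp add: M_def)
  finally have "(\<Sum>j\<in>{- int u..int u}. T (- j)) = rf (int v) * rf (int M) * rf (int u)"
    using assms by (simp add: M_def)
  hence "burge_sum 1 1 u v = (pf (int u) * rf (int u)) * (pf (int u) * rf (int v) * rf (int u - int v))"
    unfolding burge_sum_def bt sum_distrib_left[symmetric] by (simp add: M power2_eq_square mult_ac)
  thus ?thesis by (simp add: pf_rf qbinom_eq)
qed

end

section \<open>Burge polynomials and their limits\<close>

text \<open>The head of the word is the move made last. \<open>True\<close> means that the entries
  are exchanged before the Burge step, so that \<open>(c, e)\<close> passes through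
  \<open>(e, c)\<close> to \<open>(c + e, c)\<close>.\<close>

fun burge_pair :: "bool list \<Rightarrow> nat \<times> nat" where
  "burge_pair [] = (1, 1)"
| "burge_pair (s # bs) = (let (c, e) = burge_pair bs in (c + e, if s then c else e))"

lemma burge_pair_pos: "fst (burge_pair bs) \<ge> 1 \<and> snd (burge_pair bs) \<ge> 1"
  by (induction bs) (auto simp: case_prod_unfold Let_def)

lemma summable_on_int_geometric:
  fixes r :: real
  assumes "0 \<le> r" "r < 1"
  shows "(\<lambda>j :: int. r ^ nat \<bar>j\<bar>) summable_on UNIV"
proof -
  have s: "(\<lambda>n. r ^ n) summable_on (UNIV :: nat set)"
    using assms by (intro norm_summable_imp_summable_on) (simp add: norm_power summable_geometric)
  have "(\<lambda>j :: int. r ^ nat \<bar>j\<bar>) summable_on range int"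
    using s by (subst summable_on_reindex) (auto simp: o_def inj_on_def)
  moreover have "(\<lambda>n. r ^ Suc n) summable_on (UNIV :: nat set)"
    using summable_on_cmult_right[OF s, of r] by simp
  hence "(\<lambda>j :: int. r ^ nat \<bar>j\<bar>) summable_on range (\<lambda>n. - int (Suc n))"
    by (subst summable_on_reindex) (auto simp: o_def inj_on_def nat_add_distrib)
  moreover have "range int \<inter> range (\<lambda>n. - int (Suc n)) = {}" by auto
  ultimately have "(\<lambda>j :: int. r ^ nat \<bar>j\<bar>) summable_on (range int \<union> range (\<lambda>n. - int (Suc n)))"
    by (rule summable_on_Un_disjoint)
  moreover have "j \<in> range int \<union> range (\<lambda>n. - int (Suc n))" for j
  proof (cases "j \<ge> 0")
    case True
    hence "j = int (nat j)" by simp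
    thus ?thesis by blast
  next
    case False
    hence "j = - int (Suc (nat (- j - 1)))" by simp
    thus ?thesis by blast
  qed
  hence "range int \<union> range (\<lambda>n. - int (Suc n)) = UNIV" by blast
  ultimately show ?thesis by simp
qed

context nome
begin

text \<open>The variable \<open>k\<close> is the second argument of the inner polynomial. The Burge
  transform evaluates the inner sum at \<open>v - i\<close>, hence \<open>i = v - k\<close>; after
  an exchange the reflection turns \<open>v - i\<close> into \<open>i\<close>, hence
  \<open>i = k\<close>.\<close>

fun burge_poly :: "bool list \<Rightarrow> nat \<Rightarrow> nat \<Rightarrow> complex" where
  "burge_poly [] u v = qbinom q (int u) (int v)"
| "burge_poly (s # bs) u v =
     (\<Sum>k\<le>v. q powi ((int (if s then k else v - k))\<^sup>2) *
        qbinom q (int (v + u) - int (if s then k else v - k)) (int (2 * v)) * burge_poly bs v k)"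

lemma burge_poly_eq:
  assumes "v \<le> u"
  shows "burge_poly bs u v = burge_sum (fst (burge_pair bs)) (snd (burge_pair bs)) u v"
  using assms
proof (induction bs arbitrary: u v)
  case Nil
  thus ?case using burge_sum_1_1 by simp
next
  case (Cons s bs)
  define c e where "c = fst (burge_pair bs)" and "e = snd (burge_pair bs)"
  have ce: "c \<ge> 1" "e \<ge> 1" using burge_pair_pos[of bs] by (simp_all add: c_def e_def)
  have IH: "burge_poly bs v k = burge_sum c e v k" if "k \<le> v" for k
    using Cons.IH[OF that] by (simp add: c_def e_def)
  show ?case
  proof (cases s)
    case True
    have "burge_poly (s # bs) u v = (\<Sum>i\<le>v. q powi ((int i)\<^sup>2) * qbinom q (int (v + u) - int i) (int (2 * v)) * burge_sum e c v (v - i))"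
      using True by (simp add: IH) (intro sum.cong; simp add: burge_sum_swap[of _ v c e])
    also have "\<dots> = burge_sum (e + c) c u v"
      using burge_transform[OF ce(2) Cons.prems] by simp
    finally show ?thesis using True by (simp add: case_prod_unfold Let_def c_def e_def add.commute)
  next
    case False
    have "burge_poly (s # bs) u v = (\<Sum>k\<in>{0..v}. q powi ((int (v - k))\<^sup>2) * qbinom q (int (v + u) - int (v - k)) (int (2 * v)) * burge_sum c e v k)"
      using False by (simp add: IH atLeast0AtMost)
    also have "\<dots> = (\<Sum>i\<in>{0..v}. q powi ((int i)\<^sup>2) * qbinom q (int (v + u) - int i) (int (2 * v)) * burge_sum c e v (v - i))"
      by (rule sum.reindex_bij_witness[of _ "\<lambda>i. v - i" "\<lambda>i. v - i"]) auto
    also have "\<dots> = burge_sum (c + e) e u v"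
      using burge_transform[OF ce(1) Cons.prems] by (simp add: atLeast0AtMost)
    finally show ?thesis using False by (simp add: case_prod_unfold Let_def c_def e_def)
  qed
qed

lemma qbinom_tendsto: "(\<lambda>n. qbinom q (int n + k) M) \<longlonglongrightarrow> rf M"
proof -
  have "(\<lambda>n. pf (int n * 1 + k) * rf M * rf (int n * 1 + (k - M))) \<longlonglongrightarrow> qpoch_inf q q * rf M * (1 / qpoch_inf q q)"
    by (intro tendsto_mult pf_tendsto rf_tendsto tendsto_const) auto
  hence "(\<lambda>n. pf (int n * 1 + k) * rf M * rf (int n * 1 + (k - M))) \<longlonglongrightarrow> rf M"
    using qpoch_inf_nonzero[OF q_less] by simp
  moreover have "eventually (\<lambda>n. pf (int n * 1 + k) * rf M * rf (int n * 1 + (k - M)) = qbinom q (int n + k) M) sequentially"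
    by (rule eventually_sequentiallyI[of "nat (- k)"]) (auto simp: qbinom_eq algebra_simps)
  ultimately show ?thesis by (rule Lim_transform_eventually)
qed

text \<open>Note the order of the arguments: this is the limit of \<open>burge_sum b a u v\<close> as \<open>u\<close> tends to infinity.\<close>

definition bailey_sum :: "nat \<Rightarrow> nat \<Rightarrow> nat \<Rightarrow> complex" where
  "bailey_sum a b v = (\<Sum>j\<in>{- int v..int v}. (- 1) powi j * q powi (int (a * b) * j\<^sup>2 + j * (j + 1) div 2)
     * (rf (int v + int b * j) * rf (int v - int b * j)))"

lemma bailey_sum_eq:
  assumes "b \<ge> 1" "v \<le> N"
  shows "bailey_sum a b v = (\<Sum>j\<in>{- int N..int N}. (- 1) powi j * q powi (int (a * b) * j\<^sup>2 + j * (j + 1) div 2)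
     * (rf (int v + int b * j) * rf (int v - int b * j)))"
  unfolding bailey_sum_def
proof (rule sum.mono_neutral_left)
  show "\<forall>j\<in>{- int N..int N} - {- int v..int v}. (- 1) powi j * q powi (int (a * b) * j\<^sup>2 + j * (j + 1) div 2)
     * (rf (int v + int b * j) * rf (int v - int b * j)) = 0"
  proof
    fix j assume "j \<in> {- int N..int N} - {- int v..int v}"
    hence j: "\<bar>j\<bar> > int v" by auto
    have "int b * \<bar>j\<bar> \<ge> 1 * \<bar>j\<bar>" using assms by (intro mult_right_mono) auto
    hence "\<bar>int b * j\<bar> > int v" using j by (simp add: abs_mult)
    hence "int v + int b * j < 0 \<or> int v - int b * j < 0" by linarith
    thus "(- 1) powi j * q powi (int (a * b) * j\<^sup>2 + j * (j + 1) div 2)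
     * (rf (int v + int b * j) * rf (int v - int b * j)) = 0" by auto
  qed
qed (use assms in auto)

lemma burge_sum_tendsto:
  assumes "c \<ge> 1"
  shows "(\<lambda>u. burge_sum c e u v) \<longlonglongrightarrow> bailey_sum e c v"
proof -
  have "(\<lambda>u. \<Sum>j\<in>{- int v..int v}. burge_term c e u v j) \<longlonglongrightarrow> bailey_sum e c v"
    unfolding burge_term_def bailey_sum_def
  proof (intro tendsto_sum tendsto_mult)
    fix j :: int
    show "(\<lambda>u. q powi (int (c * e) * j\<^sup>2 + j * (j + 1) div 2)) \<longlonglongrightarrow> q powi (int (e * c) * j\<^sup>2 + j * (j + 1) div 2)"
      by (simp add: mult.commute)
    show "(\<lambda>u. qbinom q (int u + (int c * j - int e * j)) (int v + int c * j)) \<longlonglongrightarrow> rf (int v + int c * j)"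
      by (rule qbinom_tendsto)
    show "(\<lambda>u. qbinom q (int u - (int c * j - int e * j)) (int v - int c * j)) \<longlonglongrightarrow> rf (int v - int c * j)"
      using qbinom_tendsto[of "- (int c * j - int e * j)" "int v - int c * j"] by (simp only: add_uminus_conv_diff)
  qed auto
  moreover have "eventually (\<lambda>u. (\<Sum>j\<in>{- int v..int v}. burge_term c e u v j) = burge_sum c e u v) sequentially"
    using assms by (intro eventually_sequentiallyI[of v]) (simp add: burge_sum_eq[where N = v])
  ultimately show ?thesis by (rule Lim_transform_eventually)
qed

text \<open>Only the outermost \<open>q\<close>-binomial depends on \<open>u\<close>, and its limit
  1/(q)_(2v) no longer involves the summation variable.\<close>

fun burge_poly_inf :: "bool list \<Rightarrow> nat \<Rightarrow> complex" where
  "burge_poly_inf [] v = rf (int v)"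
| "burge_poly_inf (s # bs) v = rf (int (2 * v)) *
     (\<Sum>k\<le>v. q powi ((int (if s then k else v - k))\<^sup>2) * burge_poly bs v k)"

lemma burge_poly_tendsto: "(\<lambda>u. burge_poly bs u v) \<longlonglongrightarrow> burge_poly_inf bs v"
proof (cases bs)
  case Nil
  thus ?thesis using qbinom_tendsto[of 0] by simp
next
  case (Cons s bs')
  have "(\<lambda>u. qbinom q (int (v + u) - i) M) \<longlonglongrightarrow> rf M" for i M
    using qbinom_tendsto[of "int v - i" M] by (simp add: algebra_simps)
  hence "(\<lambda>u. \<Sum>k\<le>v. q powi ((int (if s then k else v - k))\<^sup>2) *
        qbinom q (int (v + u) - int (if s then k else v - k)) (int (2 * v)) * burge_poly bs' v k)
     \<longlonglongrightarrow> (\<Sum>k\<le>v. q powi ((int (if s then k else v - k))\<^sup>2) * rf (int (2 * v)) * burge_poly bs' v k)"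
    by (intro tendsto_sum tendsto_mult tendsto_const)
  thus ?thesis by (simp add: Cons sum_distrib_left mult_ac)
qed

lemma burge_poly_inf_eq:
  "burge_poly_inf bs v = bailey_sum (snd (burge_pair bs)) (fst (burge_pair bs)) v"
proof -
  have "(\<lambda>u. burge_sum (fst (burge_pair bs)) (snd (burge_pair bs)) u v) \<longlonglongrightarrow> bailey_sum (snd (burge_pair bs)) (fst (burge_pair bs)) v"
    using burge_pair_pos burge_sum_tendsto by blast
  moreover have "eventually (\<lambda>u. burge_sum (fst (burge_pair bs)) (snd (burge_pair bs)) u v = burge_poly bs u v) sequentially"
    by (intro eventually_sequentiallyI[of v]) (simp add: burge_poly_eq)
  ultimately have "(\<lambda>u. burge_poly bs u v) \<longlonglongrightarrow> bailey_sum (snd (burge_pair bs)) (fst (burge_pair bs)) v"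
    by (rule Lim_transform_eventually)
  thus ?thesis using burge_poly_tendsto LIMSEQ_unique by blast
qed

section \<open>Bailey's lemma and its unit seed\<close>

text \<open>A \<open>q\<close>-Chu-Vandermonde sum, obtained from \<open>saalschutz_aux\<close> by
  setting \<open>N1 = N2 = n\<close> and letting \<open>n\<close> tend to infinity.\<close>

lemma bailey_aux:
  fixes P c :: nat
  shows "(\<Sum>s\<le>P. q powi (int s * int (s + c)) * (rf (int P - int s) * rf (int s) * rf (int (s + c))))
     = rf (int P) * rf (int (P + c))"
proof -
  define Q where "Q = qpoch_inf q q"
  have Q: "Q \<noteq> 0" unfolding Q_def by (rule qpoch_inf_nonzero[OF q_less])
  \<comment> \<open>All arguments that depend on \<open>n\<close> are written in the shape
    \<open>int n * c + k\<close>, to which \<open>pf_tendsto\<close> and \<open>rf_tendsto\<close>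
    apply literally.\<close>
  have "(\<lambda>n. \<Sum>s\<le>P. q powi (int s * int (s + c)) * pf (int n * 2 + (int P - int s)) * rf (int P - int s)
            * rf (int n * 2 + 0) * pf (int n * 1 + 0) * rf (int s) * rf (int n * 1 + - int s)
            * rf (int (s + c)) * rf (int n * 1 + - int (s + c)))
       \<longlonglongrightarrow> (\<Sum>s\<le>P. q powi (int s * int (s + c)) * Q * rf (int P - int s)
            * (1 / Q) * Q * rf (int s) * (1 / Q) * rf (int (s + c)) * (1 / Q))"
    unfolding Q_def by (intro tendsto_sum tendsto_mult tendsto_const pf_tendsto rf_tendsto) auto
  moreover have "(\<lambda>n. pf (int n * 1 + int (P + c)) * rf (int P) * rf (int n * 1 + int c) * pf (int n * 1 + int P) * rf (int (P + c)) * rf (int n * 1 + - int c)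
         * rf (int n * 1 + 0)) \<longlonglongrightarrow> Q * rf (int P) * (1 / Q) * Q * rf (int (P + c)) * (1 / Q) * (1 / Q)"
    unfolding Q_def by (intro tendsto_mult tendsto_const pf_tendsto rf_tendsto) auto
  moreover have "(\<Sum>s\<le>P. q powi (int s * int (s + c)) * pf (int n * 2 + (int P - int s)) * rf (int P - int s)
            * rf (int n * 2 + 0) * pf (int n * 1 + 0) * rf (int s) * rf (int n * 1 + - int s)
            * rf (int (s + c)) * rf (int n * 1 + - int (s + c)))
        = pf (int n * 1 + int (P + c)) * rf (int P) * rf (int n * 1 + int c) * pf (int n * 1 + int P) * rf (int (P + c)) * rf (int n * 1 + - int c)
         * rf (int n * 1 + 0)" for n
  proof -
    have e: "int n * 2 + (int P - int s) = int (n + n + P) - int s" "int n * 2 + 0 = int (n + n)"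
      "int n * 1 + 0 = int n" "int n * 1 + - int s = int n - int s"
      "int n * 1 + - int (s + c) = int n - int (s + c)" for s by simp_all
    have e': "int n * 1 + int (P + c) = int (n + P + c)" "int n * 1 + int c = int (n + c)"
      "int n * 1 + int P = int (n + P)" "int n * 1 + - int c = int n - int c" by simp_all
    show ?thesis unfolding e e' by (rule saalschutz_aux)
  qed
  ultimately have "(\<Sum>s\<le>P. q powi (int s * int (s + c)) * Q * rf (int P - int s)
            * (1 / Q) * Q * rf (int s) * (1 / Q) * rf (int (s + c)) * (1 / Q))
       = Q * rf (int P) * (1 / Q) * Q * rf (int (P + c)) * (1 / Q) * (1 / Q)"
    using LIMSEQ_unique by (simp only:)
  hence "(\<Sum>s\<le>P. (1 / Q) * (q powi (int s * int (s + c)) * (rf (int P - int s) * rf (int s) * rf (int (s + c)))))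
     = (1 / Q) * (rf (int P) * rf (int (P + c)))"
    using Q by (simp add: mult_ac)
  thus ?thesis using Q unfolding sum_distrib_left[symmetric] by simp
qed

text \<open>Symmetry in the sign of \<open>B\<close> allows \<open>B = int b\<close>; then
  \<open>k = s + b\<close> turns the sum into \<open>bailey_aux\<close> with shift
  \<open>2 * b\<close>.\<close>

lemma bailey_lemma:
  "(\<Sum>k\<le>I. q powi ((int k)\<^sup>2) * rf (int I - int k) * (rf (int k + B) * rf (int k - B)))
     = q powi (B\<^sup>2) * (rf (int I + B) * rf (int I - B))"
proof -
  define b where "b = nat \<bar>B\<bar>"
  have B: "B = int b \<or> B = - int b" by (auto simp: b_def)
  have "(\<Sum>k\<le>I. q powi ((int k)\<^sup>2) * rf (int I - int k) * (rf (int k + int b) * rf (int k - int b)))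
     = q powi ((int b)\<^sup>2) * (rf (int I + int b) * rf (int I - int b))" (is "sum ?f _ = _")
  proof (cases "b \<le> I")
    case False
    thus ?thesis by (simp add: sum.neutral)
  next
    case True
    define P where "P = I - b"
    have P: "int P = int I - int b" using True by (simp add: P_def)
    have "(\<Sum>k\<le>I. ?f k) = (\<Sum>k\<in>{0 + b..P + b}. ?f k)"
      by (rule sum.mono_neutral_right) (use True in \<open>auto simp: P_def\<close>)
    also have "\<dots> = (\<Sum>s\<le>P. ?f (s + b))"
      by (subst sum.shift_bounds_cl_nat_ivl) (simp add: atLeast0AtMost)
    also have "\<dots> = (\<Sum>s\<le>P. q powi ((int b)\<^sup>2) * (q powi (int s * int (s + 2 * b)) * (rf (int P - int s) * rf (int s) * rf (int (s + 2 * b)))))"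
    proof (rule sum.cong[OF refl])
      fix s
      have "(int (s + b))\<^sup>2 = (int b)\<^sup>2 + int s * int (s + 2 * b)"
        by (simp add: power2_eq_square algebra_simps)
      moreover have "int I - int (s + b) = int P - int s" "int (s + b) + int b = int (s + 2 * b)" "int (s + b) - int b = int s"
        using P by simp_all
      ultimately show "?f (s + b) = q powi ((int b)\<^sup>2) * (q powi (int s * int (s + 2 * b)) * (rf (int P - int s) * rf (int s) * rf (int (s + 2 * b))))"
        by (simp only: powi_add mult_ac)
    qed
    also have "\<dots> = q powi ((int b)\<^sup>2) * (rf (int P) * rf (int (P + 2 * b)))"
      unfolding sum_distrib_left[symmetric] bailey_aux ..
    also have "int (P + 2 * b) = int I + int b" using P by simp
    finally show ?thesis using P by (simp add: mult_ac)
  qed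
  thus ?thesis using B by (auto simp: mult_ac)
qed

text \<open>Applying \<open>bailey_lemma\<close> with \<open>B = b j\<close> to each term adds
  \<open>(b j)\<^sup>2\<close> to the exponent and so raises \<open>a b\<close> to
  \<open>(a + b) b\<close>.\<close>

lemma bailey_sum_rec:
  assumes "b \<ge> 1"
  shows "bailey_sum (a + b) b I = (\<Sum>k\<le>I. q powi ((int k)\<^sup>2) * rf (int (I - k)) * bailey_sum a b k)"
proof -
  define w where "w j = (- 1) powi j * q powi (int (a * b) * j\<^sup>2 + j * (j + 1) div 2)" for j
  have "(\<Sum>k\<le>I. q powi ((int k)\<^sup>2) * rf (int (I - k)) * bailey_sum a b k)
     = (\<Sum>k\<le>I. \<Sum>j\<in>{- int I..int I}. w j * (q powi ((int k)\<^sup>2) * rf (int I - int k) * (rf (int k + int b * j) * rf (int k - int b * j))))"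
    using assms by (intro sum.cong) (auto simp: bailey_sum_eq[where N = I] w_def sum_distrib_left of_nat_diff mult_ac)
  also have "\<dots> = (\<Sum>j\<in>{- int I..int I}. \<Sum>k\<le>I. w j * (q powi ((int k)\<^sup>2) * rf (int I - int k) * (rf (int k + int b * j) * rf (int k - int b * j))))"
    by (rule sum.swap)
  also have "\<dots> = (\<Sum>j\<in>{- int I..int I}. w j * (q powi ((int b * j)\<^sup>2) * (rf (int I + int b * j) * rf (int I - int b * j))))"
    unfolding sum_distrib_left[symmetric] bailey_lemma ..
  also have "\<dots> = bailey_sum (a + b) b I"
    unfolding bailey_sum_def w_def
  proof (rule sum.cong[OF refl])
    fix j
    have "int ((a + b) * b) * j\<^sup>2 + j * (j + 1) div 2 = (int (a * b) * j\<^sup>2 + j * (j + 1) div 2) + (int b * j)\<^sup>2"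
      by (simp add: power2_eq_square algebra_simps)
    thus "(- 1) powi j * q powi (int (a * b) * j\<^sup>2 + j * (j + 1) div 2) * (q powi (int b * j)\<^sup>2 * (rf (int I + int b * j) * rf (int I - int b * j)))
      = (- 1) powi j * q powi (int ((a + b) * b) * j\<^sup>2 + j * (j + 1) div 2) * (rf (int I + int b * j) * rf (int I - int b * j))"
      by (simp only: powi_add mult.assoc)
  qed
  finally show ?thesis ..
qed

text \<open>The Bailey step from \<open>(0, 1)\<close> to \<open>(1, 1)\<close> is a triangular
  system with nonzero diagonal \<open>q powi ((int I)\<^sup>2)\<close>, and its image
  \<open>rf (int I)\<close> is known. This delta is the seed for \<open>b = 1\<close>.\<close>

lemma bailey_sum_0_1: "bailey_sum 0 1 I = (if I = 0 then 1 else 0)"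
proof (induction I rule: less_induct)
  case (less I)
  have "bailey_sum 1 1 I = rf (int I)"
    using burge_poly_inf_eq[of "[]" I] by simp
  hence "rf (int I) = (\<Sum>k\<le>I. q powi ((int k)\<^sup>2) * rf (int (I - k)) * bailey_sum 0 1 k)"
    using bailey_sum_rec[of 1 0 I] by simp
  \<comment> \<open>By induction only \<open>k = 0\<close> survives below \<open>I\<close>, and for
    \<open>I > 0\<close> it already accounts for all of \<open>rf (int I)\<close>.\<close>
  also have "\<dots> = (\<Sum>k<I. q powi ((int k)\<^sup>2) * rf (int (I - k)) * (if k = 0 then 1 else 0)) + q powi ((int I)\<^sup>2) * bailey_sum 0 1 I"
    using less by (simp add: lessThan_Suc_atMost[symmetric])
  also have "(\<Sum>k<I. q powi ((int k)\<^sup>2) * rf (int (I - k)) * (if k = 0 then 1 else 0)) = (if I = 0 then 0 else rf (int I))"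
    by (cases I) (simp_all add: if_distrib[of "\<lambda>x. _ * x"] sum.delta cong: if_cong)
  finally show ?case by (auto split: if_splits)
qed

end

section \<open>The triple product\<close>

context nome
begin

text \<open>With n = q^N, \<open>p = q\<close> and w = q^j this compares the coefficients of x^j in
  the product over \<open>N + 1\<close> pairs with those over \<open>N\<close> pairs, after division
  by their common factor.\<close>

lemma triple_product_certificate:
  fixes n w p :: complex
  assumes "w \<noteq> 0"
  shows "(1 - n * n * p) * (1 - n * n * p * p) = (1 + n * n * p) * ((1 - n * p / w) * (1 - n * p * w))
     + n * (p / w * ((1 - n * p * w) * (1 - n * w))) + n * p * (w * ((1 - n * p / w) * (1 - n / w)))"
  using assms by (simp add: divide_simps) algebra

text \<open>The coefficients of the product over \<open>N + 1\<close> pairs of factors arise from those over \<open>N\<close> pairs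
  by multiplication with \<open>(1 - x q ^ N) (1 - q ^ (N + 1) / x)\<close>.\<close>

lemma triple_product_finite:
  assumes x: "x \<noteq> 0" and "N \<le> K"
  shows "(\<Sum>j\<in>{- int K..int K}. (- 1) powi j * x powi j * q powi (j * (j - 1) div 2)
           * (pf (int (2 * N)) * rf (int N - j) * rf (int N + j)))
       = qpoch x q N * qpoch (q / x) q N"
  using assms(2)
proof (induction N)
  case 0
  have "(\<Sum>j\<in>{- int K..int K}. (- 1) powi j * x powi j * q powi (j * (j - 1) div 2)
           * (pf (int (2 * 0)) * rf (int 0 - j) * rf (int 0 + j)))
      = (\<Sum>j\<in>{0}. (- 1) powi j * x powi j * q powi (j * (j - 1) div 2)
           * (pf (int (2 * 0)) * rf (int 0 - j) * rf (int 0 + j)))"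
  proof (rule sum.mono_neutral_right)
    show "\<forall>j\<in>{- int K..int K} - {0}. (- 1) powi j * x powi j * q powi (j * (j - 1) div 2)
           * (pf (int (2 * 0)) * rf (int 0 - j) * rf (int 0 + j)) = 0"
    proof
      fix j assume "j \<in> {- int K..int K} - {0}"
      hence "int 0 - j < 0 \<or> int 0 + j < 0" by auto
      thus "(- 1) powi j * x powi j * q powi (j * (j - 1) div 2) * (pf (int (2 * 0)) * rf (int 0 - j) * rf (int 0 + j)) = 0"
        by auto
    qed
  qed auto
  thus ?case by (simp add: qpoch_def)
next
  case (Suc N)
  define t where "t j = (- 1) powi j * x powi j * q powi (j * (j - 1) div 2)
           * (pf (int (2 * N)) * rf (int N - j) * rf (int N + j))" for j
  define n where "n = q powi (int N)"
  have rec: "(- 1) powi j * x powi j * q powi (j * (j - 1) div 2)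
           * (pf (int (2 * Suc N)) * rf (int (Suc N) - j) * rf (int (Suc N) + j))
       = (1 + n * n * q) * t j - n * (x * t (j - 1)) - n * q * (t (j + 1) / x)" for j
  proof -
    define w where "w = q powi j"
    have w: "w \<noteq> 0" by (simp add: w_def)
    define h where "h = (- 1) powi j * x powi j * q powi (j * (j - 1) div 2)
           * (pf (int (2 * N)) * rf (int N + 1 - j) * rf (int N + 1 + j))"
    have 1: "rf (int N - j) = (1 - n * q / w) * rf (int N + 1 - j)"
      using rf_rec[of "int N + 1 - j"] by (simp add: n_def w_def powi_diff powi_add)
    have 2: "rf (int N + j) = (1 - n * q * w) * rf (int N + 1 + j)"
    proof -
      have "q powi (int N + 1 + j) = n * q * w" by (simp only: powi_add n_def w_def power_int_1_right)
      moreover have "int N + 1 + j - 1 = int N + j" by simp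
      ultimately show ?thesis using rf_rec[of "int N + 1 + j"] by (simp only:)
    qed
    have 3: "rf (int N - (j + 1)) = (1 - n / w) * rf (int N - j)"
      using rf_rec[of "int N - j"] by (simp add: n_def w_def powi_diff algebra_simps)
    have 4: "rf (int N + (j - 1)) = (1 - n * w) * rf (int N + j)"
    proof -
      have "q powi (int N + j) = n * w" by (simp only: powi_add n_def w_def)
      moreover have "int N + (j - 1) = int N + j - 1" by simp
      ultimately show ?thesis using rf_rec[of "int N + j"] by (simp only:)
    qed
    have 5: "pf (int (2 * Suc N)) = (1 - n * n * q * q) * ((1 - n * n * q) * pf (int (2 * N)))"
    proof -
      have "q powi (int (2 * N) + 1) = n * n * q" "q powi (int (2 * N) + 1 + 1) = n * n * q * q"
      proof -
        have e: "int (2 * N) = int N + int N" by simp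
        show "q powi (int (2 * N) + 1) = n * n * q" "q powi (int (2 * N) + 1 + 1) = n * n * q * q"
          unfolding e n_def by (simp_all only: powi_add power_int_1_right)
      qed
      moreover have "int (2 * Suc N) = int (2 * N) + 1 + 1" by simp
      ultimately show ?thesis using pf_rec[of "int (2 * N)"] pf_rec[of "int (2 * N) + 1"] by simp
    qed
    have T1: "q powi (j * (j - 1) div 2) = q powi ((j - 1) * (j - 1 - 1) div 2) * (w / q)"
    proof -
      have "j * (j - 1) = (j - 1) * (j - 1 - 1) + (j - 1) * 2" by (simp add: algebra_simps)
      hence "j * (j - 1) div 2 = (j - 1) * (j - 1 - 1) div 2 + (j - 1)"
        using div_mult_self1[of 2 "(j - 1) * (j - 1 - 1)" "j - 1"] by linarith
      moreover have "q powi (j - 1) = w / q" by (simp add: powi_diff w_def)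
      ultimately show ?thesis by (simp only: powi_add)
    qed
    have T2: "q powi ((j + 1) * (j + 1 - 1) div 2) = q powi (j * (j - 1) div 2) * w"
    proof -
      have "(j + 1) * (j + 1 - 1) = j * (j - 1) + j * 2" by (simp add: algebra_simps)
      hence "(j + 1) * (j + 1 - 1) div 2 = j * (j - 1) div 2 + j"
        using div_mult_self1[of 2 "j * (j - 1)" j] by linarith
      thus ?thesis by (simp only: powi_add w_def)
    qed
    have s: "(- 1 :: complex) powi (j + 1) = - ((- 1) powi j)" "(- 1 :: complex) powi (j - 1) = - ((- 1) powi j)"
      by (simp_all add: power_int_add power_int_diff)
    have xp: "x powi (j + 1) = x powi j * x" "x powi (j - 1) = x powi j / x"
      using x by (simp_all add: power_int_add power_int_diff)
    have A: "t j = (1 - n * q / w) * (1 - n * q * w) * h"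
      unfolding t_def h_def 1 2 by (simp only: mult_ac)
    have e: "int N - (j - 1) = int N + 1 - j" "int N + (j + 1) = int N + 1 + j" by simp_all
    have B: "x * t (j - 1) = - (q / w * ((1 - n * q * w) * (1 - n * w))) * h"
    proof -
      have "x * t (j - 1) = x * (- ((- 1) powi j) * (x powi j / x) * (q powi (j * (j - 1) div 2) * (q / w))
         * (pf (int (2 * N)) * rf (int N + 1 - j) * ((1 - n * w) * ((1 - n * q * w) * rf (int N + 1 + j)))))"
      proof -
        have "q powi (j * (j - 1) div 2) * (q / w) = q powi ((j - 1) * (j - 1 - 1) div 2)"
          unfolding T1 using w by simp
        thus ?thesis unfolding t_def s xp e 4 2 by (simp only:)
      qed
      also have "\<dots> = - (q / w * ((1 - n * q * w) * (1 - n * w))) * h"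
        unfolding h_def using x by (simp add: mult_ac)
      finally show ?thesis .
    qed
    have D: "t (j + 1) / x = - (w * ((1 - n * q / w) * (1 - n / w))) * h"
      unfolding t_def s xp e 3 1 T2 h_def using x by (simp add: mult_ac)
    have e': "int (Suc N) - j = int N + 1 - j" "int (Suc N) + j = int N + 1 + j" by simp_all
    have "(- 1) powi j * x powi j * q powi (j * (j - 1) div 2)
           * (pf (int (2 * Suc N)) * rf (int (Suc N) - j) * rf (int (Suc N) + j))
       = ((1 - n * n * q) * (1 - n * n * q * q)) * h"
      unfolding 5 e' h_def by (simp only: mult_ac)
    also have "\<dots> = (1 + n * n * q) * t j - n * (x * t (j - 1)) - n * q * (t (j + 1) / x)"
      unfolding triple_product_certificate[OF w] A B D
      by (simp only: distrib_right mult_minus_left mult_minus_right diff_minus_eq_add mult.assoc)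
    finally show ?thesis .
  qed
  \<comment> \<open>Shifting the index leaves the sum over the fixed range unchanged only because
    \<open>t\<close> already vanishes at both ends; this uses \<open>Suc N \<le> K\<close>.\<close>
  have zero: "t j = 0" if "\<bar>j\<bar> \<ge> int K" for j
  proof -
    have "int N - j < 0 \<or> int N + j < 0" using that Suc.prems by linarith
    thus ?thesis by (auto simp: t_def)
  qed
  have s1: "(\<Sum>j\<in>{- int K..int K}. t (j + 1)) = (\<Sum>j\<in>{- int K..int K}. t j)"
    using sum_int_telescope[of t K] zero[of "int K + 1"] zero[of "- int K"] by (simp add: sum_subtractf)
  have s2: "(\<Sum>j\<in>{- int K..int K}. t (j - 1)) = (\<Sum>j\<in>{- int K..int K}. t j)"
    using sum_int_telescope[of "\<lambda>j. t (j - 1)" K] zero[of "int K"] zero[of "- int K - 1"] by (simp add: sum_subtractf)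
  have "(\<Sum>j\<in>{- int K..int K}. (- 1) powi j * x powi j * q powi (j * (j - 1) div 2)
           * (pf (int (2 * Suc N)) * rf (int (Suc N) - j) * rf (int (Suc N) + j)))
      = (1 + n * n * q - n * x - n * q / x) * (\<Sum>j\<in>{- int K..int K}. t j)"
    unfolding rec sum_subtractf sum_distrib_left[symmetric] sum_divide_distrib[symmetric] s1 s2
    by (simp add: algebra_simps)
  also have "(\<Sum>j\<in>{- int K..int K}. t j) = qpoch x q N * qpoch (q / x) q N"
    using Suc by (simp add: t_def)
  also have "1 + n * n * q - n * x - n * q / x = (1 - x * q ^ N) * (1 - q / x * q ^ N)"
    using x by (simp add: n_def field_simps)
  finally show ?case by (simp add: qpoch_def mult_ac)
qed

text \<open>In the finite form the \<open>q\<close>-binomial coefficient tends to 1/(q)_infinity and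
  is bounded uniformly in \<open>N\<close> and \<open>j\<close>, so a constant multiple of the
  absolute values of the limit series is a majorant for Tannery's theorem.\<close>

lemma triple_product:
  assumes x: "x \<noteq> 0" and summable: "(\<lambda>j :: int. norm (x powi j * q powi (j * (j - 1) div 2))) summable_on UNIV"
  shows "((\<lambda>j. (- 1) powi j * x powi j * q powi (j * (j - 1) div 2)) has_sum
            (qpoch_inf x q * qpoch_inf (q / x) q * qpoch_inf q q)) UNIV"
proof -
  define Q where "Q = qpoch_inf q q"
  have Q: "Q \<noteq> 0" unfolding Q_def by (rule qpoch_inf_nonzero[OF q_less])
  obtain K where K: "K \<ge> 1" "\<And>n. norm (pf n) \<le> K" "\<And>n. norm (rf n) \<le> K"
    using norm_pf_rf_bounded by blast
  define g where "g j = (- 1) powi j * x powi j * q powi (j * (j - 1) div 2)" for j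
  have "((\<lambda>j. g j * (Q * (1 / Q) * (1 / Q))) has_sum (qpoch_inf x q * qpoch_inf (q / x) q)) UNIV"
  proof (rule has_sum_tannery[where f = "\<lambda>N j. g j * (pf (int (2 * N)) * rf (int N - j) * rf (int N + j))"
       and h = "\<lambda>j. K * K * K * norm (x powi j * q powi (j * (j - 1) div 2))" and e = int_decode])
    show "bij int_decode" by (rule bij_int_decode)
    show "(\<lambda>N. g j * (pf (int (2 * N)) * rf (int N - j) * rf (int N + j))) \<longlonglongrightarrow> g j * (Q * (1 / Q) * (1 / Q))" for j
    proof -
      have "(\<lambda>N. g j * (pf (int N * 2 + 0) * rf (int N * 1 + - j) * rf (int N * 1 + j))) \<longlonglongrightarrow> g j * (Q * (1 / Q) * (1 / Q))"
        unfolding Q_def by (intro tendsto_mult tendsto_const pf_tendsto rf_tendsto) auto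
      thus ?thesis by (simp add: mult.commute)
    qed
    show "norm (g j * (pf (int (2 * N)) * rf (int N - j) * rf (int N + j))) \<le> K * K * K * norm (x powi j * q powi (j * (j - 1) div 2))" for N j
    proof -
      have "norm (pf (int (2 * N)) * rf (int N - j) * rf (int N + j)) \<le> K * K * K"
        unfolding norm_mult using K by (intro mult_mono mult_nonneg_nonneg) auto
      moreover have "norm (g j) = norm (x powi j * q powi (j * (j - 1) div 2))"
        by (simp add: g_def norm_mult norm_power_int)
      ultimately show ?thesis
        unfolding norm_mult[of "g j"] by (subst mult.commute) (simp only: mult_right_mono norm_ge_zero)
    qed
    show "(\<lambda>j. K * K * K * norm (x powi j * q powi (j * (j - 1) div 2))) summable_on UNIV"
      using summable by (rule summable_on_cmult_right)
    show "((\<lambda>j. g j * (pf (int (2 * N)) * rf (int N - j) * rf (int N + j))) has_sum (qpoch x q N * qpoch (q / x) q N)) UNIV" for N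
    proof (rule has_sum_finite_neutralI)
      show "qpoch x q N * qpoch (q / x) q N = (\<Sum>j\<in>{- int N..int N}. g j * (pf (int (2 * N)) * rf (int N - j) * rf (int N + j)))"
        using triple_product_finite[OF x order_refl, of N] by (simp add: g_def)
      show "g j * (pf (int (2 * N)) * rf (int N - j) * rf (int N + j)) = 0" if "j \<in> UNIV - {- int N..int N}" for j
      proof -
        have "int N - j < 0 \<or> int N + j < 0" using that by auto
        thus ?thesis by auto
      qed
    qed auto
    show "(\<lambda>N. qpoch x q N * qpoch (q / x) q N) \<longlonglongrightarrow> qpoch_inf x q * qpoch_inf (q / x) q"
      by (intro tendsto_mult qpoch_inf_LIMSEQ q_less)
  qed
  from has_sum_cmult_left[OF this, of Q] show ?thesis
    using Q by (simp add: g_def Q_def mult_ac)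
qed

section \<open>The limiting Bailey step and the theta series\<close>

text \<open>The limit of \<open>bailey_lemma\<close> as \<open>I\<close> tends to infinity: the
  right side gains two factors 1/(q)_infinity, one of which cancels against the limit of
  \<open>rf (int I - int k)\<close>.\<close>

lemma bailey_limit:
  "((\<lambda>k. q powi ((int k)\<^sup>2) * (rf (int k + B) * rf (int k - B))) has_sum (q powi (B\<^sup>2) / qpoch_inf q q)) UNIV"
proof -
  define Q where "Q = qpoch_inf q q"
  have Q: "Q \<noteq> 0" unfolding Q_def by (rule qpoch_inf_nonzero[OF q_less])
  obtain K where K: "K \<ge> 1" "\<And>n. norm (pf n) \<le> K" "\<And>n. norm (rf n) \<le> K"
    using norm_pf_rf_bounded by blast
  have "((\<lambda>k. q powi ((int k)\<^sup>2) * (1 / Q) * (rf (int k + B) * rf (int k - B))) has_sum (q powi (B\<^sup>2) * ((1 / Q) * (1 / Q)))) UNIV"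
  proof (rule has_sum_tannery[where f = "\<lambda>I k. q powi ((int k)\<^sup>2) * rf (int I - int k) * (rf (int k + B) * rf (int k - B))"
       and h = "\<lambda>k. norm q ^ k * (K * (K * K))" and e = id])
    show "(\<lambda>I. q powi ((int k)\<^sup>2) * rf (int I - int k) * (rf (int k + B) * rf (int k - B)))
        \<longlonglongrightarrow> q powi ((int k)\<^sup>2) * (1 / Q) * (rf (int k + B) * rf (int k - B))" for k
      using rf_tendsto[of 1 "- int k"] unfolding Q_def by (intro tendsto_mult tendsto_const) auto
    show "norm (q powi ((int k)\<^sup>2) * rf (int I - int k) * (rf (int k + B) * rf (int k - B))) \<le> norm q ^ k * (K * (K * K))" for I k
    proof -
      have "norm (q powi ((int k)\<^sup>2)) = norm q ^ (k * k)"
        by (metis norm_power of_nat_mult power2_eq_square power_int_of_nat)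
      also have "\<dots> \<le> norm q ^ k"
        using q_less by (intro power_decreasing) auto
      finally have 1: "norm (q powi ((int k)\<^sup>2)) \<le> norm q ^ k" .
      have "norm (q powi ((int k)\<^sup>2) * (rf (int I - int k) * (rf (int k + B) * rf (int k - B)))) \<le> norm q ^ k * (K * (K * K))"
        unfolding norm_mult using K 1 by (intro mult_mono mult_nonneg_nonneg) auto
      thus ?thesis by (simp add: mult.assoc)
    qed
    have "(\<lambda>k. norm q ^ k) summable_on (UNIV :: nat set)"
      using q_less by (intro norm_summable_imp_summable_on) (simp add: norm_power summable_geometric)
    thus "(\<lambda>k. norm q ^ k * (K * (K * K))) summable_on UNIV" by (rule summable_on_cmult_left)
    show "((\<lambda>k. q powi ((int k)\<^sup>2) * rf (int I - int k) * (rf (int k + B) * rf (int k - B))) has_sum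
        (q powi (B\<^sup>2) * (rf (int I + B) * rf (int I - B)))) UNIV" for I
      by (rule has_sum_finite_neutralI[where B = "{..I}"]) (auto simp: bailey_lemma)
    show "(\<lambda>I. q powi (B\<^sup>2) * (rf (int I + B) * rf (int I - B))) \<longlonglongrightarrow> q powi (B\<^sup>2) * ((1 / Q) * (1 / Q))"
      using rf_tendsto[of 1 B] rf_tendsto[of 1 "- B"] unfolding Q_def by (intro tendsto_mult tendsto_const) auto
  qed auto
  from has_sum_cmult_left[OF this, of Q] show ?thesis
    using Q by (simp add: Q_def mult_ac)
qed

text \<open>Comparison with a two-sided geometric series; the \<open>- 1\<close> in the bound costs
  only the constant factor \<open>1 / norm q\<close>.\<close>

lemma summable_on_powi_quadratic:
  assumes "\<And>j. e j \<ge> \<bar>j\<bar> - 1"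
  shows "(\<lambda>j :: int. norm (q powi e j)) summable_on UNIV"
proof -
  have le: "norm (q powi e j) \<le> norm q ^ nat \<bar>j\<bar> / norm q" for j
  proof -
    have "norm (q powi e j) = norm q powi e j" by (simp add: norm_power_int)
    also have "\<dots> \<le> norm q powi (int (nat \<bar>j\<bar>) - 1)"
      using assms[of j] q_less by (intro power_int_decreasing) auto
    also have "\<dots> = norm q ^ nat \<bar>j\<bar> / norm q"
      by (subst power_int_diff) (simp_all add: power_int_nonneg_exp)
    finally show ?thesis .
  qed
  have "(\<lambda>j :: int. norm q ^ nat \<bar>j\<bar> * (1 / norm q)) summable_on UNIV"
    using q_less by (intro summable_on_cmult_left summable_on_int_geometric) auto
  thus ?thesis
    by (rule Infinite_Sum.abs_summable_on_comparison_test') (use le in simp)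
qed

lemma triangular_ge: "(j :: int) * (j + 1) div 2 \<ge> \<bar>j\<bar> - 1"
proof -
  have "j * (j + 1) \<ge> (\<bar>j\<bar> - 1) * 2"
  proof (cases "j \<ge> 0")
    case True
    hence "j * (j + 1) - (\<bar>j\<bar> - 1) * 2 = j * (j - 1) + 2" by (simp add: algebra_simps)
    moreover have "j * (j - 1) \<ge> 0" using True by (cases "j = 0") auto
    ultimately show ?thesis by linarith
  next
    case False
    hence "j * (j + 1) - (\<bar>j\<bar> - 1) * 2 = (- j - 1) * (- j - 2)" by (simp add: algebra_simps)
    moreover have "(- j - 1) * (- j - 2) \<ge> 0"
      using False by (cases "j = - 1") auto
    ultimately show ?thesis by linarith
  qed
  from zdiv_mono1[OF this, of 2] show ?thesis by simp
qed

text \<open>The triple product in base p = q^(2n+1) at x = q^(n+1), for which p/x = q^n. Its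
  exponent (n+1) j + (2n+1) j(j-1)/2 equals n j^2 + j(j+1)/2.\<close>

lemma theta_product:
  assumes "n \<ge> 1"
  shows "((\<lambda>j. (- 1) powi j * q powi (int n * j\<^sup>2 + j * (j + 1) div 2)) has_sum
     (qpoch_inf (q ^ n) (q ^ (2 * n + 1)) * qpoch_inf (q ^ (n + 1)) (q ^ (2 * n + 1))
       * qpoch_inf (q ^ (2 * n + 1)) (q ^ (2 * n + 1)))) UNIV"
proof -
  define p x where "p = q ^ (2 * n + 1)" and "x = q ^ (n + 1)"
  interpret p: nome p
  proof
    show "p \<noteq> 0" by (simp add: p_def)
    have "norm q ^ (2 * n + 1) \<le> norm q ^ 1" using q_less by (intro power_decreasing) auto
    also have "\<dots> < 1" using q_less by simp
    finally show "norm p < 1" by (simp only: p_def norm_power)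
  qed
  have e: "x powi j * p powi (j * (j - 1) div 2) = q powi (int n * j\<^sup>2 + j * (j + 1) div 2)" for j
  proof -
    have "x powi j * p powi (j * (j - 1) div 2) = q powi (int (n + 1) * j + int (2 * n + 1) * (j * (j - 1) div 2))"
      by (simp only: x_def p_def power_int_power powi_add)
    also have "int (n + 1) * j + int (2 * n + 1) * (j * (j - 1) div 2) = int n * j\<^sup>2 + j * (j + 1) div 2"
    proof -
      have "even (j * (j - 1))" by simp
      then obtain t where t: "j * (j - 1) = 2 * t" by (elim evenE)
      have "j * (j + 1) = 2 * (t + j)" using t by (simp add: algebra_simps)
      hence "j * (j + 1) div 2 = t + j" by simp
      moreover have "j * (j - 1) div 2 = t" using t by simp
      moreover have "j\<^sup>2 = 2 * t + j" using t by (simp add: algebra_simps power2_eq_square)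
      ultimately show ?thesis by (simp add: algebra_simps)
    qed
    finally show ?thesis .
  qed
  have "((\<lambda>j. (- 1) powi j * x powi j * p powi (j * (j - 1) div 2)) has_sum
            (qpoch_inf x p * qpoch_inf (p / x) p * qpoch_inf p p)) UNIV"
  proof (rule p.triple_product)
    show "x \<noteq> 0" by (simp add: x_def)
    have "int n * j\<^sup>2 + j * (j + 1) div 2 \<ge> \<bar>j\<bar> - 1" for j
      using triangular_ge[of j] by (simp add: add_increasing)
    thus "(\<lambda>j :: int. norm (x powi j * p powi (j * (j - 1) div 2))) summable_on UNIV"
      unfolding e by (rule summable_on_powi_quadratic)
  qed
  moreover have "p / x = q ^ n"
  proof -
    have "2 * n + 1 = (n + 1) + n" by simp
    hence "p = x * q ^ n" unfolding p_def x_def by (simp only: power_add)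
    thus ?thesis by (simp add: x_def)
  qed
  ultimately show ?thesis unfolding mult.assoc e by (simp only: p_def x_def mult_ac)
qed

text \<open>One absolutely convergent double series is summed in two ways. Summing over
  \<open>k\<close> first, by \<open>bailey_limit\<close>, leaves the theta series; summing over
  \<open>j\<close> first is a finite sum and gives \<open>bailey_sum\<close>.\<close>

lemma bailey_sum_limit:
  assumes b: "b \<ge> 1"
  shows "((\<lambda>k. q powi ((int k)\<^sup>2) * bailey_sum a b k) has_sum
     (qpoch_inf (q ^ ((a + b) * b)) (q ^ (2 * ((a + b) * b) + 1)) * qpoch_inf (q ^ ((a + b) * b + 1)) (q ^ (2 * ((a + b) * b) + 1))
       * qpoch_inf (q ^ (2 * ((a + b) * b) + 1)) (q ^ (2 * ((a + b) * b) + 1)) / qpoch_inf q q)) UNIV"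
    (is "(_ has_sum (?T / _)) _")
proof -
  define Q where "Q = qpoch_inf q q"
  obtain K where K: "K \<ge> 1" "\<And>n. norm (pf n) \<le> K" "\<And>n. norm (rf n) \<le> K"
    using norm_pf_rf_bounded by blast
  define e where "e j = int (a * b) * j\<^sup>2 + j * (j + 1) div 2" for j
  define f where "f = (\<lambda>(j :: int, k :: nat). (- 1) powi j * q powi e j * (q powi ((int k)\<^sup>2) * (rf (int k + int b * j) * rf (int k - int b * j))))"
  have e: "e j \<ge> \<bar>j\<bar> - 1" for j
    using triangular_ge[of j] by (simp add: e_def add_increasing)
  \<comment> \<open>A product majorant: \<open>K\<close> bounds every \<open>rf\<close>, and the
    square in the exponent is weakened to \<open>k\<close>.\<close>
  define h where "h = (\<lambda>(j :: int, k :: nat). norm (q powi e j) * (norm q ^ k * (K * K)))"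
  have gs: "(\<lambda>k. norm q ^ k) summable_on (UNIV :: nat set)"
    using q_less by (intro norm_summable_imp_summable_on) (simp add: norm_power summable_geometric)
  have "h summable_on (UNIV \<times> UNIV)"
  proof (rule summable_on_SigmaI)
    show "((\<lambda>k. h (j, k)) has_sum (norm (q powi e j) * infsum (\<lambda>k. norm q ^ k * (K * K)) UNIV)) UNIV" for j
      unfolding h_def prod.case by (intro has_sum_cmult_right has_sum_infsum summable_on_cmult_left gs)
    show "(\<lambda>j. norm (q powi e j) * infsum (\<lambda>k. norm q ^ k * (K * K)) UNIV) summable_on UNIV"
      by (intro summable_on_cmult_left summable_on_powi_quadratic e)
    show "h (j, k) \<ge> 0" for j k using K by (simp add: h_def)
  qed
  hence "(\<lambda>z. norm (f z)) summable_on (UNIV \<times> UNIV)"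
  proof (rule Infinite_Sum.abs_summable_on_comparison_test')
    fix z :: "int \<times> nat"
    obtain j k where z: "z = (j, k)" by (cases z)
    have "norm (q powi ((int k)\<^sup>2)) = norm q ^ (k * k)"
      by (metis norm_power of_nat_mult power2_eq_square power_int_of_nat)
    also have "\<dots> \<le> norm q ^ k"
      using q_less by (intro power_decreasing) auto
    finally have "norm (q powi ((int k)\<^sup>2)) \<le> norm q ^ k" .
    hence "norm (q powi ((int k)\<^sup>2) * (rf (int k + int b * j) * rf (int k - int b * j))) \<le> norm q ^ k * (K * K)"
      unfolding norm_mult using K by (intro mult_mono mult_nonneg_nonneg) auto
    thus "norm (f z) \<le> h z"
      unfolding z f_def h_def prod.case norm_mult by (simp add: norm_power_int mult_left_mono)
  qed
  hence fs: "f summable_on (UNIV \<times> UNIV)" by (rule abs_summable_summable)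
  have "(f has_sum (?T * (1 / Q))) (UNIV \<times> UNIV)"
  proof (rule has_sum_SigmaI)
    show "((\<lambda>k. f (j, k)) has_sum ((- 1) powi j * q powi e j * (q powi ((int b * j)\<^sup>2) / Q))) UNIV" for j
      unfolding f_def prod.case Q_def by (intro has_sum_cmult_right bailey_limit)
    have "e j + (int b * j)\<^sup>2 = int ((a + b) * b) * j\<^sup>2 + j * (j + 1) div 2" for j
      by (simp add: e_def power2_eq_square algebra_simps)
    hence "q powi e j * q powi ((int b * j)\<^sup>2) = q powi (int ((a + b) * b) * j\<^sup>2 + j * (j + 1) div 2)" for j
      by (metis powi_add)
    hence E: "(- 1) powi j * q powi e j * (q powi ((int b * j)\<^sup>2) / Q)
       = (- 1) powi j * q powi (int ((a + b) * b) * j\<^sup>2 + j * (j + 1) div 2) * (1 / Q)" for j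
      by (simp add: mult.assoc)
    have n: "(a + b) * b \<ge> 1" using b by simp
    show "((\<lambda>j. (- 1) powi j * q powi e j * (q powi ((int b * j)\<^sup>2) / Q)) has_sum (?T * (1 / Q))) UNIV"
      unfolding E by (rule has_sum_cmult_left[OF theta_product[OF n]])
  qed (rule fs)
  hence "((f \<circ> prod.swap) has_sum (?T * (1 / Q))) (UNIV \<times> UNIV)"
    by (subst has_sum_reindex[symmetric]) (auto simp: product_swap)
  hence "((\<lambda>k. q powi ((int k)\<^sup>2) * bailey_sum a b k) has_sum (?T * (1 / Q))) UNIV"
  proof (rule has_sum_SigmaD)
    fix k :: nat
    show "((\<lambda>j. (f \<circ> prod.swap) (k, j)) has_sum (q powi ((int k)\<^sup>2) * bailey_sum a b k)) UNIV"
    proof (rule has_sum_finite_neutralI[where B = "{- int k..int k}"])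
      show "q powi ((int k)\<^sup>2) * bailey_sum a b k = (\<Sum>j\<in>{- int k..int k}. (f \<circ> prod.swap) (k, j))"
        unfolding bailey_sum_def sum_distrib_left by (intro sum.cong) (auto simp: f_def e_def mult_ac)
      show "(f \<circ> prod.swap) (k, j) = 0" if "j \<in> UNIV - {- int k..int k}" for j
      proof -
        have j: "\<bar>j\<bar> > int k" using that by auto
        have "int b * \<bar>j\<bar> \<ge> 1 * \<bar>j\<bar>" using b by (intro mult_right_mono) auto
        hence "\<bar>int b * j\<bar> > int k" using j by (simp add: abs_mult)
        hence "int k + int b * j < 0 \<or> int k - int b * j < 0" by linarith
        thus ?thesis by (auto simp: f_def)
      qed
    qed auto
  qed
  thus ?thesis by (simp add: Q_def)
qed

end

section \<open>Unrolling the recursions\<close>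

lemma has_sum_finite_partition:
  fixes f :: "'a \<Rightarrow> 'b :: topological_comm_monoid_add"
  assumes "finite A" and "\<And>k. k \<in> A \<Longrightarrow> (f has_sum g k) {x \<in> \<Omega>. \<kappa> x = k}"
  shows "(f has_sum (\<Sum>k\<in>A. g k)) {x \<in> \<Omega>. \<kappa> x \<in> A}"
  using assms
proof (induction A rule: finite_induct)
  case (insert a A)
  have "(f has_sum (g a + (\<Sum>k\<in>A. g k))) ({x \<in> \<Omega>. \<kappa> x = a} \<union> {x \<in> \<Omega>. \<kappa> x \<in> A})"
    using insert by (intro has_sum_Un_disjoint) auto
  moreover have "{x \<in> \<Omega>. \<kappa> x = a} \<union> {x \<in> \<Omega>. \<kappa> x \<in> A} = {x \<in> \<Omega>. \<kappa> x \<in> insert a A}" by auto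
  ultimately show ?case using insert by simp
qed simp

text \<open>One step of unrolling a recursion: \<open>\<kappa>\<close> is the next summation
  variable, \<open>\<phi> k\<close> inserts the outer variable, and vanishing beyond
  \<open>v\<close> leaves finitely many fibres.\<close>

lemma has_sum_fibration:
  fixes f :: "'a \<Rightarrow> 'b :: {topological_comm_monoid_add, topological_semigroup_mult, semiring_0}" and \<kappa> :: "'a \<Rightarrow> nat"
  assumes bij: "\<And>k. k \<le> v \<Longrightarrow> bij_betw (\<phi> k) (\<Omega>' k) {x \<in> \<Omega>. \<kappa> x = k}"
    and f: "\<And>k y. k \<le> v \<Longrightarrow> y \<in> \<Omega>' k \<Longrightarrow> f (\<phi> k y) = w k * F y"
    and zero: "\<And>x. x \<in> \<Omega> \<Longrightarrow> \<kappa> x > v \<Longrightarrow> f x = 0"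
    and F: "\<And>k. k \<le> v \<Longrightarrow> (F has_sum S k) (\<Omega>' k)"
  shows "(f has_sum (\<Sum>k\<le>v. w k * S k)) \<Omega>"
proof -
  have "(f has_sum (w k * S k)) {x \<in> \<Omega>. \<kappa> x = k}" if k: "k \<le> v" for k
  proof -
    have "((\<lambda>y. w k * F y) has_sum (w k * S k)) (\<Omega>' k)"
      using F[OF k] by (rule has_sum_cmult_right)
    hence "((\<lambda>y. f (\<phi> k y)) has_sum (w k * S k)) (\<Omega>' k)"
      by (rule has_sum_cong[THEN iffD1, rotated]) (simp add: f[OF k])
    thus ?thesis using has_sum_reindex_bij_betw[OF bij[OF k], of f] by simp
  qed
  hence "(f has_sum (\<Sum>k\<in>{..v}. w k * S k)) {x \<in> \<Omega>. \<kappa> x \<in> {..v}}"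
    by (intro has_sum_finite_partition) auto
  moreover have "(f has_sum (\<Sum>k\<le>v. w k * S k)) {x \<in> \<Omega>. \<kappa> x \<in> {..v}} \<longleftrightarrow> (f has_sum (\<Sum>k\<le>v. w k * S k)) \<Omega>"
    by (rule has_sum_cong_neutral) (use zero in \<open>auto simp: not_le\<close>)
  ultimately show ?thesis by simp
qed

section \<open>Sums with controlled absolute values\<close>

text \<open>Values on single fibres do not guarantee convergence over infinitely many fibres; the
  bound \<open>b\<close> on the sum of norms is what permits the later passage to the whole index
  set.\<close>

definition bounded_has_sum :: "('a \<Rightarrow> complex) \<Rightarrow> complex \<Rightarrow> real \<Rightarrow> 'a set \<Rightarrow> bool" where
  "bounded_has_sum f S b \<Omega> \<longleftrightarrow> (f has_sum S) \<Omega> \<and> (\<exists>c\<le>b. ((\<lambda>x. norm (f x)) has_sum c) \<Omega>)"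

text \<open>Each unrolled variable costs a factor \<open>K\<close> for its weight and a factor
  \<open>v + 1\<close> for the number of its values, so the bound gains one degree in
  \<open>v\<close>.\<close>

lemma bounded_has_sum_fibration:
  fixes \<kappa> :: "'a \<Rightarrow> nat"
  assumes bij: "\<And>k. k \<le> v \<Longrightarrow> bij_betw (\<phi> k) (\<Omega>' k) {x \<in> \<Omega>. \<kappa> x = k}"
    and f: "\<And>k y. k \<le> v \<Longrightarrow> y \<in> \<Omega>' k \<Longrightarrow> f (\<phi> k y) = w k * F y"
    and zero: "\<And>x. x \<in> \<Omega> \<Longrightarrow> \<kappa> x > v \<Longrightarrow> f x = 0"
    and F: "\<And>k. k \<le> v \<Longrightarrow> bounded_has_sum F (S k) ((K * (real k + 1)) ^ N) (\<Omega>' k)"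
    and w: "\<And>k. k \<le> v \<Longrightarrow> norm (w k) \<le> K" and K: "K \<ge> 1"
  shows "bounded_has_sum f (\<Sum>k\<le>v. w k * S k) ((K * (real v + 1)) ^ Suc N) \<Omega>"
proof -
  obtain c where c: "\<And>k. k \<le> v \<Longrightarrow> c k \<le> (K * (real k + 1)) ^ N"
    "\<And>k. k \<le> v \<Longrightarrow> ((\<lambda>y. norm (F y)) has_sum c k) (\<Omega>' k)"
    using F unfolding bounded_has_sum_def by metis
  have n: "((\<lambda>x. norm (f x)) has_sum (\<Sum>k\<le>v. norm (w k) * c k)) \<Omega>"
    by (rule has_sum_fibration[OF bij, where F = "\<lambda>y. norm (F y)"]) (use f zero c in \<open>auto simp: norm_mult\<close>)
  have "(\<Sum>k\<le>v. norm (w k) * c k) \<le> (\<Sum>k\<le>v. K * (K * (real v + 1)) ^ N)"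
  proof (rule sum_mono)
    fix k assume k: "k \<in> {..v}"
    have "c k \<le> (K * (real k + 1)) ^ N" using c k by simp
    also have "\<dots> \<le> (K * (real v + 1)) ^ N"
      using k K by (intro power_mono mult_left_mono) auto
    finally show "norm (w k) * c k \<le> K * (K * (real v + 1)) ^ N"
      using w[of k] k K has_sum_nonneg[OF c(2)[of k]] by (intro mult_mono) auto
  qed
  also have "(\<Sum>k\<le>v. K * (K * (real v + 1)) ^ N) = (K * (real v + 1)) ^ Suc N"
    by (simp add: algebra_simps)
  finally have "(\<Sum>k\<le>v. norm (w k) * c k) \<le> (K * (real v + 1)) ^ Suc N" .
  moreover have "(f has_sum (\<Sum>k\<le>v. w k * S k)) \<Omega>"
    by (rule has_sum_fibration[OF bij, where F = F]) (use f zero F in \<open>auto simp: bounded_has_sum_def\<close>)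
  ultimately show ?thesis using n unfolding bounded_has_sum_def
    by (intro conjI exI[of _ "\<Sum>k\<le>v. norm (w k) * c k"]) assumption+
qed

lemma bounded_has_sum_singleton: "norm (f x) \<le> b \<Longrightarrow> bounded_has_sum f (f x) b {x}"
  unfolding bounded_has_sum_def by (auto intro!: exI[of _ "norm (f x)"] has_sum_finiteI)

text \<open>Summability of the norm bounds over all fibres makes \<open>f\<close> absolutely
  summable on the disjoint union, so the fibre sums may be added up.\<close>

lemma has_sum_nat_partition:
  fixes f :: "'a \<Rightarrow> complex" and \<kappa> :: "'a \<Rightarrow> nat"
  assumes F: "\<And>k. bounded_has_sum f (g k) (b k) {x \<in> \<Omega>. \<kappa> x = k}"
    and b: "summable b" and g: "(g has_sum s) UNIV"
  shows "(f has_sum s) \<Omega>"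
proof -
  obtain c where c: "\<And>k. c k \<le> b k" "\<And>k. ((\<lambda>y. norm (f y)) has_sum c k) {x \<in> \<Omega>. \<kappa> x = k}"
    using F unfolding bounded_has_sum_def by metis
  have c0: "c k \<ge> 0" for k using has_sum_nonneg[OF c(2)[of k]] by simp
  have "summable c"
    by (rule summable_comparison_test'[OF b, of 0]) (use c c0 in auto)
  hence cs: "c summable_on UNIV" using c0 by (intro norm_summable_imp_summable_on) auto
  define B where "B k = {x \<in> \<Omega>. \<kappa> x = k}" for k
  have "(\<lambda>z. norm (f (snd z))) summable_on Sigma UNIV B"
    by (rule summable_on_SigmaI[where g = c]) (use c cs in \<open>auto simp: B_def\<close>)
  hence "(\<lambda>z. f (snd z)) summable_on Sigma UNIV B" by (rule abs_summable_summable)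
  hence "((\<lambda>z. f (snd z)) has_sum s) (Sigma UNIV B)"
    by (intro has_sum_SigmaI[OF _ g]) (use F in \<open>auto simp: bounded_has_sum_def B_def\<close>)
  moreover have "bij_betw snd (Sigma UNIV B) \<Omega>"
    by (rule bij_betwI[where g = "\<lambda>x. (\<kappa> x, x)"]) (auto simp: B_def)
  ultimately show ?thesis using has_sum_reindex_bij_betw[of snd "Sigma UNIV B" \<Omega> f] by simp
qed

lemma summable_power_times_geometric:
  fixes r :: real
  assumes "0 < r" "r < 1"
  shows "summable (\<lambda>I. (real I + 1) ^ N * r ^ I)"
proof -
  \<comment> \<open>Splitting r^I into \<open>N + 1\<close> equal parts leaves one geometric factor
    and gives each of the \<open>N\<close> factors \<open>I + 1\<close> its own damping.\<close>
  define y where "y = root (Suc N) r"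
  have y: "0 < y" "y < 1" using assms by (auto simp: y_def)
  have yN: "y ^ Suc N = r" using assms unfolding y_def by (intro real_root_pow_pos2) auto
  have "(\<lambda>I. real I * y ^ I) \<longlonglongrightarrow> 0" using powser_times_n_limit_0[of y] y by simp
  hence "Bseq (\<lambda>I. real I * y ^ I)" using convergentI convergent_imp_Bseq by blast
  then obtain C where C: "C > 0" "\<And>I. norm (real I * y ^ I) \<le> C" by (auto simp: Bseq_def)
  have "norm ((real I + 1) ^ N * r ^ I) \<le> (C + 1) ^ N * y ^ I" for I
  proof -
    have "real I * y ^ I \<le> C" using C(2)[of I] unfolding real_norm_def by (rule abs_le_D1)
    moreover have "y ^ I \<le> 1" using y by (intro power_le_one) auto
    ultimately have "(real I + 1) * y ^ I \<le> C + 1" unfolding distrib_right by linarith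
    hence "((real I + 1) * y ^ I) ^ N \<le> (C + 1) ^ N" using y by (intro power_mono) auto
    moreover have "(real I + 1) ^ N * r ^ I = ((real I + 1) * y ^ I) ^ N * y ^ I"
      unfolding yN[symmetric] power_mult_distrib power_mult[symmetric] mult.assoc power_add[symmetric]
      by (simp add: algebra_simps)
    moreover have "(real I + 1) ^ N * r ^ I \<ge> 0" "y ^ I \<ge> 0" using y assms by simp_all
    ultimately show ?thesis unfolding real_norm_def by (metis abs_of_nonneg mult_right_mono)
  qed
  moreover have "summable (\<lambda>I. (C + 1) ^ N * y ^ I)"
    using y by (intro summable_mult summable_geometric) auto
  ultimately show ?thesis by (rule summable_comparison_test'[where N = 0, rotated])
qed

definition supported :: "nat set \<Rightarrow> (nat \<Rightarrow> nat) \<Rightarrow> bool" where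
  "supported A m \<longleftrightarrow> (\<forall>k. k \<notin> A \<longrightarrow> m k = 0)"

text \<open>The summation variables \<open>i\<close> of the successive Burge transforms in terms of the \<open>m\<close>.\<close>

definition burge_index :: "nat set \<Rightarrow> (nat \<Rightarrow> nat) \<Rightarrow> nat \<Rightarrow> int" where
  "burge_index T m j = (if j \<in> T then int (m (Suc j)) else int (m j) - int (m (Suc j)))"

text \<open>Letter \<open>j\<close> belongs to the Burge step at variable m_j, and the smallest
  index is the outermost step; \<open>T\<close> will be the set of partial sums of the continued
  fraction.\<close>

fun burge_word :: "nat set \<Rightarrow> nat \<Rightarrow> nat \<Rightarrow> bool list" where
  "burge_word T 0 j = []"
| "burge_word T (Suc r) j = (j \<in> T) # burge_word T r (Suc j)"

context nome
begin

text \<open>The argument \<open>u\<close> stands for m_(j-1); at step \<open>j\<close> the recursion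
  has v = m_j and k = m_(j+1). The empty word leaves the root \<open>q\<close>-binomial at the last
  variable.\<close>

fun burge_summand :: "nat set \<Rightarrow> nat \<Rightarrow> nat \<Rightarrow> nat \<Rightarrow> (nat \<Rightarrow> nat) \<Rightarrow> complex" where
  "burge_summand T 0 j u m = qbinom q (int u) (int (m j))"
| "burge_summand T (Suc r) j u m = q powi ((burge_index T m j)\<^sup>2)
     * qbinom q (int (m j + u) - burge_index T m j) (int (2 * m j)) * burge_summand T r (Suc j) (m j) m"

fun burge_summand_inf :: "nat set \<Rightarrow> nat \<Rightarrow> nat \<Rightarrow> (nat \<Rightarrow> nat) \<Rightarrow> complex" where
  "burge_summand_inf T 0 j m = rf (int (m j))"
| "burge_summand_inf T (Suc r) j m = rf (int (2 * m j)) * (q powi ((burge_index T m j)\<^sup>2)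
     * burge_summand T r (Suc j) (m j) m)"

lemma burge_summand_cong:
  assumes "\<And>k. k \<ge> j \<Longrightarrow> m k = m' k"
  shows "burge_summand T r j u m = burge_summand T r j u m'"
  using assms by (induction r arbitrary: j u) (auto simp: burge_index_def)

text \<open>The variables must decrease weakly. A negative \<open>burge_index\<close> could spoil
  the range of the \<open>q\<close>-binomial, but it needs an increase at the next position, where
  the inner summand already vanishes.\<close>

lemma burge_summand_zero: "m j > u \<Longrightarrow> burge_summand T r j u m = 0"
proof (induction r arbitrary: j u)
  case (Suc r)
  show ?case
  proof (cases "m (Suc j) > m j")
    case True
    thus ?thesis using Suc.IH by simp
  next
    case False
    hence "int (m j + u) - burge_index T m j < int (2 * m j)"
      using Suc.prems by (auto simp: burge_index_def)
    thus ?thesis by (simp add: qbinom_zero)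
  qed
qed (simp add: qbinom_zero)

lemma norm_qbinom_rf_bounded:
  obtains K where "K \<ge> 1" "\<And>N M. norm (qbinom q N M) \<le> K" "\<And>n. norm (rf n) \<le> K"
proof -
  obtain K where K: "K \<ge> 1" "\<And>n. norm (pf n) \<le> K" "\<And>n. norm (rf n) \<le> K"
    using norm_pf_rf_bounded by blast
  have "norm (qbinom q N M) \<le> K * K * K" for N M
  proof (cases "N \<ge> 0")
    case True
    thus ?thesis unfolding qbinom_eq[OF True] norm_mult
      using K by (intro mult_mono mult_nonneg_nonneg) auto
  next
    case False
    thus ?thesis using K by (auto simp: qbinom_def)
  qed
  moreover have "K \<le> K * K * K" using K mult_mono[of 1 K 1 K] mult_mono[of 1 "K * K" K K] by simp
  hence "norm (rf n) \<le> K * K * K" for n using K(3)[of n] by linarith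
  moreover have "K * K * K \<ge> 1" using \<open>K \<le> K * K * K\<close> K by linarith
  ultimately show ?thesis using that by blast
qed

lemma norm_powi_square_le: "norm (q powi (x\<^sup>2)) \<le> 1"
proof -
  have "norm (q powi (x\<^sup>2)) = norm q powi (x\<^sup>2)" by (simp add: norm_power_int)
  also have "\<dots> \<le> 1" using q_less by (intro power_int_le_one) auto
  finally show ?thesis .
qed

lemma bij_betw_first_variable:
  "bij_betw (\<lambda>m. m(j := v)) {m. supported {Suc j..Suc j + r} m \<and> m (Suc j) = k}
     {m \<in> {m. supported {j..j + Suc r} m \<and> m j = v}. m (Suc j) = k}"
  by (rule bij_betwI[where g = "\<lambda>m. m(j := 0)"]) (auto simp: supported_def fun_eq_iff)

lemma supported_singleton: "{m. supported {j..j + 0} m \<and> m j = v} = {(\<lambda>_. 0)(j := v)}"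
  by (auto simp: supported_def fun_eq_iff)

context
  fixes K :: real
  assumes K: "K \<ge> 1" and K_qbinom: "\<And>N M. norm (qbinom q N M) \<le> K" and K_rf: "\<And>n. norm (rf n) \<le> K"
begin

text \<open>Fixing m_j = v and letting k = m_(j+1) run is the recursion of
  \<open>burge_poly\<close>. The bound does not depend on \<open>u\<close>, so it can be
  iterated.\<close>

lemma burge_summand_has_sum:
  "bounded_has_sum (burge_summand T r j u) (burge_poly (burge_word T r j) u v) ((K * (real v + 1)) ^ Suc r)
     {m. supported {j..j + r} m \<and> m j = v}"
proof (induction r arbitrary: j u v)
  case 0
  have "K \<le> K * (real v + 1)" using K by simp
  hence "norm (qbinom q (int u) (int v)) \<le> K * (real v + 1)" using K_qbinom order_trans by blast
  hence 1: "norm (burge_summand T 0 j u ((\<lambda>_. 0)(j := v))) \<le> (K * (real v + 1)) ^ Suc 0" by simp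
  have 2: "burge_summand T 0 j u ((\<lambda>_. 0)(j := v)) = burge_poly (burge_word T 0 j) u v" by simp
  show ?case unfolding supported_singleton
    using bounded_has_sum_singleton[of "burge_summand T 0 j u", OF 1] unfolding 2 .
next
  case (Suc r)
  define w where "w k = q powi ((int (if j \<in> T then k else v - k))\<^sup>2) *
        qbinom q (int (v + u) - int (if j \<in> T then k else v - k)) (int (2 * v))" for k
  have "bounded_has_sum (burge_summand T (Suc r) j u) (\<Sum>k\<le>v. w k * burge_poly (burge_word T r (Suc j)) v k)
     ((K * (real v + 1)) ^ Suc (Suc r)) {m. supported {j..j + Suc r} m \<and> m j = v}"
  proof (rule bounded_has_sum_fibration[where \<kappa> = "\<lambda>m. m (Suc j)" and F = "burge_summand T r (Suc j) v"])
    show "bij_betw (\<lambda>m. m(j := v)) {m. supported {Suc j..Suc j + r} m \<and> m (Suc j) = k}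
       {m \<in> {m. supported {j..j + Suc r} m \<and> m j = v}. m (Suc j) = k}" for k
      by (rule bij_betw_first_variable)
    show "burge_summand T (Suc r) j u (m(j := v)) = w k * burge_summand T r (Suc j) v m"
      if "k \<le> v" "m \<in> {m. supported {Suc j..Suc j + r} m \<and> m (Suc j) = k}" for k m
      using that burge_summand_cong[of "Suc j" "m(j := v)" m T r v]
      by (auto simp: w_def burge_index_def of_nat_diff)
    show "burge_summand T (Suc r) j u m = 0" if "m \<in> {m. supported {j..j + Suc r} m \<and> m j = v}" "m (Suc j) > v" for m
      using that by (simp add: burge_summand_zero)
    show "norm (w k) \<le> K" for k
      using mult_mono[OF norm_powi_square_le K_qbinom] unfolding w_def norm_mult by auto
    show "bounded_has_sum (burge_summand T r (Suc j) v) (burge_poly (burge_word T r (Suc j)) v k)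
       ((K * (real k + 1)) ^ Suc r) {m. supported {Suc j..Suc j + r} m \<and> m (Suc j) = k}" for k
      by (rule Suc.IH)
  qed (rule K)
  thus ?case by (simp only: w_def burge_poly.simps burge_word.simps)
qed

lemma burge_summand_inf_has_sum:
  "bounded_has_sum (burge_summand_inf T r j) (burge_poly_inf (burge_word T r j) v) ((K * (real v + 1)) ^ Suc r)
     {m. supported {j..j + r} m \<and> m j = v}"
proof (cases r)
  case 0
  have "K \<le> K * (real v + 1)" using K by simp
  hence "norm (rf (int v)) \<le> K * (real v + 1)" using K_rf order_trans by blast
  hence 1: "norm (burge_summand_inf T 0 j ((\<lambda>_. 0)(j := v))) \<le> (K * (real v + 1)) ^ Suc 0" by simp
  have 2: "burge_summand_inf T 0 j ((\<lambda>_. 0)(j := v)) = burge_poly_inf (burge_word T 0 j) v" by simp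
  show ?thesis unfolding 0 supported_singleton
    using bounded_has_sum_singleton[of "burge_summand_inf T 0 j", OF 1] unfolding 2 .
next
  case (Suc r)
  define w where "w k = rf (int (2 * v)) * q powi ((int (if j \<in> T then k else v - k))\<^sup>2)" for k
  have "bounded_has_sum (burge_summand_inf T (Suc r) j) (\<Sum>k\<le>v. w k * burge_poly (burge_word T r (Suc j)) v k)
     ((K * (real v + 1)) ^ Suc (Suc r)) {m. supported {j..j + Suc r} m \<and> m j = v}"
  proof (rule bounded_has_sum_fibration[where \<kappa> = "\<lambda>m. m (Suc j)" and F = "burge_summand T r (Suc j) v"])
    show "bij_betw (\<lambda>m. m(j := v)) {m. supported {Suc j..Suc j + r} m \<and> m (Suc j) = k}
       {m \<in> {m. supported {j..j + Suc r} m \<and> m j = v}. m (Suc j) = k}" for k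
      by (rule bij_betw_first_variable)
    show "burge_summand_inf T (Suc r) j (m(j := v)) = w k * burge_summand T r (Suc j) v m"
      if "k \<le> v" "m \<in> {m. supported {Suc j..Suc j + r} m \<and> m (Suc j) = k}" for k m
      using that burge_summand_cong[of "Suc j" "m(j := v)" m T r v]
      by (auto simp: w_def burge_index_def of_nat_diff)
    show "burge_summand_inf T (Suc r) j m = 0" if "m \<in> {m. supported {j..j + Suc r} m \<and> m j = v}" "m (Suc j) > v" for m
      using that by (simp add: burge_summand_zero)
    show "norm (w k) \<le> K" for k
      using mult_mono[OF K_rf norm_powi_square_le] K unfolding w_def norm_mult by auto
    show "bounded_has_sum (burge_summand T r (Suc j) v) (burge_poly (burge_word T r (Suc j)) v k)
       ((K * (real k + 1)) ^ Suc r) {m. supported {Suc j..Suc j + r} m \<and> m (Suc j) = k}" for k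
      by (rule burge_summand_has_sum)
  qed (rule K)
  thus ?thesis by (simp add: Suc w_def sum_distrib_left mult.assoc)
qed

end

section \<open>Chains of Bailey steps and the variables n\<close>

text \<open>Variables are added in the order n_p, ..., n_i, one Bailey step each. The square with
  index i' enters when n_(i'-1) is added, so the one for \<open>i\<close> itself is still missing;
  the index \<open>Suc p\<close> has an empty sum of n and contributes the square of
  \<open>\<mu> m\<close> alone.\<close>

lemma bailey_chain:
  fixes \<mu> :: "'m \<Rightarrow> nat" and \<tau> :: "'m \<Rightarrow> complex"
  assumes K: "K \<ge> 1" and K_rf: "\<And>n. norm (rf n) \<le> K" and b: "b \<ge> 1"
    and base: "\<And>I. bounded_has_sum \<tau> (bailey_sum a b I) ((K * (real I + 1)) ^ N) {m \<in> M. \<mu> m = I}"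
  shows "i + s = Suc p \<Longrightarrow> bounded_has_sum
     (\<lambda>(n, m). (\<Prod>i'\<in>{i..p}. rf (int (n i'))) * q powi (\<Sum>i'\<in>{Suc i..Suc p}. (int (sum n {i'..p} + \<mu> m))\<^sup>2) * \<tau> m)
     (bailey_sum (a + s * b) b I) ((K * (real I + 1)) ^ (N + s))
     {(n, m). supported {i..p} n \<and> m \<in> M \<and> sum n {i..p} + \<mu> m = I}"
proof (induction s arbitrary: i I)
  case 0
  have bij: "bij_betw (\<lambda>m. ((\<lambda>_. 0), m)) {m \<in> M. \<mu> m = I} {(n, m). supported {i..p} n \<and> m \<in> M \<and> sum n {i..p} + \<mu> m = I}"
    by (rule bij_betwI[where g = snd]) (use 0 in \<open>auto simp: supported_def\<close>)
  have e: "{i..p} = {}" "{Suc i..Suc p} = {}" using 0 by auto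
  show ?case
    using base[of I] unfolding bounded_has_sum_def has_sum_reindex_bij_betw[OF bij, symmetric] by (simp add: e)
next
  case (Suc s)
  define f where "f i = (\<lambda>(n :: nat \<Rightarrow> nat, m). (\<Prod>i'\<in>{i..p}. rf (int (n i'))) * q powi (\<Sum>i'\<in>{Suc i..Suc p}. (int (sum n {i'..p} + \<mu> m))\<^sup>2) * \<tau> m)" for i
  define \<Omega> where "\<Omega> i I = {(n :: nat \<Rightarrow> nat, m). supported {i..p} n \<and> m \<in> M \<and> sum n {i..p} + \<mu> m = I}" for i I
  define w where "w k = q powi ((int k)\<^sup>2) * rf (int (I - k))" for k
  have i: "i \<le> p" using Suc.prems by simp
  have ip: "{i..p} = insert i {Suc i..p}" using i by auto
  have "bounded_has_sum (f i) (\<Sum>k\<le>I. w k * bailey_sum (a + s * b) b k) ((K * (real I + 1)) ^ Suc (N + s)) (\<Omega> i I)"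
  \<comment> \<open>Once n_i is removed, the remaining total is \<open>k\<close>, which forces n_i =
    I - k.\<close>
  proof (rule bounded_has_sum_fibration[where \<kappa> = "\<lambda>(n, m). sum n {Suc i..p} + \<mu> m" and F = "f (Suc i)"
        and \<Omega>' = "\<Omega> (Suc i)" and \<phi> = "\<lambda>k (n, m). (n(i := I - k), m)"])
    show "bij_betw (\<lambda>(n, m). (n(i := I - k), m)) (\<Omega> (Suc i) k) {x \<in> \<Omega> i I. (case x of (n, m) \<Rightarrow> sum n {Suc i..p} + \<mu> m) = k}"
      if k: "k \<le> I" for k
      by (rule bij_betwI[where g = "\<lambda>(n, m). (n(i := 0), m)"])
         (use k i in \<open>auto simp: \<Omega>_def supported_def ip fun_eq_iff\<close>)
    show "f i ((\<lambda>(n, m). (n(i := I - k), m)) y) = w k * f (Suc i) y" if k: "k \<le> I" "y \<in> \<Omega> (Suc i) k" for k y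
    proof -
      obtain n m where y: "y = (n, m)" by (cases y)
      have nm: "sum n {Suc i..p} + \<mu> m = k" using k by (simp add: y \<Omega>_def)
      have "{Suc i..Suc p} = insert (Suc i) {Suc (Suc i)..Suc p}" using i by auto
      moreover have "(\<Sum>i'\<in>{Suc (Suc i)..Suc p}. (int (sum (n(i := I - k)) {i'..p} + \<mu> m))\<^sup>2)
           = (\<Sum>i'\<in>{Suc (Suc i)..Suc p}. (int (sum n {i'..p} + \<mu> m))\<^sup>2)"
        by (intro sum.cong) auto
      ultimately have "(\<Sum>i'\<in>{Suc i..Suc p}. (int (sum (n(i := I - k)) {i'..p} + \<mu> m))\<^sup>2)
         = (int k)\<^sup>2 + (\<Sum>i'\<in>{Suc (Suc i)..Suc p}. (int (sum n {i'..p} + \<mu> m))\<^sup>2)"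
        using nm by (simp del: of_nat_add)
      moreover have "(\<Prod>i'\<in>{i..p}. rf (int ((n(i := I - k)) i'))) = rf (int (I - k)) * (\<Prod>i'\<in>{Suc i..p}. rf (int (n i')))"
        unfolding ip by simp
      ultimately show ?thesis unfolding y f_def prod.case w_def by (simp only: powi_add mult_ac)
    qed
    show "f i x = 0" if "x \<in> \<Omega> i I" "(case x of (n, m) \<Rightarrow> sum n {Suc i..p} + \<mu> m) > I" for x
      using that by (auto simp: \<Omega>_def ip)
    show "bounded_has_sum (f (Suc i)) (bailey_sum (a + s * b) b k) ((K * (real k + 1)) ^ (N + s)) (\<Omega> (Suc i) k)" for k
      using Suc.IH[of "Suc i" k] Suc.prems unfolding f_def \<Omega>_def by simp
    show "norm (w k) \<le> K" for k
      using mult_mono[OF norm_powi_square_le K_rf] unfolding w_def norm_mult by auto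
  qed (use K in auto)
  moreover have "(\<Sum>k\<le>I. w k * bailey_sum (a + s * b) b k) = bailey_sum (a + Suc s * b) b I"
    using bailey_sum_rec[OF b, of "a + s * b" I] by (simp add: w_def add_ac)
  ultimately show ?case unfolding f_def \<Omega>_def by simp
qed

text \<open>The \<open>p\<close> Bailey steps raise \<open>e\<close> to \<open>e + p * b\<close>;
  the final limit adds the last \<open>b\<close> and supplies the missing square for
  \<open>i = 1\<close> as its factor \<open>q powi ((int k)\<^sup>2)\<close>.\<close>

lemma bailey_chain_has_sum:
  fixes \<mu> :: "'m \<Rightarrow> nat" and \<tau> :: "'m \<Rightarrow> complex"
  assumes K: "K \<ge> 1" and K_rf: "\<And>n. norm (rf n) \<le> K" and b: "b \<ge> 1"
    and base: "\<And>I. bounded_has_sum \<tau> (bailey_sum e b I) ((K * (real I + 1)) ^ N) {m \<in> M. \<mu> m = I}"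
    and a: "a = e + Suc p * b"
  shows "((\<lambda>(n, m). (\<Prod>i\<in>{1..p}. rf (int (n i))) * q powi (\<Sum>i\<in>{1..Suc p}. (int (sum n {i..p} + \<mu> m))\<^sup>2) * \<tau> m)
     has_sum (qpoch_inf (q ^ (a * b)) (q ^ (2 * a * b + 1)) * qpoch_inf (q ^ (a * b + 1)) (q ^ (2 * a * b + 1))
       * qpoch_inf (q ^ (2 * a * b + 1)) (q ^ (2 * a * b + 1)) / qpoch_inf q q))
     {(n, m). supported {1..p} n \<and> m \<in> M}"
proof (rule has_sum_nat_partition[where \<kappa> = "\<lambda>(n, m). sum n {1..p} + \<mu> m"])
  define f where "f = (\<lambda>(n :: nat \<Rightarrow> nat, m). (\<Prod>i'\<in>{1..p}. rf (int (n i'))) * q powi (\<Sum>i'\<in>{Suc 1..Suc p}. (int (sum n {i'..p} + \<mu> m))\<^sup>2) * \<tau> m)"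
  show "bounded_has_sum (\<lambda>(n, m). (\<Prod>i\<in>{1..p}. rf (int (n i))) * q powi (\<Sum>i\<in>{1..Suc p}. (int (sum n {i..p} + \<mu> m))\<^sup>2) * \<tau> m)
     (q powi ((int k)\<^sup>2) * bailey_sum (e + p * b) b k) (norm q ^ k * (K * (real k + 1)) ^ (N + p))
     {x \<in> {(n, m). supported {1..p} n \<and> m \<in> M}. (case x of (n, m) \<Rightarrow> sum n {1..p} + \<mu> m) = k}" (is "bounded_has_sum ?F _ _ ?\<Omega>") for k
  proof -
    have \<Omega>: "{(n, m). supported {1..p} n \<and> m \<in> M \<and> sum n {1..p} + \<mu> m = k} = ?\<Omega>" by auto
    have "bounded_has_sum f (bailey_sum (e + p * b) b k) ((K * (real k + 1)) ^ (N + p)) ?\<Omega>"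
      using bailey_chain[OF K K_rf b base, of 1 p p k] unfolding f_def \<Omega> by linarith
    then obtain c where c: "(f has_sum bailey_sum (e + p * b) b k) ?\<Omega>" "c \<le> (K * (real k + 1)) ^ (N + p)"
      "((\<lambda>x. norm (f x)) has_sum c) ?\<Omega>" unfolding bounded_has_sum_def by auto
    have F: "?F x = q powi ((int k)\<^sup>2) * f x" if "x \<in> ?\<Omega>" for x
    proof -
      have "{1..Suc p} = insert 1 {Suc 1..Suc p}" by auto
      thus ?thesis using that unfolding f_def by (auto simp: powi_add simp del: of_nat_add of_nat_sum)
    qed
    have "(?F has_sum (q powi ((int k)\<^sup>2) * bailey_sum (e + p * b) b k)) ?\<Omega>"
      by (rule has_sum_cong[THEN iffD2, OF F has_sum_cmult_right[OF c(1)]])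
    moreover have "((\<lambda>x. norm (?F x)) has_sum (norm (q powi ((int k)\<^sup>2)) * c)) ?\<Omega>"
    proof (rule has_sum_cong[THEN iffD2, OF _ has_sum_cmult_right[OF c(3)]])
      show "norm (?F x) = norm (q powi ((int k)\<^sup>2)) * norm (f x)" if "x \<in> ?\<Omega>" for x
        unfolding F[OF that] norm_mult ..
    qed
    moreover have "norm (q powi ((int k)\<^sup>2)) * c \<le> norm q ^ k * (K * (real k + 1)) ^ (N + p)"
    proof (rule mult_mono)
      have "norm (q powi ((int k)\<^sup>2)) = norm q ^ (k * k)"
        by (metis norm_power of_nat_mult power2_eq_square power_int_of_nat)
      also have "\<dots> \<le> norm q ^ k"
        using q_less by (intro power_decreasing) auto
      finally show "norm (q powi ((int k)\<^sup>2)) \<le> norm q ^ k" .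
      show "0 \<le> c" using has_sum_nonneg[OF c(3)] by simp
    qed (use c in auto)
    ultimately show ?thesis unfolding bounded_has_sum_def by blast
  qed
  show "summable (\<lambda>k. norm q ^ k * (K * (real k + 1)) ^ (N + p))"
    using summable_mult[OF summable_power_times_geometric[of "norm q" "N + p"], of "K ^ (N + p)"] q_less
    by (simp add: power_mult_distrib mult_ac)
  show "((\<lambda>k. q powi ((int k)\<^sup>2) * bailey_sum (e + p * b) b k) has_sum
     (qpoch_inf (q ^ (a * b)) (q ^ (2 * a * b + 1)) * qpoch_inf (q ^ (a * b + 1)) (q ^ (2 * a * b + 1))
       * qpoch_inf (q ^ (2 * a * b + 1)) (q ^ (2 * a * b + 1)) / qpoch_inf q q)) UNIV"
  proof -
    have "e + p * b + b = a" "2 * (a * b) = 2 * a * b" by (simp_all add: a)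
    thus ?thesis using bailey_sum_limit[OF b, of "e + p * b"] by (simp only:)
  qed
qed

end

section \<open>Continued fractions and the matrix C\<close>

definition partial_sums :: "nat list \<Rightarrow> nat set" where
  "partial_sums l = {sum_list (take j l) | j. 1 \<le> j \<and> j \<le> length l}"

lemma tset_eq: "tset a b = partial_sums (cf a b)"
  by (simp add: tset_def partial_sums_def)

lemma partial_sums_Cons: "partial_sums (x # l) = insert x ((+) x ` partial_sums l)"
proof (intro equalityI subsetI)
  fix t assume "t \<in> partial_sums (x # l)"
  then obtain j where j: "t = sum_list (take j (x # l))" "1 \<le> j" "j \<le> Suc (length l)"
    by (auto simp: partial_sums_def)
  then obtain i where i: "j = Suc i" by (cases j) auto
  show "t \<in> insert x ((+) x ` partial_sums l)"
  proof (cases "i = 0")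
    case True
    thus ?thesis using j i by simp
  next
    case False
    hence "sum_list (take i l) \<in> partial_sums l" using j i by (auto simp: partial_sums_def)
    thus ?thesis using j i by auto
  qed
next
  fix t assume "t \<in> insert x ((+) x ` partial_sums l)"
  thus "t \<in> partial_sums (x # l)"
  proof
    assume "t = x"
    hence "t = sum_list (take 1 (x # l))" by simp
    thus ?thesis by (force simp: partial_sums_def)
  next
    assume "t \<in> (+) x ` partial_sums l"
    then obtain j where j: "t = x + sum_list (take j l)" "1 \<le> j" "j \<le> length l"
      by (auto simp: partial_sums_def)
    thus ?thesis unfolding partial_sums_def by (intro CollectI exI[of _ "Suc j"]) auto
  qed
qed

lemma add_in_partial_sums_Cons: "0 < z \<Longrightarrow> x + z \<in> partial_sums (x # l) \<longleftrightarrow> z \<in> partial_sums l"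
  by (auto simp: partial_sums_Cons image_iff)

lemma partial_sums_Nil [simp]: "partial_sums [] = {}"
  by (auto simp: partial_sums_def)

lemma sum_list_in_partial_sums: "l \<noteq> [] \<Longrightarrow> sum_list l \<in> partial_sums l"
  by (induction l rule: induct_list012) (auto simp: partial_sums_Cons)

lemma cfval_pos: "l \<noteq> [] \<Longrightarrow> \<forall>x\<in>set l. 0 < x \<Longrightarrow> cfval l > 0"
  by (induction l rule: cfval.induct) (auto simp: add_pos_pos)

lemma cfval_gt_1: "l \<noteq> [] \<Longrightarrow> \<forall>x\<in>set l. 0 < x \<Longrightarrow> 2 \<le> last l \<Longrightarrow> cfval l > 1"
proof (induction l rule: cfval.induct)
  case (3 x y r)
  have "cfval (y # r) > 0" using 3 by (intro cfval_pos) auto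
  moreover have "(of_nat x :: rat) \<ge> 1" using 3 by simp
  moreover have "1 / cfval (y # r) > 0" using calculation by simp
  ultimately show ?case unfolding cfval.simps by linarith
qed auto

lemma of_nat_add_fraction_inject:
  fixes v w :: rat
  assumes "of_nat x + v = of_nat y + w" "0 \<le> v" "v < 1" "0 \<le> w" "w < 1"
  shows "x = y"
proof -
  have "\<lfloor>of_nat x + v\<rfloor> = int x" "\<lfloor>of_nat y + w\<rfloor> = int y"
    using assms(2-) by (simp_all add: floor_eq_iff)
  thus ?thesis using assms(1) by simp
qed

text \<open>The head is the floor of the value: a last quotient of at least 2 makes every nonempty
  tail exceed 1, so its reciprocal is a proper fractional part.\<close>

lemma cfval_inject:
  assumes "l \<noteq> []" "\<forall>x\<in>set l. 0 < x" "2 \<le> last l" "l' \<noteq> []" "\<forall>x\<in>set l'. 0 < x" "2 \<le> last l'"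
    "cfval l = cfval l'"
  shows "l = l'"
  using assms
proof (induction l arbitrary: l')
  case (Cons x r)
  obtain y r' where l': "l' = y # r'" using Cons.prems by (cases l') auto
  define fr where "fr r = (if r = [] then 0 else 1 / cfval r)" for r
  have fr: "cfval (x # r) = of_nat x + fr r" for x r by (cases r) (auto simp: fr_def)
  have bounds: "0 \<le> fr r \<and> fr r < 1" if "r \<noteq> [] \<Longrightarrow> cfval r > 1" for r
  proof (cases "r = []")
    case False
    hence "cfval r > 1" using that by blast
    moreover from this have "cfval r > 0" by linarith
    ultimately show ?thesis by (simp add: fr_def)
  qed (simp add: fr_def)
  have r: "r \<noteq> [] \<Longrightarrow> cfval r > 1" "r' \<noteq> [] \<Longrightarrow> cfval r' > 1"
    using Cons.prems by (auto simp: l' intro!: cfval_gt_1)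
  have eq: "of_nat x + fr r = of_nat y + fr r'" using Cons.prems by (simp only: fr l')
  hence xy: "x = y" using of_nat_add_fraction_inject bounds r by blast
  hence frr: "fr r = fr r'" using eq by simp
  have "r = r'"
  proof (cases "r = [] \<or> r' = []")
    case True
    thus ?thesis using frr r by (auto simp: fr_def split: if_splits)
  next
    case False
    hence "cfval r = cfval r'" using frr by (auto simp: fr_def)
    thus ?thesis using Cons.IH[of r'] Cons.prems False by (auto simp: l')
  qed
  thus ?case using xy l' by simp
qed simp

text \<open>The Euclidean algorithm. It ends at \<open>e = 1\<close> with \<open>c > 1\<close>,
  which gives the condition on the last quotient.\<close>

lemma cfval_exists:
  fixes c e :: nat
  assumes "coprime c e" "e < c" "1 \<le> e"
  shows "\<exists>l. l \<noteq> [] \<and> (\<forall>x\<in>set l. 0 < x) \<and> 2 \<le> last l \<and> cfval l = of_nat c / of_nat e"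
  using assms
proof (induction e arbitrary: c rule: less_induct)
  case (less e)
  show ?case
  proof (cases "e = 1")
    case True
    thus ?thesis using less.prems by (intro exI[of _ "[c]"]) auto
  next
    case False
    define x r where "x = c div e" and "r = c mod e"
    have c: "c = e * x + r" by (simp add: x_def r_def)
    have "coprime e r" using less.prems coprime_mod_right_iff[of e c] coprime_commute[of c e]
      unfolding r_def by auto
    moreover have "r < e" using less.prems by (simp add: r_def)
    moreover have "r \<noteq> 0" using \<open>coprime e r\<close> False by (intro notI) simp
    ultimately obtain l where l: "l \<noteq> []" "\<forall>x\<in>set l. 0 < x" "2 \<le> last l" "cfval l = of_nat e / of_nat r"
      using less.IH[of r e] by auto
    have "x \<ge> 1" using less.prems by (simp add: x_def Suc_le_eq div_greater_zero_iff)
    moreover have "cfval (x # l) = of_nat x + 1 / cfval l" using l by (cases l) auto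
    moreover have "\<dots> = of_nat c / of_nat e"
      using less.prems by (simp add: l(4) c add_divide_distrib)
    ultimately show ?thesis using l by (intro exI[of _ "x # l"]) auto
  qed
qed

text \<open>Existence and uniqueness are both needed to unfold the definite description. Apart from
  \<open>a = 2 * b\<close>, the target is a reduced fraction greater than 1, either (a-b)/b or
  b/(a-b).\<close>

lemma cf_properties:
  assumes "coprime a b" "1 \<le> b" "b < a"
  shows "cf a b \<noteq> [] \<and> (\<forall>x\<in>set (cf a b). 0 < x) \<and> cfval (cf a b) = cf_target a b"
proof -
  define P where "P l \<longleftrightarrow> l \<noteq> [] \<and> (\<forall>x\<in>set l. 0 < x) \<and>
     (if (a, b) = (2, 1) then l = [1] else 2 \<le> last l) \<and> cfval l = cf_target a b" for l
  have "\<exists>!l. P l"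
  proof (cases "a = 2 * b")
    case True
    \<comment> \<open>Coprimality leaves only \<open>(a, b) = (2, 1)\<close>, where the defining
      condition itself prescribes \<open>[1]\<close>.\<close>
    hence "b dvd a" by simp
    hence "is_unit b" using assms(1) coprime_absorb_left[of b a] coprime_commute[of a b] by blast
    hence b: "b = 1" by simp
    hence "P l \<longleftrightarrow> l = [1]" for l using True unfolding P_def cf_target_def by auto
    thus ?thesis by simp
  next
    case False
    hence ne: "(a, b) \<noteq> (2, 1)" by auto
    have cop: "coprime (a - b) b"
    proof -
      have "gcd (a - b) b = gcd a b" using assms by (intro gcd_diff1_nat) simp
      thus ?thesis using assms(1) by (simp only: coprime_iff_gcd_eq_1)
    qed
    hence cop': "coprime b (a - b)" by (simp add: coprime_commute)
    have fr: "(of_nat a :: rat) / of_nat b - 1 = of_nat (a - b) / of_nat b"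
      using assms by (simp add: of_nat_diff diff_divide_distrib)
    have "\<exists>l. P l"
    proof (cases "a > 2 * b")
      case True
      have "cf_target a b = of_nat (a - b) / of_nat b"
        unfolding cf_target_def fr using True by (simp only: if_True)
      moreover have "b < a - b" using True by simp
      ultimately show ?thesis
        using cfval_exists[OF cop _ assms(2)] unfolding P_def if_not_P[OF ne] by metis
    next
      case less: False
      have "a < 2 * b" using less False by simp
      hence "cf_target a b = of_nat b / of_nat (a - b)"
        unfolding cf_target_def fr inverse_divide using less by (simp only: if_True if_False)
      moreover have "a - b < b" "1 \<le> a - b" using assms less False by simp_all
      ultimately show ?thesis
        using cfval_exists[OF cop'] unfolding P_def if_not_P[OF ne] by metis
    qed
    moreover have "l = l'" if "P l" "P l'" for l l'
      using that cfval_inject[of l l'] unfolding P_def if_not_P[OF ne] by metis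
    ultimately show ?thesis by blast
  qed
  hence "P (THE l. P l)" by (rule theI')
  moreover have "cf a b = (THE l. P l)" unfolding cf_def P_def ..
  ultimately have "P (cf a b)" by (simp only:)
  thus ?thesis unfolding P_def by blast
qed

section \<open>Burge words and continued fractions\<close>

lemma burge_pair_run:
  assumes "\<forall>k\<in>{j..<j + y}. k \<notin> T"
  shows "burge_pair (burge_word T (y + r) j) =
    (let (c, e) = burge_pair (burge_word T r (j + y)) in (c + y * e, e))"
  using assms
proof (induction y arbitrary: j)
  case (Suc y)
  have "burge_pair (burge_word T (y + r) (Suc j)) =
    (let (c, e) = burge_pair (burge_word T r (Suc j + y)) in (c + y * e, e))"
    using Suc.prems by (intro Suc.IH) auto
  moreover have "j \<notin> T" using Suc.prems by auto
  ultimately show ?case by (simp add: case_prod_unfold Let_def)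
qed (simp add: case_prod_unfold Let_def)

lemma coprime_mult_add:
  fixes c e x :: nat
  assumes "coprime c e"
  shows "coprime (x * c + e) c"
proof -
  have "gcd (x * c + e) c = gcd c (x * c + e)" by (rule gcd.commute)
  also have "\<dots> = gcd c e" by (rule gcd_add_mult)
  finally show ?thesis using assms by (simp only: coprime_iff_gcd_eq_1)
qed

text \<open>If the tail gives \<open>(c', e')\<close>, an exchange step followed by x - 1 plain
  steps gives \<open>(x c' + e', c')\<close>, that is, x + e'/c'. The word is one letter shorter
  than the sum of the quotients because the root \<open>(1, 1)\<close> accounts for one unit of the
  last quotient; thus the last partial sum labels no letter.\<close>

lemma burge_pair_cfval:
  assumes "l \<noteq> []" "\<forall>x\<in>set l. 0 < x" "\<forall>k\<in>{s<..<s + sum_list l}. k \<in> T \<longleftrightarrow> k - s \<in> partial_sums l"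
    and "burge_pair (burge_word T (sum_list l - 1) (Suc s)) = (c, e)"
  shows "coprime c e \<and> cfval l = of_nat c / of_nat e"
  using assms
proof (induction l arbitrary: s c e)
  case (Cons x l)
  have x: "x \<ge> 1" using Cons.prems by auto
  have run: "\<forall>k\<in>{Suc s..<Suc s + (x - 1)}. k \<notin> T"
  proof
    fix k assume k: "k \<in> {Suc s..<Suc s + (x - 1)}"
    hence "k - s < x" by auto
    hence "k - s \<notin> partial_sums (x # l)" by (auto simp: partial_sums_Cons)
    moreover have "k \<in> {s<..<s + sum_list (x # l)}" using k by auto
    ultimately show "k \<notin> T" using Cons.prems(3) by blast
  qed
  show ?case
  proof (cases "l = []")
    case True
    have "burge_pair (burge_word T (x - 1 + 0) (Suc s)) = (1 + (x - 1) * 1, 1)"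
      by (subst burge_pair_run[OF run]) simp
    hence "c = x" "e = 1" using Cons.prems(4) x by (simp_all add: True)
    thus ?thesis by (simp add: True)
  next
    case False
    hence "sum_list l \<ge> 1" using Cons.prems(2) by (cases l) auto
    hence sum: "sum_list (x # l) - 1 = x - 1 + Suc (sum_list l - 1)" using x by simp
    have xT: "s + x \<in> T"
      using Cons.prems(3) \<open>sum_list l \<ge> 1\<close> x by (auto simp: partial_sums_Cons)
    obtain c' e' where ce': "burge_pair (burge_word T (sum_list l - 1) (Suc (s + x))) = (c', e')"
      by (cases "burge_pair (burge_word T (sum_list l - 1) (Suc (s + x)))")
    have IH: "coprime c' e' \<and> cfval l = of_nat c' / of_nat e'"
    proof (rule Cons.IH[OF False _ _ ce'])
      show "\<forall>x\<in>set l. 0 < x" using Cons.prems by simp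
      show "\<forall>k\<in>{s + x<..<s + x + sum_list l}. (k \<in> T) = (k - (s + x) \<in> partial_sums l)"
      proof
        fix k assume k: "k \<in> {s + x<..<s + x + sum_list l}"
        hence "k \<in> T \<longleftrightarrow> k - s \<in> partial_sums (x # l)" using Cons.prems(3) by auto
        also have "k - s = x + (k - (s + x))" using k by simp
        also have "\<dots> \<in> partial_sums (x # l) \<longleftrightarrow> k - (s + x) \<in> partial_sums l"
          using k by (intro add_in_partial_sums_Cons) simp
        finally show "(k \<in> T) = (k - (s + x) \<in> partial_sums l)" .
      qed
    qed
    have e: "Suc s + (x - 1) = s + x" using x by simp
    \<comment> \<open>The letter at \<open>s + x\<close> is the exchange; the \<open>x - 1\<close>
      letters before it are applied afterwards.\<close>
    have "burge_pair (burge_word T (sum_list (x # l) - 1) (Suc s)) = (c' + e' + (x - 1) * c', c')"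
      unfolding sum burge_pair_run[OF run] e using xT ce' by simp
    hence "c = c' + e' + (x - 1) * c'" "e = c'" using Cons.prems(4) by auto
    hence ce: "c = x * c' + e'" "e = c'"
      using x by (cases x; simp)+
    have pos: "c' \<ge> 1" "e' \<ge> 1" using burge_pair_pos[of "burge_word T (sum_list l - 1) (Suc (s + x))"] ce' by auto
    have "cfval (x # l) = of_nat x + 1 / cfval l" using False by (cases l) auto
    also have "\<dots> = of_nat c / of_nat e" using pos by (simp add: ce IH[THEN conjunct2] add_divide_distrib)
    finally have "cfval (x # l) = of_nat c / of_nat e" .
    moreover have "coprime c e" unfolding ce using IH by (intro coprime_mult_add) simp
    ultimately show ?thesis by simp
  qed
qed simp

lemma coprime_fraction_unique:
  fixes c e c' e' :: nat
  assumes "coprime c e" "coprime c' e'" "e \<ge> 1" "e' \<ge> 1" "(of_nat c :: rat) / of_nat e = of_nat c' / of_nat e'"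
  shows "c = c' \<and> e = e'"
proof -
  have "(of_nat (c * e') :: rat) = of_nat (c' * e)" using assms by (simp add: field_simps)
  hence "c * e' = c' * e" by (simp only: of_nat_eq_iff)
  thus ?thesis using coprime_crossproduct_nat[of c e c' e'] assms by auto
qed

section \<open>The rows and the quadratic form of C\<close>

lemma sum_if_supported:
  assumes "supported A m" "finite A"
  shows "(\<Sum>k\<in>A. (if k = i then z else 0) * int (m k)) = z * int (m i)"
proof -
  have "(\<Sum>k\<in>A. (if k = i then z else 0) * int (m k)) = (\<Sum>k\<in>A. if k = i then z * int (m k) else 0)"
    by (intro sum.cong) auto
  also have "\<dots> = z * int (m i)"
    using assms by (auto simp: sum.delta' sum.delta supported_def)
  finally show ?thesis .
qed

text \<open>Off \<open>T\<close> the row is a second difference, which splits as (m_j - m_(j-1)) +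
  (m_j - m_(j+1)); on \<open>T\<close> it is m_j - m_(j-1) + m_(j+1). In both cases the last part is
  the Burge variable.\<close>

lemma Cmat_row:
  assumes m: "supported {s..d} m" and j: "1 \<le> j"
  shows "(\<Sum>k\<in>{s..d}. Cmat a b j k * int (m k)) = int (m j) - int (m (j - 1)) + burge_index (tset a b) m j"
proof -
  have "Cmat a b j k = (if k = j then (if j \<in> tset a b then 1 else 2) else 0) - (if k = j - 1 then 1 else 0)
      + (if k = Suc j then (if j \<in> tset a b then 1 else - 1) else 0)" for k
    using j by (auto simp: Cmat_def Imat_def)
  hence "(\<Sum>k\<in>{s..d}. Cmat a b j k * int (m k)) =
     (\<Sum>k\<in>{s..d}. (if k = j then (if j \<in> tset a b then 1 else 2) else 0) * int (m k))
      - (\<Sum>k\<in>{s..d}. (if k = j - 1 then 1 else 0) * int (m k))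
      + (\<Sum>k\<in>{s..d}. (if k = Suc j then (if j \<in> tset a b then 1 else - 1) else 0) * int (m k))"
    by (simp only: distrib_right left_diff_distrib sum.distrib sum_subtractf)
  also have "\<dots> = int (m j) - int (m (j - 1)) + burge_index (tset a b) m j"
    unfolding sum_if_supported[OF m finite_atLeastAtMost] by (simp add: burge_index_def)
  finally show ?thesis .
qed

text \<open>Induction downwards from \<open>d\<close>. Passing from \<open>Suc s\<close> to
  \<open>s\<close> completes a square if \<open>s \<notin> T\<close>, while for
  \<open>s \<in> T\<close> the mixed terms cancel. At \<open>d\<close>, which lies in
  \<open>T\<close>, the index is 0 because \<open>m (Suc d) = 0\<close>.\<close>

lemma burge_quadratic_form:
  assumes "s \<le> d" "d \<in> T" "m (Suc d) = 0" "1 \<le> s"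
  shows "(\<Sum>j\<in>{s..d}. int (m j) * (int (m j) - int (m (j - 1)) + burge_index T m j))
     = (int (m s))\<^sup>2 - int (m (s - 1)) * int (m s) + (\<Sum>j\<in>{s..<d}. (burge_index T m j)\<^sup>2)"
  using assms(1,4)
proof (induction s rule: inc_induct)
  case base
  thus ?case using assms by (simp add: burge_index_def power2_eq_square algebra_simps)
next
  case (step s)
  have "{s..d} = insert s {Suc s..d}" "{s..<d} = insert s {Suc s..<d}" using step by auto
  thus ?case using step by (simp add: burge_index_def power2_eq_square algebra_simps)
qed

lemma Cmat_quadratic_form:
  assumes m: "supported {s..d} m" and "s \<le> d" "d \<in> tset a b" "1 \<le> s"
  shows "(\<Sum>j\<in>{s..d}. \<Sum>k\<in>{s..d}. int (m j) * Cmat a b j k * int (m k))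
     = (int (m s))\<^sup>2 + (\<Sum>j\<in>{s..<d}. (burge_index (tset a b) m j)\<^sup>2)"
proof -
  have "(\<Sum>j\<in>{s..d}. \<Sum>k\<in>{s..d}. int (m j) * Cmat a b j k * int (m k))
     = (\<Sum>j\<in>{s..d}. int (m j) * (int (m j) - int (m (j - 1)) + burge_index (tset a b) m j))"
  proof (rule sum.cong[OF refl])
    fix j assume "j \<in> {s..d}"
    hence j: "1 \<le> j" using assms(4) by simp
    show "(\<Sum>k\<in>{s..d}. int (m j) * Cmat a b j k * int (m k)) = int (m j) * (int (m j) - int (m (j - 1)) + burge_index (tset a b) m j)"
      by (simp only: Cmat_row[OF m j, symmetric] sum_distrib_left mult.assoc)
  qed
  also have "\<dots> = (int (m s))\<^sup>2 - int (m (s - 1)) * int (m s) + (\<Sum>j\<in>{s..<d}. (burge_index (tset a b) m j)\<^sup>2)"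
    using assms by (intro burge_quadratic_form) (auto simp: supported_def)
  also have "m (s - 1) = 0" using m assms by (auto simp: supported_def)
  finally show ?thesis by simp
qed

text \<open>A vanishing Burge variable says that m_(j+1) is either m_j or 0, so zeros propagate
  upwards.\<close>

lemma burge_squares_zero:
  assumes "m s = 0" "\<forall>j\<in>{s..<d}. burge_index T m j = 0" "s \<le> j" "j \<le> d"
  shows "m j = 0"
  using assms(3,4)
proof (induction j rule: dec_induct)
  case (step j)
  thus ?case using assms(2) by (auto simp: burge_index_def split: if_splits)
qed (use assms in auto)

section \<open>The multisum identities\<close>

context nome
begin

lemma rf_of_nat: "rf (int k) = 1 / qpoch q q k"
  by (simp add: qrf_def)

text \<open>By \<open>Cmat_row\<close> the upper entry of each factor is tau_k m_k + n_k. For the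
  last index the coefficient 1 and the zero Burge variable leave m_(k-1) over m_k, which is the root
  of the tree.\<close>

lemma burge_summand_eq:
  assumes "1 \<le> j" "m (Suc (j + r)) = 0" "j + r \<in> T"
  shows "burge_summand T r j (m (j - 1)) m = q powi (\<Sum>k\<in>{j..<j + r}. (burge_index T m k)\<^sup>2)
    * (\<Prod>k\<in>{j..j + r}. qbinom q (int ((if k < j + r then 2 else 1) * m k) - (int (m k) - int (m (k - 1)) + burge_index T m k))
          (int ((if k < j + r then 2 else 1) * m k)))"
  using assms
proof (induction r arbitrary: j)
  case 0
  thus ?case by (simp add: burge_index_def)
next
  case (Suc r)
  have j: "{j..j + Suc r} = insert j {Suc j..Suc j + r}" "{j..<j + Suc r} = insert j {Suc j..<Suc j + r}" by auto
  have IH: "burge_summand T r (Suc j) (m j) m = q powi (\<Sum>k\<in>{Suc j..<Suc j + r}. (burge_index T m k)\<^sup>2)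
    * (\<Prod>k\<in>{Suc j..Suc j + r}. qbinom q (int ((if k < Suc j + r then 2 else 1) * m k) - (int (m k) - int (m (k - 1)) + burge_index T m k))
          (int ((if k < Suc j + r then 2 else 1) * m k)))"
    using Suc.IH[of "Suc j"] Suc.prems by simp
  have 1: "int (m j + m (j - 1)) - burge_index T m j
      = int ((if j < j + Suc r then 2 else 1) * m j) - (int (m j) - int (m (j - 1)) + burge_index T m j)"
    and 2: "int (2 * m j) = int ((if j < j + Suc r then 2 else 1) * m j)"
    by simp_all
  have 3: "j + Suc r = Suc j + r" by simp
  have 4: "j \<notin> {Suc j..Suc j + r}" "j \<notin> {Suc j..<Suc j + r}" by auto
  show ?case
    unfolding burge_summand.simps IH j sum.insert[OF finite_atLeastLessThan 4(2)] prod.insert[OF finite_atLeastAtMost 4(1)]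
      powi_add 1 2 unfolding 3 by (simp only: mult_ac)
qed

lemma burge_summand_inf_eq:
  assumes "1 \<le> j" "m (Suc (j + r)) = 0" "j + r \<in> T"
  shows "burge_summand_inf T r j m = rf (int ((if j < j + r then 2 else 1) * m j))
    * (q powi (\<Sum>k\<in>{j..<j + r}. (burge_index T m k)\<^sup>2)
    * (\<Prod>k\<in>{Suc j..j + r}. qbinom q (int ((if k < j + r then 2 else 1) * m k) - (int (m k) - int (m (k - 1)) + burge_index T m k))
          (int ((if k < j + r then 2 else 1) * m k))))"
proof (cases r)
  case (Suc r')
  have "{j..<j + r} = insert j {Suc j..<Suc j + r'}" by (auto simp: Suc)
  moreover have "burge_summand T r' (Suc j) (m j) m = q powi (\<Sum>k\<in>{Suc j..<Suc j + r'}. (burge_index T m k)\<^sup>2)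
    * (\<Prod>k\<in>{Suc j..Suc j + r'}. qbinom q (int ((if k < Suc j + r' then 2 else 1) * m k) - (int (m k) - int (m (k - 1)) + burge_index T m k))
          (int ((if k < Suc j + r' then 2 else 1) * m k)))"
    using burge_summand_eq[of "Suc j" m r' T] assms Suc by simp
  moreover have "j + r = Suc j + r'" by (simp add: Suc)
  ultimately show ?thesis by (simp add: Suc powi_add mult_ac)
qed simp

end

text \<open>The number \<open>p\<close> of variables \<open>n\<close> is \<open>0\<close> if \<open>a \<le> 2 * b\<close> and \<open>cf_a0 a b\<close> if \<open>a > 2 * b\<close>.\<close>

definition multisum_exponent :: "nat \<Rightarrow> nat \<Rightarrow> nat \<Rightarrow> (nat \<Rightarrow> nat) \<times> (nat \<Rightarrow> nat) \<Rightarrow> int" where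
  "multisum_exponent a b p = (\<lambda>(n, m).
     (\<Sum>i\<in>{1..p}. (int (\<Sum>i'\<in>{i..p}. n i') + int (m (p + 1)))\<^sup>2)
       + (\<Sum>j\<in>{p + 1..cfd a b}. \<Sum>k\<in>{p + 1..cfd a b}. int (m j) * Cmat a b j k * int (m k)))"

definition multisum_summand :: "complex \<Rightarrow> nat \<Rightarrow> nat \<Rightarrow> nat \<Rightarrow> (nat \<Rightarrow> nat) \<times> (nat \<Rightarrow> nat) \<Rightarrow> complex" where
  "multisum_summand q a b p = (\<lambda>(n, m).
     q powi multisum_exponent a b p (n, m)
      / ((\<Prod>i\<in>{1..p}. qpoch q q (n i)) * qpoch q q (tau a b (p + 1) * m (p + 1)))
      * (\<Prod>j\<in>{p + 2..cfd a b}.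
           qbinom q (int (tau a b j * m j) - (\<Sum>k\<in>{p + 1..cfd a b}. Cmat a b j k * int (m k)))
                    (int (tau a b j * m j))))"

definition multisum_product :: "complex \<Rightarrow> nat \<Rightarrow> nat \<Rightarrow> complex" where
  "multisum_product q a b = qpoch_inf (q ^ (a * b)) (q ^ (2 * a * b + 1)) * qpoch_inf (q ^ (a * b + 1)) (q ^ (2 * a * b + 1))
          * qpoch_inf (q ^ (2 * a * b + 1)) (q ^ (2 * a * b + 1)) / qpoch_inf q q"

definition multisum_index_set :: "nat \<Rightarrow> nat \<Rightarrow> nat \<Rightarrow> ((nat \<Rightarrow> nat) \<times> (nat \<Rightarrow> nat)) set" where
  "multisum_index_set a b p = {(n, m). supported {1..p} n \<and> supported {p + 1..cfd a b} m}"

text \<open>The quadratic form yields the square of \<open>m (Suc p)\<close>, which is absorbed as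
  the summand \<open>i = Suc p\<close>, where the sum of the n is empty.\<close>

lemma multisum_exponent_eq:
  assumes "(n, m) \<in> multisum_index_set a b p" "p < cfd a b" "cfd a b \<in> tset a b"
  shows "multisum_exponent a b p (n, m) = (\<Sum>i\<in>{1..Suc p}. (int (sum n {i..p} + m (Suc p)))\<^sup>2)
     + (\<Sum>j\<in>{Suc p..<cfd a b}. (burge_index (tset a b) m j)\<^sup>2)"
proof -
  have "{1..Suc p} = insert (Suc p) {1..p}" by auto
  thus ?thesis
    using assms Cmat_quadratic_form[of "Suc p" "cfd a b" m a b]
    by (simp add: multisum_exponent_def multisum_index_set_def)
qed

lemma multisum_exponent_no_m:
  assumes "(n, m) \<in> multisum_index_set a b p" "p = cfd a b"
  shows "multisum_exponent a b p (n, m) = (\<Sum>i\<in>{1..Suc p}. (int (sum n {i..p} + m (Suc p)))\<^sup>2)"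
proof -
  have "{1..Suc p} = insert (Suc p) {1..p}" by auto
  moreover have "m (Suc p) = 0" using assms by (simp add: multisum_index_set_def supported_def)
  ultimately show ?thesis using assms by (simp add: multisum_exponent_def)
qed

text \<open>As a sum of squares, the exponent is positive definite on the index set: first m_(p+1)
  and the Burge variables vanish, then all of \<open>m\<close>, then all of
  \<open>n\<close>.\<close>

lemma multisum_exponent_eq_0:
  assumes nm: "(n, m) \<in> multisum_index_set a b p" and "p \<le> cfd a b" "cfd a b \<in> tset a b"
    and "multisum_exponent a b p (n, m) = 0"
  shows "n = (\<lambda>_. 0) \<and> m = (\<lambda>_. 0)"
proof -
  define S where "S = (\<Sum>j\<in>{Suc p..<cfd a b}. (burge_index (tset a b) m j)\<^sup>2)"
  have "(\<Sum>i\<in>{1..Suc p}. (int (sum n {i..p} + m (Suc p)))\<^sup>2) + S = 0"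
  proof (cases "p = cfd a b")
    case True
    thus ?thesis using multisum_exponent_no_m[OF nm] assms by (simp add: S_def del: of_nat_add of_nat_sum)
  next
    case False
    thus ?thesis using multisum_exponent_eq[OF nm] assms by (simp add: S_def del: of_nat_add of_nat_sum)
  qed
  moreover have S0: "S \<ge> 0" unfolding S_def by (intro sum_nonneg) simp
  moreover have N0: "(\<Sum>i\<in>{1..Suc p}. (int (sum n {i..p} + m (Suc p)))\<^sup>2) \<ge> 0" by (intro sum_nonneg) simp
  ultimately have "S = 0" "(\<Sum>i\<in>{1..Suc p}. (int (sum n {i..p} + m (Suc p)))\<^sup>2) = 0" by linarith+
  note Z = this
  have sq: "\<forall>j\<in>{Suc p..<cfd a b}. burge_index (tset a b) m j = 0"
    using Z(1) unfolding S_def by (subst (asm) sum_nonneg_eq_0_iff) auto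
  have sq2: "sum n {i..p} + m (Suc p) = 0" if "i \<in> {1..Suc p}" for i
  proof -
    have "(int (sum n {i..p} + m (Suc p)))\<^sup>2 = 0"
      by (rule sum_nonneg_0[OF _ _ Z(2) that]) simp_all
    thus ?thesis by (simp only: power2_eq_iff power_zero_numeral zero_eq_power2 of_nat_eq_0_iff)
  qed
  have "m (Suc p) = 0" using sq2[of "Suc p"] by simp
  hence "m j = 0" if "Suc p \<le> j" "j \<le> cfd a b" for j
    using burge_squares_zero sq that by blast
  moreover have "m j = 0" if "\<not> (Suc p \<le> j \<and> j \<le> cfd a b)" for j
    using nm that by (auto simp: multisum_index_set_def supported_def)
  ultimately have "m j = 0" for j by blast
  moreover have "n i = 0" for i
  proof (cases "i \<in> {1..p}")
    case True
    thus ?thesis using sq2[of 1] by simp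
  next
    case False
    thus ?thesis using nm by (auto simp: multisum_index_set_def supported_def)
  qed
  ultimately show ?thesis by auto
qed

text \<open>Since \<open>0 powi x\<close> is 1 at \<open>x = 0\<close> and 0 elsewhere, only the
  zero index contributes.\<close>

lemma multisum_has_sum_0:
  assumes "p \<le> cfd a b" "cfd a b \<in> tset a b" "a * b > 0"
  shows "(multisum_summand 0 a b p has_sum multisum_product 0 a b) (multisum_index_set a b p)"
proof (rule has_sum_finite_neutralI[where B = "{(\<lambda>_. 0, \<lambda>_. 0)}"])
  have "qpoch 0 0 0 = 1" "qbinom 0 0 0 = 1" by (simp_all add: qpoch_def qbinom_def)
  hence "multisum_summand 0 a b p (\<lambda>_. 0, \<lambda>_. 0) = 1"
    unfolding multisum_summand_def multisum_exponent_def prod.case by simp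
  moreover have "multisum_product 0 a b = 1"
  proof -
    have "(0 :: complex) ^ (a * b) = 0" "(0 :: complex) ^ (2 * a * b + 1) = 0" "(0 :: complex) ^ (a * b + 1) = 0"
      using assms by simp_all
    moreover have "qpoch_inf 0 0 = 1"
      using qpoch_inf_LIMSEQ[of 0 0] by (simp add: qpoch_def LIMSEQ_const_iff)
    ultimately show ?thesis unfolding multisum_product_def by (simp only: mult_1 div_by_1)
  qed
  ultimately show "multisum_product 0 a b = sum (multisum_summand 0 a b p) {(\<lambda>_. 0, \<lambda>_. 0)}" by simp
  show "multisum_summand 0 a b p x = 0" if "x \<in> multisum_index_set a b p - {(\<lambda>_. 0, \<lambda>_. 0)}" for x
  proof -
    obtain n m where x: "x = (n, m)" by (cases x)
    have "multisum_exponent a b p (n, m) \<noteq> 0"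
      using that multisum_exponent_eq_0[OF _ assms(1,2)] unfolding x by blast
    thus ?thesis by (simp add: x multisum_summand_def)
  qed
qed (auto simp: multisum_index_set_def supported_def)

context nome
begin

lemma multisum_summand_no_m:
  assumes nm: "(n, m) \<in> multisum_index_set a b p" and p: "p = cfd a b"
  shows "multisum_summand q a b p (n, m) = (\<Prod>i\<in>{1..p}. rf (int (n i)))
     * q powi (\<Sum>i\<in>{1..Suc p}. (int (sum n {i..p} + m (Suc p)))\<^sup>2) * 1"
proof -
  have "m (Suc p) = 0" using assms by (simp add: multisum_index_set_def supported_def)
  thus ?thesis unfolding multisum_summand_def prod.case multisum_exponent_no_m[OF nm p]
    by (simp add: p qrf_def qpoch_def prod_dividef)
qed

lemma multisum_summand_eq:
  assumes nm: "(n, m) \<in> multisum_index_set a b p" and d: "cfd a b = Suc p + r" and T: "cfd a b \<in> tset a b"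
  shows "multisum_summand q a b p (n, m) = (\<Prod>i\<in>{1..p}. rf (int (n i)))
     * q powi (\<Sum>i\<in>{1..Suc p}. (int (sum n {i..p} + m (Suc p)))\<^sup>2) * burge_summand_inf (tset a b) r (Suc p) m"
proof -
  have m: "supported {p + 1..cfd a b} m" using nm by (simp add: multisum_index_set_def)
  have pd: "p < cfd a b" using d by simp
  define W where "W = (\<Prod>k\<in>{Suc (Suc p)..Suc p + r}. qbinom q (int (tau a b k * m k) - (int (m k) - int (m (k - 1)) + burge_index (tset a b) m k))
          (int (tau a b k * m k)))"
  have "burge_summand_inf (tset a b) r (Suc p) m = rf (int (tau a b (Suc p) * m (Suc p)))
     * (q powi (\<Sum>k\<in>{Suc p..<Suc p + r}. (burge_index (tset a b) m k)\<^sup>2) * W)"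
    using burge_summand_inf_eq[of "Suc p" m r "tset a b"] T m unfolding d tau_def W_def
    by (simp add: supported_def)
  moreover have "(\<Prod>j\<in>{p + 2..cfd a b}. qbinom q (int (tau a b j * m j) - (\<Sum>k\<in>{p + 1..cfd a b}. Cmat a b j k * int (m k)))
                    (int (tau a b j * m j))) = W"
    unfolding W_def
  proof (rule prod.cong)
    show "{p + 2..cfd a b} = {Suc (Suc p)..Suc p + r}" by (simp add: d)
    fix j assume "j \<in> {Suc (Suc p)..Suc p + r}"
    hence j: "1 \<le> j" by simp
    show "qbinom q (int (tau a b j * m j) - (\<Sum>k\<in>{p + 1..cfd a b}. Cmat a b j k * int (m k))) (int (tau a b j * m j))
      = qbinom q (int (tau a b j * m j) - (int (m j) - int (m (j - 1)) + burge_index (tset a b) m j)) (int (tau a b j * m j))"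
      unfolding Cmat_row[OF m j] ..
  qed
  moreover have "(\<Prod>i\<in>{1..p}. rf (int (n i))) = 1 / (\<Prod>i\<in>{1..p}. qpoch q q (n i))"
    by (simp add: qrf_def prod_dividef)
  moreover have "rf (int (tau a b (Suc p) * m (Suc p))) = 1 / qpoch q q (tau a b (Suc p) * m (Suc p))"
    by (rule rf_of_nat)
  ultimately show ?thesis
    unfolding multisum_summand_def prod.case multisum_exponent_eq[OF nm pd T] powi_add d Suc_eq_plus1[symmetric]
    by (simp only:) (simp add: mult_ac)
qed

text \<open>The Burge word produces the seed \<open>bailey_sum e b\<close>; \<open>p\<close> Bailey
  steps and the final limit then reach \<open>e + Suc p * b = a\<close>.\<close>

lemma multisum_has_sum_m:
  assumes d: "cfd a b = Suc p + r" and T: "cfd a b \<in> tset a b"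
    and ce: "burge_pair (burge_word (tset a b) r (Suc p)) = (b, e)" and a: "a = e + Suc p * b"
  shows "(multisum_summand q a b p has_sum multisum_product q a b) (multisum_index_set a b p)"
proof -
  obtain K where K: "K \<ge> 1" "\<And>N M. norm (qbinom q N M) \<le> K" "\<And>n. norm (rf n) \<le> K"
    using norm_qbinom_rf_bounded by blast
  have b: "b \<ge> 1" using burge_pair_pos[of "burge_word (tset a b) r (Suc p)"] ce by simp
  have base: "bounded_has_sum (burge_summand_inf (tset a b) r (Suc p)) (bailey_sum e b I) ((K * (real I + 1)) ^ Suc r)
     {m \<in> {m. supported {Suc p..Suc p + r} m}. m (Suc p) = I}" for I
    using burge_summand_inf_has_sum[OF K, of "tset a b" r "Suc p" I] by (simp add: burge_poly_inf_eq ce)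
  have set: "multisum_index_set a b p = {(n, m). supported {1..p} n \<and> m \<in> {m. supported {Suc p..Suc p + r} m}}"
    by (simp add: multisum_index_set_def d)
  show ?thesis
    unfolding multisum_product_def
    by (rule has_sum_cong[THEN iffD2, OF _ bailey_chain_has_sum[OF K(1,3) b base a, folded set]])
       (auto simp only: multisum_summand_eq[OF _ d T])
qed

text \<open>The chain starts from \<open>bailey_sum 0 1\<close>; its delta is the sum over the
  single tuple \<open>m = 0\<close>, which plays the part of the absent m variables.\<close>

lemma multisum_has_sum_no_m:
  assumes p: "p = cfd a 1" and a: "a = Suc p"
  shows "(multisum_summand q a 1 p has_sum multisum_product q a 1) (multisum_index_set a 1 p)"
proof -
  obtain K where K: "K \<ge> 1" "\<And>N M. norm (qbinom q N M) \<le> K" "\<And>n. norm (rf n) \<le> K"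
    using norm_qbinom_rf_bounded by blast
  have zero: "supported {p + 1..cfd a 1} m \<longleftrightarrow> m = (\<lambda>_. 0)" for m
    by (auto simp: p supported_def)
  have base: "bounded_has_sum (\<lambda>m :: nat \<Rightarrow> nat. 1) (bailey_sum 0 1 I) ((K * (real I + 1)) ^ 0)
     {m \<in> {\<lambda>_. 0}. m (Suc p) = I}" for I
  proof (cases "I = 0")
    case True
    hence "{m \<in> {\<lambda>_. 0 :: nat}. m (Suc p) = I} = {\<lambda>_. 0}" by auto
    thus ?thesis using bounded_has_sum_singleton[of "\<lambda>m :: nat \<Rightarrow> nat. 1" "\<lambda>_. 0" 1]
      unfolding bailey_sum_0_1 True by simp
  next
    case False
    hence e: "{m \<in> {\<lambda>_. 0 :: nat}. m (Suc p) = I} = {}" by auto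
    show ?thesis unfolding e bailey_sum_0_1 bounded_has_sum_def using False by (auto intro!: exI[of _ 0])
  qed
  have set: "multisum_index_set a 1 p = {(n, m). supported {1..p} n \<and> m \<in> {\<lambda>_. 0}}"
    unfolding multisum_index_set_def zero by simp
  have a': "a = 0 + Suc p * 1" by (simp add: a)
  show ?thesis
    unfolding multisum_product_def
    by (rule has_sum_cong[THEN iffD2, OF _ bailey_chain_has_sum[OF K(1,3) order_refl base a', folded set]])
       (auto simp only: multisum_summand_no_m[OF _ p])
qed

end

text \<open>The pair reached by the Burge word is coprime and has the ratio prescribed by the
  continued fraction, so it is determined by \<open>coprime_fraction_unique\<close>.\<close>

lemma multisum_has_sum_all:
  assumes q: "norm q < 1" and ab: "coprime a b" "1 \<le> b" "b < a"
    and p: "p = (if a \<le> 2 * b then 0 else cf_a0 a b)"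
  shows "(multisum_summand q a b p has_sum multisum_product q a b) (multisum_index_set a b p)"
proof -
  define l where "l = cf a b"
  have l: "l \<noteq> []" "\<forall>x\<in>set l. 0 < x" "cfval l = cf_target a b"
    using cf_properties[OF ab] by (auto simp: l_def)
  have d: "cfd a b = sum_list l" by (simp add: cfd_def l_def)
  have T: "tset a b = partial_sums l" by (simp add: tset_eq l_def)
  have dT: "cfd a b \<in> tset a b" using sum_list_in_partial_sums[OF l(1)] by (simp add: d T)
  have fr: "(of_nat a :: rat) / of_nat b - 1 = of_nat (a - b) / of_nat b"
    using ab by (simp add: of_nat_diff diff_divide_distrib)
  have cop: "coprime (a - b) b"
  proof -
    have "gcd (a - b) b = gcd a b" using ab by (intro gcd_diff1_nat) simp
    thus ?thesis using ab(1) by (simp only: coprime_iff_gcd_eq_1)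
  qed
  have d0: "sum_list l \<ge> 1" using l by (cases l) auto
  obtain y l' where yl: "l = y # l'" using l by (cases l) auto
  have a0: "cf_a0 a b = y" by (simp add: cf_a0_def l_def[symmetric] yl)
  have pd: "p \<le> cfd a b" using p by (simp add: d a0 yl)
  show ?thesis
  proof (cases "q = 0")
    case True
    thus ?thesis using multisum_has_sum_0[OF pd dT] ab by simp
  next
    case False
    then interpret nome q using q by unfold_locales
    show ?thesis
    proof (cases "a \<le> 2 * b")
      case True
      \<comment> \<open>Here the whole continued fraction goes into the Burge word, which yields
        \<open>(b, a - b)\<close>; the final limit turns \<open>a - b\<close> into
        \<open>a\<close>.\<close>
      have p0: "p = 0" using p True by simp
      define r where "r = sum_list l - 1"
      obtain c e where ce: "burge_pair (burge_word (tset a b) r (Suc 0)) = (c, e)"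
        by (cases "burge_pair (burge_word (tset a b) r (Suc 0))")
      have ce': "coprime c e" "cfval l = of_nat c / of_nat e"
        using burge_pair_cfval[OF l(1,2), of 0 "tset a b" c e] ce by (auto simp: T r_def)
      have "cf_target a b = of_nat b / of_nat (a - b)"
      proof (cases "a = 2 * b")
        case True
        thus ?thesis using ab by (simp add: cf_target_def)
      next
        case neq: False
        hence "a < 2 * b" "\<not> a > 2 * b" using True by simp_all
        thus ?thesis unfolding cf_target_def fr inverse_divide by (simp only: if_True if_False)
      qed
      moreover have "e \<ge> 1" using burge_pair_pos[of "burge_word (tset a b) r (Suc 0)"] ce by simp
      moreover have "coprime b (a - b)" using cop by (simp only: coprime_commute)
      ultimately have "c = b \<and> e = a - b"
        using coprime_fraction_unique[OF ce'(1), of b "a - b"] ce'(2) l(3) ab by simp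
      moreover have "cfd a b = Suc 0 + r" using d0 by (simp add: d r_def)
      ultimately show ?thesis unfolding p0
        using ab ce by (intro multisum_has_sum_m[OF _ dT]) auto
    next
      case less: False
      have py: "p = y" using p less a0 by simp
      have tgt: "cfval l = of_nat (a - b) / of_nat b"
        using less unfolding l(3) cf_target_def fr by simp
      show ?thesis
      proof (cases "l' = []")
        case True
        have "(of_nat y :: rat) / of_nat 1 = of_nat (a - b) / of_nat b"
          using tgt by (simp add: yl True)
        hence "y = a - b \<and> 1 = b"
          using coprime_fraction_unique[of y 1 "a - b" b] cop ab by simp
        hence b: "b = 1" and "a = Suc y" using ab by auto
        moreover have "y = cfd a b" by (simp add: d yl True)
        ultimately show ?thesis unfolding py by (simp only: multisum_has_sum_no_m)
      next
        case ne: False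
        have l'pos: "\<forall>x\<in>set l'. 0 < x" using l(2) by (simp add: yl)
        have s1: "sum_list l' \<ge> 1" using ne l'pos by (cases l') auto
        define r where "r = sum_list l' - 1"
        obtain c e where ce: "burge_pair (burge_word (tset a b) r (Suc y)) = (c, e)"
          by (cases "burge_pair (burge_word (tset a b) r (Suc y))")
        have mem: "\<forall>k\<in>{y<..<y + sum_list l'}. k \<in> tset a b \<longleftrightarrow> k - y \<in> partial_sums l'"
        proof
          fix k assume k: "k \<in> {y<..<y + sum_list l'}"
          have "k = y + (k - y)" using k by simp
          thus "k \<in> tset a b \<longleftrightarrow> k - y \<in> partial_sums l'"
            using add_in_partial_sums_Cons[of "k - y" y l'] k unfolding T yl by simp
        qed
        have ce': "coprime c e" "cfval l' = of_nat c / of_nat e"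
          using burge_pair_cfval[OF ne l'pos mem] ce by (auto simp: r_def)
        have pos: "c \<ge> 1" "e \<ge> 1" using burge_pair_pos[of "burge_word (tset a b) r (Suc y)"] ce by simp_all
        have "cfval l = of_nat y + 1 / cfval l'" unfolding yl using ne by (cases l') auto
        \<comment> \<open>The Burge word encodes only the tail \<open>l'\<close>; the first quotient
          \<open>y\<close> is realised by \<open>y\<close> Bailey steps from \<open>(c, e)\<close>,
          and the subtracted 1 in the target by the final limit.\<close>
        also have "\<dots> = of_nat (y * c + e) / of_nat c" using pos by (simp add: ce' field_simps)
        finally have "(of_nat (y * c + e) :: rat) / of_nat c = of_nat (a - b) / of_nat b" using tgt by simp
        moreover have "coprime (y * c + e) c"
          using ce'(1) by (rule coprime_mult_add)
        ultimately have cb: "y * c + e = a - b" "c = b"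
          using coprime_fraction_unique[of "y * c + e" c "a - b" b] cop pos ab by blast+
        have "a = a - b + b" using ab by simp
        hence "a = e + Suc y * b" using cb(1) unfolding cb(2) by simp
        moreover have "cfd a b = Suc y + r" using s1 by (simp add: d yl r_def)
        ultimately show ?thesis unfolding py using ce cb by (intro multisum_has_sum_m[OF _ dT]) auto
      qed
    qed
  qed
qed

theorem theorem3p7:
  fixes q :: complex and a b :: nat
  assumes "norm q < 1" and "coprime a b" and "1 \<le> b" and "b < a"
  shows
   "(a \<le> 2 * b \<longrightarrow>
      ((\<lambda>m :: nat \<Rightarrow> nat.
          q powi (\<Sum>j\<in>{1..cfd a b}. \<Sum>k\<in>{1..cfd a b}. int (m j) * Cmat a b j k * int (m k))
          / qpoch q q (tau a b 1 * m 1)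
          * (\<Prod>j\<in>{2..cfd a b}.
               qbinom q (int (tau a b j * m j) - (\<Sum>k\<in>{1..cfd a b}. Cmat a b j k * int (m k)))
                        (int (tau a b j * m j))))
       has_sum
         (qpoch_inf (q ^ (a * b)) (q ^ (2 * a * b + 1)) * qpoch_inf (q ^ (a * b + 1)) (q ^ (2 * a * b + 1))
          * qpoch_inf (q ^ (2 * a * b + 1)) (q ^ (2 * a * b + 1)) / qpoch_inf q q))
       {m. \<forall>k. k \<notin> {1..cfd a b} \<longrightarrow> m k = 0})
  \<and>
    (2 * b < a \<longrightarrow>
      ((\<lambda>(n :: nat \<Rightarrow> nat, m :: nat \<Rightarrow> nat).
          q powi ((\<Sum>i\<in>{1..cf_a0 a b}. (int (\<Sum>i'\<in>{i..cf_a0 a b}. n i') + int (m (cf_a0 a b + 1)))\<^sup>2)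
                  + (\<Sum>j\<in>{cf_a0 a b + 1..cfd a b}. \<Sum>k\<in>{cf_a0 a b + 1..cfd a b}.
                        int (m j) * Cmat a b j k * int (m k)))
          / ((\<Prod>i\<in>{1..cf_a0 a b}. qpoch q q (n i)) * qpoch q q (tau a b (cf_a0 a b + 1) * m (cf_a0 a b + 1)))
          * (\<Prod>j\<in>{cf_a0 a b + 2..cfd a b}.
               qbinom q (int (tau a b j * m j) - (\<Sum>k\<in>{cf_a0 a b + 1..cfd a b}. Cmat a b j k * int (m k)))
                        (int (tau a b j * m j))))
       has_sum
         (qpoch_inf (q ^ (a * b)) (q ^ (2 * a * b + 1)) * qpoch_inf (q ^ (a * b + 1)) (q ^ (2 * a * b + 1))
          * qpoch_inf (q ^ (2 * a * b + 1)) (q ^ (2 * a * b + 1)) / qpoch_inf q q))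
       {(n, m). (\<forall>i. i \<notin> {1..cf_a0 a b} \<longrightarrow> n i = 0) \<and>
                (\<forall>k. k \<notin> {cf_a0 a b + 1..cfd a b} \<longrightarrow> m k = 0)})"
proof (intro conjI impI)
  assume "a \<le> 2 * b"
  hence *: "(multisum_summand q a b 0 has_sum multisum_product q a b) (multisum_index_set a b 0)"
    using multisum_has_sum_all[OF assms refl] by simp
  have bij: "bij_betw (\<lambda>m. (\<lambda>_. 0, m)) {m. \<forall>k. k \<notin> {1..cfd a b} \<longrightarrow> m k = 0} (multisum_index_set a b 0)"
    by (rule bij_betwI[where g = snd]) (auto simp: multisum_index_set_def supported_def)
  show "((\<lambda>m :: nat \<Rightarrow> nat.
          q powi (\<Sum>j\<in>{1..cfd a b}. \<Sum>k\<in>{1..cfd a b}. int (m j) * Cmat a b j k * int (m k))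
          / qpoch q q (tau a b 1 * m 1)
          * (\<Prod>j\<in>{2..cfd a b}.
               qbinom q (int (tau a b j * m j) - (\<Sum>k\<in>{1..cfd a b}. Cmat a b j k * int (m k)))
                        (int (tau a b j * m j))))
       has_sum
         (qpoch_inf (q ^ (a * b)) (q ^ (2 * a * b + 1)) * qpoch_inf (q ^ (a * b + 1)) (q ^ (2 * a * b + 1))
          * qpoch_inf (q ^ (2 * a * b + 1)) (q ^ (2 * a * b + 1)) / qpoch_inf q q))
       {m. \<forall>k. k \<notin> {1..cfd a b} \<longrightarrow> m k = 0}"
    using *[folded has_sum_reindex_bij_betw[OF bij]]
    by (simp add: multisum_summand_def multisum_exponent_def multisum_product_def numeral_2_eq_2)
next
  assume "2 * b < a"
  hence "(multisum_summand q a b (cf_a0 a b) has_sum multisum_product q a b) (multisum_index_set a b (cf_a0 a b))"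
    using multisum_has_sum_all[OF assms refl] by simp
  thus "((\<lambda>(n :: nat \<Rightarrow> nat, m :: nat \<Rightarrow> nat).
          q powi ((\<Sum>i\<in>{1..cf_a0 a b}. (int (\<Sum>i'\<in>{i..cf_a0 a b}. n i') + int (m (cf_a0 a b + 1)))\<^sup>2)
                  + (\<Sum>j\<in>{cf_a0 a b + 1..cfd a b}. \<Sum>k\<in>{cf_a0 a b + 1..cfd a b}.
                        int (m j) * Cmat a b j k * int (m k)))
          / ((\<Prod>i\<in>{1..cf_a0 a b}. qpoch q q (n i)) * qpoch q q (tau a b (cf_a0 a b + 1) * m (cf_a0 a b + 1)))
          * (\<Prod>j\<in>{cf_a0 a b + 2..cfd a b}.
               qbinom q (int (tau a b j * m j) - (\<Sum>k\<in>{cf_a0 a b + 1..cfd a b}. Cmat a b j k * int (m k)))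
                        (int (tau a b j * m j))))
       has_sum
         (qpoch_inf (q ^ (a * b)) (q ^ (2 * a * b + 1)) * qpoch_inf (q ^ (a * b + 1)) (q ^ (2 * a * b + 1))
          * qpoch_inf (q ^ (2 * a * b + 1)) (q ^ (2 * a * b + 1)) / qpoch_inf q q))
       {(n, m). (\<forall>i. i \<notin> {1..cf_a0 a b} \<longrightarrow> n i = 0) \<and>
                (\<forall>k. k \<notin> {cf_a0 a b + 1..cfd a b} \<longrightarrow> m k = 0)}"
    unfolding multisum_summand_def multisum_exponent_def multisum_product_def multisum_index_set_def supported_def prod.case .
qed

end
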